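(* Let $\mathbb F$ be an algebraically closed field of characteristic $p>0$, let $n\ge 3$, $G=\mathrm{SL}_n(\mathbb F)$, let $\omega\in X^+(T)$ be a dominant weight and let $k\in\{0,\ldots,p-1\}$. (i) If $\langle\omega,\alpha_1\rangle-l\not\equiv0\pmod p$ for every $l=0,\ldots,k-1$ and there is $m\in\{0,\ldots,k\}$ such that the Weyl $G^{(1)}$-module $\Delta(\bar\omega+m\bar\omega_2)$ is simple, then the $G^{(1)}$-submodule of the simple $G$-module $L(\omega)$ generated by $X_{-\alpha_1,k}v^+_\omega$ is isomorphic to the Weyl $G^{(1)}$-module $\Delta(\bar\omega+k\bar\omega_2)$. (ii) If $\langle\omega,\alpha_{n-1}\rangle-l\not\equiv0\pmod p$ for every $l=0,\ldots,k-1$ and there is $m\in\{0,\ldots,k\}$ such that the Weyl $G^{(n-1)}$-module $\Delta(\bar{\bar\omega}+m\bar{\bar\omega}_{n-2})$ is simple, then the $G^{(n-1)}$-submodule of $L(\omega)$ generated by $X_{-\alpha_{n-1},k}v^+_\omega$ is isomorphic to the Weyl $G^{(n-1)}$-module $\Delta(\bar{\bar\omega}+k\bar{\bar\omega}_{n-2})$.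
   Context: Notation. $E$ is the identity $n\times n$ matrix and $e_{i,j}$ the matrix units. $T\subset G=\mathrm{SL}_n(\mathbb F)$ is the torus of diagonal matrices, $B$ the Borel subgroup of upper triangular matrices. Simple roots $\alpha_1,\ldots,\alpha_{n-1}$ are ordered so that the root elements are $x_{\alpha_i+\cdots+\alpha_{j-1}}(t)=E+te_{i,j}$ and $x_{-\alpha_i-\cdots-\alpha_{j-1}}(t)=E+te_{j,i}$ for $1\le i<j\le n$; positive roots are $\alpha_i+\cdots+\alpha_{j-1}$. $\omega_1,\ldots,\omega_{n-1}$ are the fundamental weights, $X(T)$ the weights and $X^+(T)$ the dominant weights of $T$; $\langle\omega,\alpha\rangle$ is the pairing of $\omega$ with the coroot of $\alpha$, so $\langle\omega,\alpha_i\rangle=a_i$ if $\omega=a_1\omega_1+\cdots+a_{n-1}\omega_{n-1}$. Subgroups. For $q\in\{1,n-1\}$, $G^{(q)}$ is the subgroup of $G$ generated by all $x_{\alpha_i}(t),x_{-\alpha_i}(t)$ with $t\in\mathbb F$, $i\in\{1,\ldots,n-1\}\setminus\{q\}$ (a copy of $\mathrm{SL}_{n-1}(\mathbb F)$ in the bottom right corner if $q=1$, in the top left corner if $q=n-1$). $T^{(q)}$ is its maximal torus generated by $h_{\alpha_i}(t)=\mathrm{diag}(1,\ldots,1,t,t^{-1},1,\ldots,1)$ ($t\in\mathbb F^*$ in position $i$), $i\ne q$, and $B^{(q)}$ is its Borel subgroup generated by $T^{(q)}$ and the $x_\alpha(t)$ for positive roots $\alpha$ that are integer combinations of the $\alpha_i$,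 $i\ne q$. For $\kappa\in X(T)$, $\bar\kappa$ denotes the restriction of $\kappa$ to $T^{(1)}$ and $\bar{\bar\kappa}$ the restriction of $\kappa$ to $T^{(n-1)}$. Modules. $L(\omega)$ and $\Delta(\omega)$ are the simple rational $G$-module and the Weyl $G$-module of highest weight $\omega$; $v^+_\omega\in L(\omega)$ is a fixed nonzero vector of weight $\omega$. The same notation $\Delta(\cdot)$ is used for Weyl modules over $G^{(q)}$ with respect to the maximal torus $T^{(q)}$ and the Borel subgroup $B^{(q)}$ of $G^{(q)}$. Divided powers. On a rational $G$-module $V$, the operators $X_{\alpha,m}$ ($\alpha$ a root, $m\ge0$) are the divided-power elements of the hyperalgebra of $G$, determined by $x_\alpha(t)v=\sum_{m\ge0}t^mX_{\alpha,m}v$ for all $t\in\mathbb F$, $v\in V$. *)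

theory Defs
  imports
    "Jordan_Normal_Form.Determinant"
    "HOL-Algebra.Generated_Groups"
    "HOL-Computational_Algebra.Computational_Algebra"
    "HOL-Number_Theory.Cong"
    "HOL-Library.Function_Algebras"
    "HOL-Library.FuncSet"
    "HOL.Hull"
begin

section \<open>The group, its root elements and its subgroups\<close>

text \<open>
  Rows and columns of the library's matrices are numbered from 0. All index arguments below
  (positions of matrix units, numbers of simple roots and of fundamental weights) start from 1.
\<close>

definition SL :: "nat \<Rightarrow> 'a::field mat monoid" where
  "SL n = \<lparr>carrier = {A \<in> carrier_mat n n. det A = 1}, mult = (*), one = 1\<^sub>m n\<rparr>"

text \<open>
  The matrix \<open>E + t e\<^bsub>i,j\<^esub>\<close>. For \<open>i < j\<close> it is the root element of the
  positive root \<open>\<alpha>\<^sub>i + \<dots> + \<alpha>\<^bsub>j-1\<^esub>\<close>, for \<open>i > j\<close> that of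
  \<open>-(\<alpha>\<^sub>j + \<dots> + \<alpha>\<^bsub>i-1\<^esub>)\<close>. The root itself is represented by the pair \<open>i, j\<close>.
\<close>

definition root_elem :: "nat \<Rightarrow> nat \<Rightarrow> nat \<Rightarrow> 'a::field \<Rightarrow> 'a mat" where
  "root_elem n i j t =
     mat n n (\<lambda>(r, c). if r = c then 1 else if r + 1 = i \<and> c + 1 = j then t else 0)"

definition coroot_elem :: "nat \<Rightarrow> nat \<Rightarrow> 'a::field \<Rightarrow> 'a mat" where
  "coroot_elem n i t =
     mat n n (\<lambda>(r, c). if r \<noteq> c then 0 else if r + 1 = i then t
                      else if r = i then inverse t else 1)"

definition torus :: "nat \<Rightarrow> 'a::field mat set" where
  "torus n = {A \<in> carrier (SL n). diagonal_mat A}"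

definition G_sub :: "nat \<Rightarrow> nat \<Rightarrow> 'a::field mat set" where
  "G_sub n q = generate (SL n)
     (\<Union>i\<in>{1..n-1} - {q}. range (root_elem n i (i+1)) \<union> range (root_elem n (i+1) i))"

definition T_sub :: "nat \<Rightarrow> nat \<Rightarrow> 'a::field mat set" where
  "T_sub n q = generate (SL n) (\<Union>i\<in>{1..n-1} - {q}. coroot_elem n i ` (UNIV - {0}))"

text \<open>
  The root \<open>\<alpha>\<^sub>i + \<dots> + \<alpha>\<^bsub>j-1\<^esub>\<close> is an integer combination of the simple roots
  other than \<open>\<alpha>\<^sub>q\<close> iff \<open>q \<notin> {i..<j}\<close>.
\<close>

definition B_sub :: "nat \<Rightarrow> nat \<Rightarrow> 'a::field mat set" where
  "B_sub n q = generate (SL n)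
     (T_sub n q \<union> \<Union> {range (root_elem n i j) | i j. 1 \<le> i \<and> i < j \<and> j \<le> n \<and> q \<notin> {i..<j}})"


section \<open>Regular functions and weights\<close>

inductive_set poly_fun :: "nat \<Rightarrow> ('a::field mat \<Rightarrow> 'a) set" for n :: nat where
  const: "(\<lambda>_. c) \<in> poly_fun n"
| entry: "i < n \<Longrightarrow> j < n \<Longrightarrow> (\<lambda>A. A $$ (i, j)) \<in> poly_fun n"
| add: "f \<in> poly_fun n \<Longrightarrow> g \<in> poly_fun n \<Longrightarrow> (\<lambda>A. f A + g A) \<in> poly_fun n"
| mult: "f \<in> poly_fun n \<Longrightarrow> g \<in> poly_fun n \<Longrightarrow> (\<lambda>A. f A * g A) \<in> poly_fun n"

text \<open>
  This is meant for closed subgroups \<open>H\<close> of \<open>SL n\<close>. As these are closed subsets of the affine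
  space of all matrices, the inverse of the determinant need not be adjoined.
\<close>

definition regular_on :: "nat \<Rightarrow> 'a::field mat set \<Rightarrow> ('a mat \<Rightarrow> 'a) \<Rightarrow> bool" where
  "regular_on n H f \<longleftrightarrow> (\<exists>P \<in> poly_fun n. \<forall>A\<in>H. f A = P A)"

text \<open>
  Weights are kept as multiplicative functions, so the additively written group of weights is
  the pointwise multiplication here. Only the values on the torus \<open>S\<close> matter.
\<close>

definition weights :: "nat \<Rightarrow> 'a::field mat set \<Rightarrow> ('a mat \<Rightarrow> 'a) set" where
  "weights n S = {\<chi>. regular_on n S \<chi> \<and> (\<forall>s\<in>S. \<chi> s \<noteq> 0) \<and>
                     (\<forall>s\<in>S. \<forall>t\<in>S. \<chi> (s * t) = \<chi> s * \<chi> t)}"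

definition pairing :: "nat \<Rightarrow> ('a::field mat \<Rightarrow> 'a) \<Rightarrow> nat \<Rightarrow> int" where
  "pairing n \<chi> i = (THE a. \<forall>t. t \<noteq> 0 \<longrightarrow> \<chi> (coroot_elem n i t) = t powi a)"

definition dominant_weights :: "nat \<Rightarrow> ('a::field mat \<Rightarrow> 'a) set" where
  "dominant_weights n = {\<chi> \<in> weights n (torus n). \<forall>i\<in>{1..n-1}. pairing n \<chi> i \<ge> 0}"

definition fund_weight :: "nat \<Rightarrow> 'a::field mat \<Rightarrow> 'a" where
  "fund_weight i t = (\<Prod>r<i. t $$ (r, r))"

definition simple_root :: "nat \<Rightarrow> 'a::field mat \<Rightarrow> 'a" where
  "simple_root i t = t $$ (i - 1, i - 1) / t $$ (i, i)"

definition weight_le :: "nat \<Rightarrow> ('a::field mat \<Rightarrow> 'a) \<Rightarrow> ('a mat \<Rightarrow> 'a) \<Rightarrow> bool" where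
  "weight_le n \<mu> \<omega> \<longleftrightarrow>
     (\<exists>c :: nat \<Rightarrow> nat. \<forall>t\<in>torus n. \<omega> t = \<mu> t * (\<Prod>i=1..n-1. simple_root i t ^ c i))"


section \<open>Modules over a subgroup of the special linear group\<close>

text \<open>
  The underlying space \<open>rspace\<close> may be a proper subspace of the ambient type, so that a submodule
  is obtained by replacing the underlying space only.
\<close>

record ('a, 'v) repn =
  rspace :: "'v set"
  rscale :: "'a \<Rightarrow> 'v \<Rightarrow> 'v"
  ract :: "'a mat \<Rightarrow> 'v \<Rightarrow> 'v"

definition linear_action :: "nat \<Rightarrow> 'a::field mat set \<Rightarrow> ('a, 'v::ab_group_add) repn \<Rightarrow> bool" where
  "linear_action n H V \<longleftrightarrow>
     vector_space (rscale V) \<and> Modules.module.subspace (rscale V) (rspace V) \<and>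
     (\<forall>g\<in>H. \<forall>v\<in>rspace V. ract V g v \<in> rspace V) \<and>
     (\<forall>g\<in>H. \<forall>v\<in>rspace V. \<forall>w\<in>rspace V. ract V g (v + w) = ract V g v + ract V g w) \<and>
     (\<forall>g\<in>H. \<forall>c. \<forall>v\<in>rspace V. ract V g (rscale V c v) = rscale V c (ract V g v)) \<and>
     (\<forall>v\<in>rspace V. ract V (1\<^sub>m n) v = v) \<and>
     (\<forall>g\<in>H. \<forall>h\<in>H. \<forall>v\<in>rspace V. ract V (g * h) v = ract V g (ract V h v))"

text \<open>
  Rationality is the existence of the comodule map
  \<open>v \<mapsto> \<Sum>\<^sub>i w\<^sub>i \<otimes> f\<^sub>i\<close> with \<open>g v = \<Sum>\<^sub>i f\<^sub>i(g) w\<^sub>i\<close>; the module may be infinite-dimensional.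
\<close>

definition rational_module :: "nat \<Rightarrow> 'a::field mat set \<Rightarrow> ('a, 'v::ab_group_add) repn \<Rightarrow> bool" where
  "rational_module n H V \<longleftrightarrow> linear_action n H V \<and>
     (\<forall>v\<in>rspace V. \<exists>(r::nat) w f. (\<forall>i<r. w i \<in> rspace V \<and> regular_on n H (f i)) \<and>
        (\<forall>g\<in>H. ract V g v = (\<Sum>i<r. rscale V (f i g) (w i))))"

definition submodule :: "'a::field mat set \<Rightarrow> ('a, 'v::ab_group_add) repn \<Rightarrow> 'v set \<Rightarrow> bool" where
  "submodule H V W \<longleftrightarrow> W \<subseteq> rspace V \<and> Modules.module.subspace (rscale V) W \<and>
     (\<forall>g\<in>H. \<forall>w\<in>W. ract V g w \<in> W)"

definition simple_module :: "'a::field mat set \<Rightarrow> ('a, 'v::ab_group_add) repn \<Rightarrow> bool" where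
  "simple_module H V \<longleftrightarrow> rspace V \<noteq> {0} \<and>
     (\<forall>W. submodule H V W \<longrightarrow> W = {0} \<or> W = rspace V)"

definition generated_submodule ::
    "'a::field mat set \<Rightarrow> ('a, 'v::ab_group_add) repn \<Rightarrow> 'v \<Rightarrow> ('a, 'v) repn" where
  "generated_submodule H V v = V\<lparr>rspace := submodule H V hull {v}\<rparr>"

definition module_isomorphic ::
    "'a::field mat set \<Rightarrow> ('a, 'v::ab_group_add) repn \<Rightarrow> ('a, 'w::ab_group_add) repn \<Rightarrow> bool" where
  "module_isomorphic H V W \<longleftrightarrow> (\<exists>\<phi>. bij_betw \<phi> (rspace V) (rspace W) \<and>
     (\<forall>v\<in>rspace V. \<forall>w\<in>rspace V. \<phi> (v + w) = \<phi> v + \<phi> w) \<and>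
     (\<forall>c. \<forall>v\<in>rspace V. \<phi> (rscale V c v) = rscale W c (\<phi> v)) \<and>
     (\<forall>g\<in>H. \<forall>v\<in>rspace V. \<phi> (ract V g v) = ract W g (\<phi> v)))"

definition weight_space ::
    "'a::field mat set \<Rightarrow> ('a, 'v::ab_group_add) repn \<Rightarrow> ('a mat \<Rightarrow> 'a) \<Rightarrow> 'v set" where
  "weight_space S V \<mu> = {v \<in> rspace V. \<forall>t\<in>S. ract V t v = rscale V (\<mu> t) v}"

text \<open>
  The simple rational module \<open>L(\<omega>)\<close> for \<open>SL n\<close>, which is unique up to isomorphism.
\<close>

definition is_simple_hw_module ::
    "nat \<Rightarrow> ('a::field mat \<Rightarrow> 'a) \<Rightarrow> ('a, 'v::ab_group_add) repn \<Rightarrow> bool" where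
  "is_simple_hw_module n \<omega> L \<longleftrightarrow>
     rational_module n (carrier (SL n)) L \<and> simple_module (carrier (SL n)) L \<and>
     weight_space (torus n) L \<omega> \<noteq> {0} \<and>
     (\<forall>\<mu>\<in>weights n (torus n). weight_space (torus n) L \<mu> \<noteq> {0} \<longrightarrow> weight_le n \<mu> \<omega>)"

text \<open>
  \<open>X\<^bsub>\<alpha>,m\<^esub>\<close> for the root \<open>\<alpha>\<close> with root elements \<open>root_elem n i j t\<close>: the coefficient of \<open>t\<^sup>m\<close>
  in the action of these elements. Over an infinite field the coefficients are unique.
\<close>

definition divided_power ::
    "nat \<Rightarrow> ('a::field, 'v::ab_group_add) repn \<Rightarrow> nat \<Rightarrow> nat \<Rightarrow> nat \<Rightarrow> 'v \<Rightarrow> 'v" where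
  "divided_power n V i j m v =
     (THE X :: nat \<Rightarrow> 'v. (\<forall>l. X l \<in> rspace V) \<and> finite {l. X l \<noteq> 0} \<and>
        (\<forall>t. ract V (root_elem n i j t) v = (\<Sum>l | X l \<noteq> 0. rscale V (t ^ l) (X l)))) m"


section \<open>Weyl modules\<close>

definition diag_part :: "nat \<Rightarrow> 'a::field mat \<Rightarrow> 'a mat" where
  "diag_part n b = mat n n (\<lambda>(r, c). if r = c then b $$ (r, c) else 0)"

text \<open>
  Let \<open>H\<close> be one of the groups above with a Borel subgroup \<open>B\<close> of upper triangular matrices and
  its maximal torus \<open>S\<close> of diagonal ones. A weight \<open>\<kappa>\<close> of \<open>S\<close> is extended to \<open>B\<close> along the
  projection \<open>diag_part n\<close> of \<open>B\<close> onto \<open>S\<close>, whose kernel is the unipotent radical.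
  The following is the module induced from the one-dimensional \<open>B\<close>-module of weight \<open>-\<kappa>\<close>,
  consisting of the regular functions \<open>f\<close> on \<open>H\<close> with \<open>f(gb) = \<kappa>(b) f(g)\<close>, on which \<open>H\<close> acts by
  left translations. Functions are set to 0 outside \<open>H\<close>.
\<close>

definition induced_module ::
    "nat \<Rightarrow> 'a::field mat set \<Rightarrow> 'a mat set \<Rightarrow> ('a mat \<Rightarrow> 'a) \<Rightarrow> ('a, 'a mat \<Rightarrow> 'a) repn" where
  "induced_module n H B \<kappa> =
     \<lparr>rspace = {f. regular_on n H f \<and> (\<forall>g. g \<notin> H \<longrightarrow> f g = 0) \<and>
                   (\<forall>g\<in>H. \<forall>b\<in>B. f (g * b) = \<kappa> (diag_part n b) * f g)},
      rscale = (\<lambda>c f g. c * f g),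
      ract = (\<lambda>x f g. if g \<in> H then f (inv\<^bsub>SL n\<^esub> x * g) else 0)\<rparr>"

text \<open>The linear functionals on \<open>V\<close>, set to 0 outside \<open>V\<close>, with the contragredient action.\<close>

definition dual_module ::
    "nat \<Rightarrow> ('a::field, 'v::ab_group_add) repn \<Rightarrow> ('a, 'v \<Rightarrow> 'a) repn" where
  "dual_module n V =
     \<lparr>rspace = {\<phi>. (\<forall>v. v \<notin> rspace V \<longrightarrow> \<phi> v = 0) \<and>
                   (\<forall>v\<in>rspace V. \<forall>w\<in>rspace V. \<phi> (v + w) = \<phi> v + \<phi> w) \<and>
                   (\<forall>c. \<forall>v\<in>rspace V. \<phi> (rscale V c v) = c * \<phi> v)},
      rscale = (\<lambda>c \<phi> v. c * \<phi> v),
      ract = (\<lambda>x \<phi> v. if v \<in> rspace V then \<phi> (ract V (inv\<^bsub>SL n\<^esub> x) v) else 0)\<rparr>"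

text \<open>
  The Weyl module of highest weight \<open>\<kappa>\<close> with respect to \<open>B\<close> is the dual of the space of
  global sections of the line bundle on \<open>H / B\<close> given by \<open>\<kappa>\<close>. In terms of the Borel subgroup
  opposite to \<open>B\<close>, the same module is usually written \<open>H\<^sup>0(-w\<^sub>0\<kappa>)\<^sup>*\<close>; the two are identified by
  right translation with a representative of the longest Weyl group element \<open>w\<^sub>0\<close>.
  The functional \<open>f \<mapsto> f(E)\<close> is the vector of highest weight \<open>\<kappa>\<close>.
\<close>

definition weyl_module ::
    "nat \<Rightarrow> 'a::field mat set \<Rightarrow> 'a mat set \<Rightarrow> ('a mat \<Rightarrow> 'a) \<Rightarrow>
      ('a, ('a mat \<Rightarrow> 'a) \<Rightarrow> 'a) repn" where
  "weyl_module n H B \<kappa> = dual_module n (induced_module n H B \<kappa>)"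

end

theory Submission
  imports Defs "HOL-Library.Infinite_Typeclass"
begin

text \<open>
  Let \<open>v\<^sub>j\<close> be the coefficient of \<open>s\<^sup>j\<close> in \<open>y(s) v\<close>, where \<open>y\<close> is the root subgroup of the removed
  negative simple root, let \<open>H\<close> be the corner subgroup and \<open>\<lambda>\<^sub>j\<close> the weight of \<open>v\<^sub>j\<close>. The functions
  \<open>g \<mapsto> \<xi>(g v\<^sub>j)\<close> on \<open>H\<close>, for linear forms \<open>\<xi>\<close> on \<open>L(\<omega>)\<close>, form a submodule \<open>F\<^sub>j\<close> of the induced module
  \<open>Ind(\<lambda>\<^sub>j)\<close>, and \<open>v\<^sub>j\<close> generates a Weyl module as soon as \<open>F\<^sub>j = Ind(\<lambda>\<^sub>j)\<close>. This equality holds for \<open>j = m\<close>,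
  since the simplicity of the Weyl module forces the annihilator of \<open>F\<^sub>m\<close> to vanish.

  It passes from \<open>j\<close> to \<open>j + 1\<close>. Moving a root element \<open>x\<^sub>i(t)\<close> with \<open>i\<close> in the corner past \<open>g y(s)\<close> gives
  \<open>\<phi>\<^sub>i F\<^sub>j \<subseteq> F\<^bsub>j+1\<^esub>\<close>, where the \<open>\<phi>\<^sub>i\<close> are the entries of the first column of \<open>g\<close> (first corner) or, up to
  sign, the minors of \<open>g\<close> omitting the last column (second corner). It remains to see that these minors
  and \<open>Ind(\<lambda>\<^sub>j)\<close> generate \<open>Ind(\<lambda>\<^bsub>j+1\<^esub>)\<close>. This follows because the functions on matrices invariant under
  unipotent column operations are spanned by products of minors in the leftmost columns: the leading
  exponents of an invariant satisfy the ballot inequalities of semistandard tableaux, every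
  such exponent is the leading one of a product of minors, and one subtracts.
\<close>

text \<open>In characteristic p many non-isomorphic modules share a highest weight, so the submodule
  generated by \<open>v\<^sub>j\<close> cannot be recognised by its weight alone. Functions decide
  instead: this submodule has finite dimension and \<open>F\<^sub>j\<close> is its full dual, so
  \<open>F\<^sub>j = Ind\<close> identifies it with the dual of the induced module. The condition on
  l enters through one formula. With a the pairing of \<omega> with the removed coroot and z = 1 + s
  t \<phi>(g), moving x(t) past g y(s) gives x(t) g y(s) v = z^a g y(s/z) v, and its linear part in
  t produces the factor a - j. This factor must be invertible twice: to keep the vectors
  \<open>v\<^sub>j\<close> nonzero and to divide by it when passing to the next level. The passage
  also needs a multiplication of sections to be surjective in every characteristic. Leading
  exponents give this over any infinite field, because a leading coefficient can always be divided
  out. They need polynomials on all matrices, whereas sections live on the group; the extension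
  costs a power of the determinant, which adds full columns to the tableaux and leaves the
  differences of row lengths unchanged.\<close>

instance alg_closed_field \<subseteq> infinite
proof
  show "infinite (UNIV :: 'a set)"
  proof
    assume fin: "finite (UNIV :: 'a set)"
    define p where "p = (\<Prod>a\<in>(UNIV::'a set). [:-a, 1:]) + 1"
    have "degree (\<Prod>a\<in>(UNIV::'a set). [:-a, 1:]) = card (UNIV :: 'a set)"
      by (subst degree_prod_eq_sum_degree) auto
    then have "degree (\<Prod>a\<in>(UNIV::'a set). [:-a, 1:]) > 0"
      using fin by (simp add: card_gt_0_iff)
    then have "degree p > 0"
      unfolding p_def by (subst degree_add_eq_left) auto
    then obtain z where "poly p z = 0"
      using alg_closed_imp_poly_has_root by blast
    moreover have "poly (\<Prod>a\<in>(UNIV::'a set). [:-a, 1:]) z = 0"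
      using fin by (simp add: poly_prod) 
    ultimately show False
      unfolding p_def by simp
  qed
qed

section \<open>Polynomial identities and degree bounds tested on an infinite field\<close>

lemma poly_eqI_infinite:
  fixes p q :: "'a::{field,infinite} poly"
  assumes "\<And>x. poly p x = poly q x"
  shows "p = q"
proof (rule ccontr)
  assume "p \<noteq> q"
  then have "finite {x. poly (p - q) x = 0}"
    by (intro poly_roots_finite) simp
  moreover have "{x. poly (p - q) x = 0} = UNIV"
    using assms by simp
  ultimately show False
    using infinite_UNIV[where 'a='a] by simp
qed

lemma poly_eqI_infinite_nz:
  fixes p q :: "'a::{field,infinite} poly"
  assumes "\<And>x. x \<noteq> 0 \<Longrightarrow> poly p x = poly q x"
  shows "p = q"
proof -
  \<comment> \<open>Multiplication by the indeterminate makes both sides agree at the missing point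
    0.\<close>
  have "[:0, 1:] * p = [:0, 1:] * q"
    by (rule poly_eqI_infinite) (use assms in auto)
  then show ?thesis
    by simp
qed

lemma coeff_eq_of_sums_eq:
  fixes a b :: "nat \<Rightarrow> 'a::{field,infinite}"
  assumes "\<And>z. (\<Sum>k\<le>d. z ^ k * a k) = (\<Sum>k\<le>d. z ^ k * b k)" and "k \<le> d"
  shows "a k = b k"
proof -
  have "(\<Sum>k\<le>d. monom (a k) k) = (\<Sum>k\<le>d. monom (b k) k)"
    by (rule poly_eqI_infinite) (use assms(1) in \<open>simp add: poly_sum poly_monom mult.commute\<close>)
  then have "coeff (\<Sum>k\<le>d. monom (a k) k) k = coeff (\<Sum>k\<le>d. monom (b k) k) k"
    by simp
  then show ?thesis
    using assms(2) by (simp add: coeff_sum)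
qed

text \<open>For \<open>i > d\<close> the coefficients of index \<open>i\<close> of the
  \<open>p k\<close> are those of a polynomial in \<open>z\<close> that vanishes everywhere. So
  cancellation for all \<open>z\<close> at once cannot hide a high degree.\<close>

lemma degree_le_of_sums_degree_le:
  fixes p :: "nat \<Rightarrow> 'a::{field,infinite} poly"
  assumes "\<And>z. degree (\<Sum>k\<le>m. smult (z ^ k) (p k)) \<le> d" and "k \<le> m"
  shows "degree (p k) \<le> d"
proof (rule degree_le, intro allI impI)
  fix i assume "d < i"
  have "(\<Sum>k\<le>m. z ^ k * coeff (p k) i) = (\<Sum>k\<le>m. z ^ k * 0)" for z
  proof -
    have "coeff (\<Sum>k\<le>m. smult (z ^ k) (p k)) i = 0"
      using assms(1)[of z] \<open>d < i\<close> by (intro coeff_eq_0) linarith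
    then show ?thesis
      by (simp add: coeff_sum)
  qed
  then show "coeff (p k) i = 0"
    using coeff_eq_of_sums_eq[where d = m and k = k and a = "\<lambda>k. coeff (p k) i" and b = "\<lambda>_. 0"] assms(2) by blast
qed

lemma zero_of_sums_zero:
  fixes p :: "nat \<Rightarrow> 'a::{field,infinite} poly"
  assumes "\<And>z. (\<Sum>k\<le>m. smult (z ^ k) (p k)) = 0" and "k \<le> m"
  shows "p k = 0"
proof (rule poly_eqI)
  fix i
  have "(\<Sum>k\<le>m. z ^ k * coeff (p k) i) = (\<Sum>k\<le>m. z ^ k * 0)" for z
    using arg_cong[OF assms(1)[of z], of "\<lambda>q. coeff q i"] by (simp add: coeff_sum)
  then show "coeff (p k) i = coeff 0 i"
    using coeff_eq_of_sums_eq[where d = m and k = k and a = "\<lambda>k. coeff (p k) i" and b = "\<lambda>_. 0"] assms(2) by simp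
qed

lemma smult_sum_right: "smult c (sum f A) = (\<Sum>i\<in>A. smult c (f i))"
  by (induction A rule: infinite_finite_induct) (auto simp: smult_add_right)

text \<open>
  With \<open>p\<^sub>i = p (a - i) (b + i)\<close>, the part of degree \<open>a + b\<close> in \<open>y, z\<close> is, at \<open>y = 1\<close>, the product of
  \<open>(z + t)\<^sup>b\<close> and \<open>Q(z) = \<Sum>\<^sub>i (z + t)\<^sup>i p\<^sub>i\<close>. So the coefficients of \<open>Q\<close> have degree at most \<open>d - b\<close> in \<open>t\<close>,
  and \<open>Q(-t) = p a b\<close>.
\<close>
lemma bivariate_degree:
  fixes p :: "nat \<Rightarrow> nat \<Rightarrow> 'a::{field,infinite} poly"
  assumes deg: "\<And>y z. degree (\<Sum>k\<le>a. \<Sum>s\<le>S. smult (y ^ k) ([:z, y:] ^ s * p k s)) \<le> d"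
    and top: "\<And>s. s > b \<Longrightarrow> p a s = 0" and S: "b + a \<le> S"
  shows "degree (p a b) \<le> d + a - b" and "d < b \<Longrightarrow> p a b = 0"
proof -
  define W where "W z = (\<Sum>i\<le>a. [:z, 1:] ^ i * p (a - i) (b + i))" for z
  have W: "degree ([:z, 1:] ^ b * W z) \<le> d" for z
  proof -
    \<comment> \<open>With \<open>c\<close> for \<open>y\<close> and \<open>c * z\<close> for
      \<open>z\<close>, the term of index \<open>k, s\<close> picks up the factor
      \<open>c ^ (k + s)\<close>. Varying \<open>c\<close> therefore splits the sum by total degree,
      and the bound holds for each part.\<close>
    have "degree (\<Sum>D\<le>a+S. smult (c ^ D) (\<Sum>k\<le>a. \<Sum>s\<le>S. if k + s = D then [:z, 1:] ^ s * p k s else 0)) \<le> d" for c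
    proof -
      have "(\<Sum>D\<le>a+S. smult (c ^ D) (\<Sum>k\<le>a. \<Sum>s\<le>S. if k + s = D then [:z, 1:] ^ s * p k s else 0))
        = (\<Sum>k\<le>a. \<Sum>s\<le>S. \<Sum>D\<le>a+S. if k + s = D then smult (c ^ D) ([:z, 1:] ^ s * p k s) else 0)"
      proof -
        have "smult (c ^ D) (\<Sum>k\<le>a. \<Sum>s\<le>S. if k + s = D then [:z, 1:] ^ s * p k s else 0)
          = (\<Sum>k\<le>a. \<Sum>s\<le>S. if k + s = D then smult (c ^ D) ([:z, 1:] ^ s * p k s) else 0)" for D
          unfolding smult_sum_right by (intro sum.cong refl) simp
        then show ?thesis
          by (simp only: sum.swap[of _ "{..S}" "{..a+S}"] sum.swap[of _ "{..a}" "{..a+S}"])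
      qed
      also have "\<dots> = (\<Sum>k\<le>a. \<Sum>s\<le>S. smult (c ^ (k + s)) ([:z, 1:] ^ s * p k s))"
        by (intro sum.cong refl) simp
      also have "\<dots> = (\<Sum>k\<le>a. \<Sum>s\<le>S. smult (c ^ k) ([:c * z, c:] ^ s * p k s))"
      proof (intro sum.cong refl)
        fix k s
        have "[:c * z, c:] = smult c [:z, 1:]" by simp
        then have "[:c * z, c:] ^ s = smult (c ^ s) ([:z, 1:] ^ s)"
          by (simp only: smult_power)
        then show "smult (c ^ (k + s)) ([:z, 1:] ^ s * p k s) = smult (c ^ k) ([:c * z, c:] ^ s * p k s)"
          by (simp add: power_add)
      qed
      finally show ?thesis
        using deg[of c "c * z"] by simp
    qed
    from degree_le_of_sums_degree_le[OF this, of "a + b"]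
    have "degree (\<Sum>k\<le>a. \<Sum>s\<le>S. if k + s = a + b then [:z, 1:] ^ s * p k s else 0) \<le> d"
      using S by simp
    also have "(\<Sum>k\<le>a. \<Sum>s\<le>S. if k + s = a + b then [:z, 1:] ^ s * p k s else 0)
        = (\<Sum>k\<le>a. [:z, 1:] ^ (a + b - k) * p k (a + b - k))"
    proof (intro sum.cong refl)
      fix k assume "k \<in> {..a}"
      then have "k + s = a + b \<longleftrightarrow> s = a + b - k" for s by auto
      then show "(\<Sum>s\<le>S. if k + s = a + b then [:z, 1:] ^ s * p k s else 0)
          = [:z, 1:] ^ (a + b - k) * p k (a + b - k)"
        using S \<open>k \<in> {..a}\<close> by (simp cong: if_cong)
    qed
    also have "\<dots> = (\<Sum>i\<le>a. [:z, 1:] ^ (b + i) * p (a - i) (b + i))"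
      by (rule sum.reindex_bij_witness[of _ "\<lambda>i. a - i" "\<lambda>i. a - i"]) (auto simp: add.commute)
    also have "\<dots> = [:z, 1:] ^ b * W z"
      unfolding W_def by (simp add: sum_distrib_left power_add algebra_simps)
    finally show ?thesis .
  qed
  have lin: "degree ([:z, 1:] ^ b) = b" "[:z, 1:] ^ b \<noteq> 0" for z :: 'a
    by (simp_all add: degree_power_eq)
  define Q where "Q = (\<Sum>i\<le>a. [:[:0, 1:], 1:] ^ i * [:p (a - i) (b + i):])"
  have degQ: "degree Q \<le> a"
    unfolding Q_def
  proof (rule degree_sum_le)
    fix i assume "i \<in> {..a}"
    have "degree ([:[:0, 1:], 1:] ^ i * [:p (a - i) (b + i):]) \<le> degree ([:[:0, 1::'a:], 1:] ^ i) + 0"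
      by (rule order_trans[OF degree_mult_le]) simp
    also have "\<dots> \<le> 1 * i"
      using degree_power_le[of "[:[:0, 1::'a:], 1:]" i] by simp
    finally show "degree ([:[:0, 1:], 1:] ^ i * [:p (a - i) (b + i):]) \<le> a"
      using \<open>i \<in> {..a}\<close> by simp
  qed simp
  have polyQ: "poly Q w = (\<Sum>l\<le>a. coeff Q l * w ^ l)" for w
    unfolding poly_altdef using degQ
    by (intro sum.mono_neutral_left) (auto simp: coeff_eq_0)
  have QW: "poly Q [:z:] = W z" for z
    unfolding Q_def W_def by (simp add: poly_sum mult.commute)
  have const_pow: "[:z:] ^ l = [:z ^ l:]" for z :: 'a and l
    by (induction l) auto
  have sumW: "W z = (\<Sum>l\<le>a. smult (z ^ l) (coeff Q l))" for z
    unfolding QW[symmetric] polyQ by (simp add: const_pow)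
  have Q0: "poly Q (- [:0, 1:]) = p a b"
  proof -
    have "poly Q (- [:0, 1:]) = (\<Sum>i\<le>a. 0 ^ i * p (a - i) (b + i))"
      unfolding Q_def by (simp add: poly_sum mult.commute)
    also have "\<dots> = (\<Sum>i\<in>{0}. 0 ^ i * p (a - i) (b + i))"
      by (rule sum.mono_neutral_right) auto
    finally show ?thesis by simp
  qed
  show "p a b = 0" if "d < b"
  proof -
    have "W z = 0" for z
      using W[of z] that lin[of z] by (metis add_leD1 degree_mult_eq not_le)
    then have "coeff Q l = 0" if "l \<le> a" for l
      using zero_of_sums_zero[where m = a and p = "coeff Q" and k = l] that unfolding sumW by blast
    then show ?thesis
      unfolding Q0[symmetric] polyQ by simp
  qed
  show "degree (p a b) \<le> d + a - b"
  proof (cases "d < b")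
    case True
    then show ?thesis using \<open>d < b \<Longrightarrow> p a b = 0\<close> by simp
  next
    case False
    have "degree (W z) \<le> d - b" for z
    proof (cases "W z = 0")
      case nz: False
      have "b + degree (W z) \<le> d"
        using W[of z] lin[of z] nz by (simp add: degree_mult_eq)
      then show ?thesis by simp
    qed simp
    then have co: "degree (coeff Q l) \<le> d - b" if "l \<le> a" for l
      using degree_le_of_sums_degree_le[where m = a and p = "coeff Q" and d = "d - b" and k = l] that unfolding sumW by blast
    have "degree (\<Sum>l\<le>a. coeff Q l * (- [:0, 1:]) ^ l) \<le> d + a - b"
    proof (rule degree_sum_le)
      fix l assume l: "l \<in> {..a}"
      have "degree (coeff Q l * (- [:0, 1:]) ^ l) \<le> degree (coeff Q l) + degree ((- [:0, 1::'a:]) ^ l)"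
        by (rule degree_mult_le)
      also have "\<dots> \<le> (d - b) + 1 * l"
        using co[of l] l degree_power_le[of "- [:0, 1::'a:]" l] by (intro add_mono) auto
      finally show "degree (coeff Q l * (- [:0, 1:]) ^ l) \<le> d + a - b"
        using l False by simp
    qed simp
    then show ?thesis
      unfolding Q0[symmetric] polyQ .
  qed
qed


section \<open>Polynomial functions and leading monomials\<close>

text \<open>Polynomials are kept as functions: over an infinite field this loses nothing, and
  substitution is plain composition.\<close>

inductive_set pfun :: "'i set \<Rightarrow> (('i \<Rightarrow> 'a::comm_ring_1) \<Rightarrow> 'a) set" for S where
  const: "(\<lambda>_. c) \<in> pfun S"
| var: "v \<in> S \<Longrightarrow> (\<lambda>x. x v) \<in> pfun S"
| add: "f \<in> pfun S \<Longrightarrow> g \<in> pfun S \<Longrightarrow> (\<lambda>x. f x + g x) \<in> pfun S"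
| mult: "f \<in> pfun S \<Longrightarrow> g \<in> pfun S \<Longrightarrow> (\<lambda>x. f x * g x) \<in> pfun S"

lemma pfun_mono: "f \<in> pfun S \<Longrightarrow> S \<subseteq> S' \<Longrightarrow> f \<in> pfun S'"
  by (induction rule: pfun.induct) (auto intro: pfun.intros)

lemma pfun_uminus: "f \<in> pfun S \<Longrightarrow> (\<lambda>x. - f x) \<in> pfun S"
  using pfun.mult[OF pfun.const[of "-1"], of f S] by simp

lemma pfun_diff: "f \<in> pfun S \<Longrightarrow> g \<in> pfun S \<Longrightarrow> (\<lambda>x. f x - g x) \<in> pfun S"
  using pfun.add[OF _ pfun_uminus, of f S g] by simp

lemma pfun_sum: "(\<And>i. i \<in> A \<Longrightarrow> f i \<in> pfun S) \<Longrightarrow> (\<lambda>x. \<Sum>i\<in>A. f i x) \<in> pfun S"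
  by (induction A rule: infinite_finite_induct) (auto intro: pfun.intros)

lemma pfun_prod: "(\<And>i. i \<in> A \<Longrightarrow> f i \<in> pfun S) \<Longrightarrow> (\<lambda>x. \<Prod>i\<in>A. f i x) \<in> pfun S"
  by (induction A rule: infinite_finite_induct) (auto intro: pfun.intros)

lemma pfun_power: "f \<in> pfun S \<Longrightarrow> (\<lambda>x. f x ^ k) \<in> pfun S"
  by (induction k) (auto intro: pfun.intros)

lemma pfun_cong: "f \<in> pfun S \<Longrightarrow> (\<And>v. v \<in> S \<Longrightarrow> x v = y v) \<Longrightarrow> f x = f y"
  by (induction rule: pfun.induct) auto

lemma pfun_empty: "f \<in> pfun {} \<Longrightarrow> \<exists>c. f = (\<lambda>_. c)"
  using pfun_cong[of f "{}"] by (metis empty_iff)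

text \<open>\<open>f\<close> is read as a univariate polynomial in \<open>v\<close> whose
  coefficients depend on the variables in \<open>S\<close>. The number \<open>d\<close> is a uniform
  bound; the degree may drop at special points.\<close>

definition poly_rep :: "'i set \<Rightarrow> 'i \<Rightarrow> nat \<Rightarrow> (('i \<Rightarrow> 'a::field) \<Rightarrow> 'a poly) \<Rightarrow> (('i \<Rightarrow> 'a) \<Rightarrow> 'a) \<Rightarrow> bool"
  where "poly_rep S v d P f \<longleftrightarrow> (\<forall>k. (\<lambda>x. coeff (P x) k) \<in> pfun S) \<and>
    (\<forall>x. degree (P x) \<le> d) \<and> (\<forall>x. f x = poly (P x) (x v))"

lemma poly_rep_add:
  "poly_rep S v d P f \<Longrightarrow> poly_rep S v e Q g \<Longrightarrow>
    poly_rep S v (max d e) (\<lambda>x. P x + Q x) (\<lambda>x. f x + g x)"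
  unfolding poly_rep_def
  by (simp add: pfun.add) (meson degree_add_le max.cobounded1 max.cobounded2 order_trans)

lemma poly_rep_diff:
  "poly_rep S v d P f \<Longrightarrow> poly_rep S v d Q g \<Longrightarrow>
    poly_rep S v d (\<lambda>x. P x - Q x) (\<lambda>x. f x - g x)"
  unfolding poly_rep_def by (auto intro: pfun_diff degree_diff_le)

lemma poly_rep_mult:
  "poly_rep S v d P f \<Longrightarrow> poly_rep S v e Q g \<Longrightarrow>
    poly_rep S v (d + e) (\<lambda>x. P x * Q x) (\<lambda>x. f x * g x)"
  unfolding poly_rep_def
  by (simp add: coeff_mult pfun_sum pfun.mult) (meson add_mono degree_mult_le order_trans)

lemma pfun_poly_rep:
  assumes "f \<in> pfun (insert v S)"
  shows "\<exists>d P. poly_rep S v d P f"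
  using assms
proof (induction rule: pfun.induct)
  case (const c)
  have "poly_rep S v 0 (\<lambda>_. [:c:]) (\<lambda>_. c)"
    unfolding poly_rep_def by (auto intro: pfun.const)
  then show ?case by blast
next
  case (var w)
  show ?case
  proof (cases "w = v")
    case True
    have "poly_rep S v 1 (\<lambda>_. [:0, 1:]) (\<lambda>x. x w)"
      unfolding poly_rep_def True by (auto intro: pfun.const)
    then show ?thesis by blast
  next
    case False
    then have "w \<in> S" using var by auto
    then have "(\<lambda>x. coeff [:x w:] k) \<in> pfun S" for k
      by (cases k) (auto intro: pfun.const pfun.var)
    then have "poly_rep S v 0 (\<lambda>x. [:x w:]) (\<lambda>x. x w)"
      unfolding poly_rep_def by auto
    then show ?thesis by blast
  qed
next
  case (add f g)
  then show ?case by (blast dest: poly_rep_add)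
next
  case (mult f g)
  then show ?case by (blast dest: poly_rep_mult)
qed

lemma poly_rep_pfun:
  assumes "poly_rep S v d P f"
  shows "f \<in> pfun (insert v S)"
proof -
  have "f = (\<lambda>x. \<Sum>k\<le>d. coeff (P x) k * x v ^ k)"
  proof
    fix x
    show "f x = (\<Sum>k\<le>d. coeff (P x) k * x v ^ k)"
      using assms unfolding poly_rep_def poly_altdef
      by (auto intro!: sum.mono_neutral_left dest: le_degree intro: order_trans)
  qed
  also have "\<dots> \<in> pfun (insert v S)"
    using assms unfolding poly_rep_def
    by (intro pfun_sum pfun.mult pfun_power pfun.var) (auto intro: pfun_mono)
  finally show ?thesis .
qed

text \<open>
  \<open>E\<close> gives the exponents and \<open>a\<close> the coefficient of the lexicographically leading monomial of \<open>f\<close>,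
  where variables that come earlier in the list are larger.
\<close>
fun lead :: "'i list \<Rightarrow> (('i \<Rightarrow> 'a::field) \<Rightarrow> 'a) \<Rightarrow> ('i \<Rightarrow> nat) \<Rightarrow> 'a \<Rightarrow> bool" where
  "lead [] f E a \<longleftrightarrow> f = (\<lambda>_. a) \<and> a \<noteq> 0"
| "lead (v # vs) f E a \<longleftrightarrow>
    (\<exists>P. poly_rep (set vs) v (E v) P f \<and> lead vs (\<lambda>x. coeff (P x) (E v)) E a)"

lemma lead_cong: "(\<And>v. v \<in> set vs \<Longrightarrow> E v = E' v) \<Longrightarrow> lead vs f E a = lead vs f E' a"
  by (induction vs arbitrary: f) auto

lemma lead_upd: "v \<notin> set vs \<Longrightarrow> lead vs f (E(v := k)) a = lead vs f E a"
  by (rule lead_cong) auto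

lemma lead_nonzero_coeff: "lead vs f E a \<Longrightarrow> a \<noteq> 0"
  by (induction vs arbitrary: f) auto

lemma lead_pfun: "lead vs f E a \<Longrightarrow> f \<in> pfun (set vs)"
  by (cases vs) (auto intro: pfun.const poly_rep_pfun)

text \<open>At a point where the leading coefficient function is nonzero, the coordinate
  \<open>v\<close> can be varied alone, since the coefficients do not depend on it.\<close>

lemma lead_nonvanishing:
  fixes f :: "('i \<Rightarrow> 'a::{field,infinite}) \<Rightarrow> 'a"
  assumes "lead vs f E a" "distinct vs"
  shows "\<exists>x. f x \<noteq> 0"
  using assms
proof (induction vs arbitrary: f)
  case (Cons v vs)
  then obtain P where P: "poly_rep (set vs) v (E v) P f" "lead vs (\<lambda>x. coeff (P x) (E v)) E a"
    by auto
  then obtain x where x: "coeff (P x) (E v) \<noteq> 0"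
    using Cons by force
  then have "P x \<noteq> 0" by auto
  then obtain z where z: "poly (P x) z \<noteq> 0"
    using poly_eqI_infinite[of "P x" 0] by auto
  have "P (x(v := z)) = P x"
  proof (rule poly_eqI)
    fix k
    have "(\<lambda>x. coeff (P x) k) \<in> pfun (set vs)"
      using P(1) unfolding poly_rep_def by blast
    then show "coeff (P (x(v := z))) k = coeff (P x) k"
      by (rule pfun_cong) (use Cons.prems(2) in auto)
  qed
  then have "f (x(v := z)) \<noteq> 0"
    using P(1) z unfolding poly_rep_def by simp
  then show ?case by blast
qed auto

text \<open>The bound \<open>d\<close> is lowered as long as the coefficient function of degree
  \<open>d\<close> vanishes identically; the first one that does not supplies the remaining
  exponents. The conclusion \<open>E v \<le> d\<close> is what makes \<open>lead_diff\<close>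
  descend.\<close>

lemma poly_rep_exists_lead:
  fixes f :: "('i \<Rightarrow> 'a::field) \<Rightarrow> 'a"
  assumes "poly_rep (set vs) v d P f" "v \<notin> set vs"
    and IH: "\<And>g :: ('i \<Rightarrow> 'a) \<Rightarrow> 'a. g \<in> pfun (set vs) \<Longrightarrow> g = (\<lambda>_. 0) \<or> (\<exists>E a. lead vs g E a)"
  shows "f = (\<lambda>_. 0) \<or> (\<exists>E a. E v \<le> d \<and> lead (v # vs) f E a)"
  using assms(1)
proof (induction d)
  case 0
  then have f: "f = (\<lambda>x. coeff (P x) 0)"
    unfolding poly_rep_def by (auto simp: poly_altdef)
  moreover have "(\<lambda>x. coeff (P x) 0) \<in> pfun (set vs)"
    using 0 unfolding poly_rep_def by blast
  ultimately have "f \<in> pfun (set vs)"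
    by simp
  then consider "f = (\<lambda>_. 0)" | E a where "lead vs f E a"
    using IH by blast
  then show ?case
  proof cases
    case 2
    then have "lead vs f (E(v := 0)) a"
      using assms(2) by (simp add: lead_upd)
    then have "lead (v # vs) f (E(v := 0)) a"
      using 0 f by auto
    then show ?thesis by (metis fun_upd_same le_refl)
  qed simp
next
  case (Suc d)
  have "(\<lambda>x. coeff (P x) (Suc d)) \<in> pfun (set vs)"
    using Suc.prems unfolding poly_rep_def by auto
  then consider "(\<lambda>x. coeff (P x) (Suc d)) = (\<lambda>_. 0)" | E a where "lead vs (\<lambda>x. coeff (P x) (Suc d)) E a"
    using IH by blast
  then show ?case
  proof cases
    case 1
    have "degree (P x) \<le> d" for x
    proof -
      have "degree (P x) \<le> Suc d" "coeff (P x) (Suc d) = 0"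
        using Suc.prems fun_cong[OF 1, of x] unfolding poly_rep_def by auto
      then show ?thesis
        by (metis degree_0 le_SucE leading_coeff_0_iff le0)
    qed
    then have "poly_rep (set vs) v d P f"
      using Suc.prems unfolding poly_rep_def by auto
    then show ?thesis
      using Suc.IH by (meson le_SucI)
  next
    case 2
    then have "lead vs (\<lambda>x. coeff (P x) (Suc d)) (E(v := Suc d)) a"
      using assms(2) by (simp add: lead_upd)
    then have "lead (v # vs) f (E(v := Suc d)) a"
      using Suc.prems by auto
    then show ?thesis by (metis fun_upd_same le_refl)
  qed
qed

lemma exists_lead:
  assumes "f \<in> pfun (set vs)" "distinct vs"
  shows "f = (\<lambda>_. 0) \<or> (\<exists>E a. lead vs f E a)"
  using assms
proof (induction vs arbitrary: f)
  case Nil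
  then obtain c where "f = (\<lambda>_. c)" using pfun_empty[of f] by auto
  then show ?case by auto
next
  case (Cons v vs)
  then obtain d P where "poly_rep (set vs) v d P f"
    using pfun_poly_rep[of f v "set vs"] by auto
  from poly_rep_exists_lead[OF this] Cons show ?case
    by fastforce
qed

fun lex_less :: "'i list \<Rightarrow> ('i \<Rightarrow> nat) \<Rightarrow> ('i \<Rightarrow> nat) \<Rightarrow> bool" where
  "lex_less [] E F \<longleftrightarrow> False"
| "lex_less (v # vs) E F \<longleftrightarrow> E v < F v \<or> E v = F v \<and> lex_less vs E F"

lemma wf_lex_less: "wf {(E, F). lex_less vs E F}"
proof -
  have "lex_less vs E F \<Longrightarrow> (map E vs, map F vs) \<in> lex less_than" for E F
    by (induction vs) auto
  then have "{(E, F). lex_less vs E F} \<subseteq> inv_image (lex less_than) (\<lambda>E. map E vs)"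
    by auto
  then show ?thesis
    by (rule wf_subset[OF wf_inv_image[OF wf_lex[OF wf_less_than]]])
qed

text \<open>The cancellation step of a division algorithm. Either the coefficient functions of the
  first variable still differ, and the descent happens in the later variables, or they agree and the
  degree in the first variable drops.\<close>

lemma lead_diff:
  fixes f :: "('i \<Rightarrow> 'a::field) \<Rightarrow> 'a"
  assumes "lead vs f E a" "lead vs g E a" "distinct vs"
  shows "(\<lambda>x. f x - g x) = (\<lambda>_. 0) \<or> (\<exists>E' a'. lead vs (\<lambda>x. f x - g x) E' a' \<and> lex_less vs E' E)"
  using assms
proof (induction vs arbitrary: f g)
  case (Cons v vs)
  from Cons.prems obtain P Q where P: "poly_rep (set vs) v (E v) P f" "lead vs (\<lambda>x. coeff (P x) (E v)) E a"
    and Q: "poly_rep (set vs) v (E v) Q g" "lead vs (\<lambda>x. coeff (Q x) (E v)) E a"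
    by auto
  let ?h = "\<lambda>x. coeff (P x) (E v) - coeff (Q x) (E v)"
  note PQ = poly_rep_diff[OF P(1) Q(1)]
  consider "?h = (\<lambda>_. 0)" | E' a' where "lead vs ?h E' a'" "lex_less vs E' E"
    using Cons.IH[OF P(2) Q(2)] Cons.prems by auto
  then show ?case
  proof cases
    case 1
    show ?thesis
    proof (cases "E v")
      case 0
      have "f x - g x = 0" for x
        using PQ fun_cong[OF 1, of x] unfolding poly_rep_def 0 by (auto simp: poly_altdef)
      then show ?thesis by auto
    next
      case (Suc d)
      have "degree (P x - Q x) \<le> d" for x
      proof -
        have "degree (P x - Q x) \<le> Suc d" "coeff (P x - Q x) (Suc d) = 0"
          using PQ fun_cong[OF 1, of x] Suc unfolding poly_rep_def by auto
        then show ?thesis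
        by (metis degree_0 le_SucE leading_coeff_0_iff le0)
      qed
      then have "poly_rep (set vs) v d (\<lambda>x. P x - Q x) (\<lambda>x. f x - g x)"
        using PQ unfolding poly_rep_def by auto
      then show ?thesis
        using poly_rep_exists_lead[of vs v d _ "\<lambda>x. f x - g x", OF _ _ exists_lead] Cons.prems(3) Suc
        by fastforce
    qed
  next
    case 2
    then have "lead vs ?h (E'(v := E v)) a'"
      using Cons.prems by (simp add: lead_upd)
    then have "lead (v # vs) (\<lambda>x. f x - g x) (E'(v := E v)) a'"
      using PQ by auto
    moreover have "lex_less vs (E'(v := E v)) E"
    proof -
      have "v \<notin> set us \<Longrightarrow> lex_less us (E'(v := E v)) E = lex_less us E' E" for us
        by (induction us) auto
      then show ?thesis using 2 Cons.prems by auto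
    qed
    ultimately show ?thesis
      by (auto simp del: lead.simps)
  qed
qed auto

lemma coeff_mult_bounds:
  assumes "degree p \<le> m" "degree q \<le> n"
  shows "coeff (p * q) (m + n) = coeff p m * coeff q n"
proof -
  have "coeff (p * q) (m + n) = (\<Sum>i\<le>m + n. coeff p i * coeff q (m + n - i))"
    by (rule coeff_mult)
  also have "\<dots> = (\<Sum>i\<in>{m}. coeff p i * coeff q (m + n - i))"
  proof (rule sum.mono_neutral_right)
    show "\<forall>i\<in>{..m + n} - {m}. coeff p i * coeff q (m + n - i) = 0"
    proof
      fix i assume "i \<in> {..m + n} - {m}"
      then have "degree p < i \<or> degree q < m + n - i"
        using assms by auto
      then show "coeff p i * coeff q (m + n - i) = 0"
        by (auto simp: coeff_eq_0)
    qed
  qed auto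
  finally show ?thesis by simp
qed

lemma lead_mult:
  "lead vs f E a \<Longrightarrow> lead vs g F b \<Longrightarrow> lead vs (\<lambda>x. f x * g x) (\<lambda>v. E v + F v) (a * b)"
proof (induction vs arbitrary: f g)
  case (Cons v vs)
  from Cons.prems obtain P Q where P: "poly_rep (set vs) v (E v) P f" "lead vs (\<lambda>x. coeff (P x) (E v)) E a"
    and Q: "poly_rep (set vs) v (F v) Q g" "lead vs (\<lambda>x. coeff (Q x) (F v)) F b"
    by auto
  have "(\<lambda>x. coeff (P x * Q x) (E v + F v)) = (\<lambda>x. coeff (P x) (E v) * coeff (Q x) (F v))"
    using P(1) Q(1) unfolding poly_rep_def by (blast intro: coeff_mult_bounds)
  then show ?case
    using poly_rep_mult[OF P(1) Q(1)] Cons.IH[OF P(2) Q(2)] by auto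
qed auto

lemma lead_const: "c \<noteq> 0 \<Longrightarrow> lead vs (\<lambda>_. c) (\<lambda>_. 0) c"
proof (induction vs)
  case (Cons v vs)
  have "poly_rep (set vs) v 0 (\<lambda>_. [:c:]) (\<lambda>_. c)"
    unfolding poly_rep_def by (auto intro: pfun.const)
  then show ?case using Cons by (auto intro!: exI[of _ "\<lambda>_. [:c:]"])
qed auto

lemma lead_scale: "lead vs f E a \<Longrightarrow> c \<noteq> 0 \<Longrightarrow> lead vs (\<lambda>x. c * f x) E (c * a)"
  using lead_mult[OF lead_const, of c vs f E a] by simp

text \<open>Larger variables that do not occur may be put in front: the function is then a constant
  polynomial in each of them.\<close>

lemma lead_skip:
  assumes "lead vs f E a" "\<And>u. u \<in> set us \<Longrightarrow> E u = 0" "set us \<inter> set vs = {}"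
  shows "lead (us @ vs) f E a"
  using assms(2,3)
proof (induction us)
  case (Cons u us)
  then have us: "lead (us @ vs) f E a" by auto
  have "poly_rep (set (us @ vs)) u 0 (\<lambda>x. [:f x:]) f"
  proof -
    have "(\<lambda>x. coeff [:f x:] k) \<in> pfun (set (us @ vs))" for k
      using lead_pfun[OF us] by (cases k) (auto intro: pfun.const)
    then show ?thesis
      unfolding poly_rep_def by auto
  qed
  then show ?case using us Cons by (auto intro!: exI[of _ "\<lambda>x. [:f x:]"])
qed (use assms(1) in auto)

text \<open>Leading monomials multiply, so a product of two nonzero functions has a leading monomial
  and is nonzero somewhere.\<close>

lemma pfun_mult_eq_0:
  fixes f g :: "('i \<Rightarrow> 'a::{field,infinite}) \<Rightarrow> 'a"
  assumes "f \<in> pfun S" "g \<in> pfun S" "finite S" "\<And>x. f x * g x = 0"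
  shows "f = (\<lambda>_. 0) \<or> g = (\<lambda>_. 0)"
proof (rule ccontr)
  assume *: "\<not> ?thesis"
  obtain vs where vs: "set vs = S" "distinct vs"
    using finite_distinct_list[OF assms(3)] by blast
  obtain E a F b where "lead vs f E a" "lead vs g F b"
    using exists_lead[of f vs] exists_lead[of g vs] assms vs * by blast
  from lead_nonvanishing[OF lead_mult[OF this] vs(2)] assms(4) show False
    by auto
qed


section \<open>Leading monomials of unipotent invariants\<close>

text \<open>Right multiplication by the root element of a simple root, on arrays without
  bounds.\<close>

definition add_col :: "nat \<Rightarrow> 'a::comm_ring_1 \<Rightarrow> (nat \<times> nat \<Rightarrow> 'a) \<Rightarrow> nat \<times> nat \<Rightarrow> 'a" where
  "add_col j t x = (\<lambda>(r, c). if c = Suc j then x (r, c) + t * x (r, j) else x (r, c))"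

text \<open>Invariance is the case \<open>d = 0\<close>. Taking a leading coefficient destroys
  invariance but changes the degree in \<open>t\<close> in a controlled way, so the induction runs
  on this weaker property.\<close>

definition tdeg_le :: "nat \<Rightarrow> nat \<Rightarrow> ((nat \<times> nat \<Rightarrow> 'a::comm_ring_1) \<Rightarrow> 'a) \<Rightarrow> bool" where
  "tdeg_le j d f \<longleftrightarrow> (\<forall>x. \<exists>p. degree p \<le> d \<and> (\<forall>t. f (add_col j t x) = poly p t))"

lemma pfun_add_col_poly:
  "f \<in> pfun S \<Longrightarrow> \<exists>p. \<forall>t. f (add_col j t x) = poly p t"
proof (induction rule: pfun.induct)
  case (const c)
  show ?case by (intro exI[of _ "[:c:]"]) simp
next
  case (var v)
  show ?case
    by (cases v, intro exI[of _ "if snd v = Suc j then [:x v, x (fst v, j):] else [:x v:]"])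
      (auto simp: add_col_def)
next
  case (add f g)
  then show ?case by (metis poly_add)
next
  case (mult f g)
  then show ?case by (metis poly_mult)
qed

text \<open>The column operation neither changes this variable nor uses it, so it commutes with
  taking coefficients; varying the value of the variable separates them.\<close>

lemma tdeg_le_lead_other_column:
  fixes f :: "(nat \<times> nat \<Rightarrow> 'a::{field,infinite}) \<Rightarrow> 'a"
  assumes "lead (v # vs) f E a" "tdeg_le j d f" "v \<notin> set vs" "snd v \<noteq> j" "snd v \<noteq> Suc j"
  shows "\<exists>g. lead vs g E a \<and> tdeg_le j d g"
proof -
  from assms(1) obtain P where P: "poly_rep (set vs) v (E v) P f"
    and lead: "lead vs (\<lambda>x. coeff (P x) (E v)) E a"
    by auto
  have Pp: "(\<lambda>x. coeff (P x) k) \<in> pfun (set vs)" "degree (P x) \<le> E v" "f x = poly (P x) (x v)" for k x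
    using P unfolding poly_rep_def by blast+
  have "tdeg_le j d (\<lambda>x. coeff (P x) (E v))"
    unfolding tdeg_le_def
  proof
    fix x
    have "\<forall>k. \<exists>p. \<forall>t. coeff (P (add_col j t x)) k = poly p t"
      using pfun_add_col_poly[OF Pp(1)] by blast
    then obtain p where p: "\<And>k t. coeff (P (add_col j t x)) k = poly (p k) t"
      by metis
    have "degree (\<Sum>k\<le>E v. smult (z ^ k) (p k)) \<le> d" for z
    proof -
      obtain q where q: "degree q \<le> d" "\<And>t. f (add_col j t (x(v := z))) = poly q t"
        using assms(2) unfolding tdeg_le_def by blast
      have "poly q t = poly (\<Sum>k\<le>E v. smult (z ^ k) (p k)) t" for t
      proof -
        have upd: "add_col j t (x(v := z)) = (add_col j t x)(v := z)"
          using assms(4,5) by (auto simp: add_col_def fun_eq_iff)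
        have co: "coeff (P ((add_col j t x)(v := z))) k = coeff (P (add_col j t x)) k" for k
          by (rule pfun_cong[OF Pp(1)]) (use assms(3) in auto)
        have "poly q t = poly (P ((add_col j t x)(v := z))) z"
          unfolding q(2)[symmetric] upd Pp(3) by simp
        also have "\<dots> = (\<Sum>k\<le>E v. coeff (P ((add_col j t x)(v := z))) k * z ^ k)"
          unfolding poly_altdef using Pp(2)
          by (intro sum.mono_neutral_left) (auto dest: le_degree intro: order_trans)
        also have "\<dots> = poly (\<Sum>k\<le>E v. smult (z ^ k) (p k)) t"
          by (simp add: co p poly_sum mult.commute)
        finally show ?thesis .
      qed
      then have "q = (\<Sum>k\<le>E v. smult (z ^ k) (p k))"
        by (rule poly_eqI_infinite)
      with q(1) show ?thesis by simp
    qed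
    from degree_le_of_sums_degree_le[OF this, of "E v"]
    have "degree (p (E v)) \<le> d" by simp
    with p show "\<exists>q. degree q \<le> d \<and> (\<forall>t. coeff (P (add_col j t x)) (E v) = poly q t)"
      by blast
  qed
  with lead show ?thesis by blast
qed

text \<open>In row \<open>r\<close> the operation fixes the entry \<open>y\<close> in column
  \<open>j\<close> and sends the entry \<open>z\<close> in column \<open>Suc j\<close> to
  \<open>z + t * y\<close>. By \<open>bivariate_degree\<close> the bound then gains the exponent of
  \<open>y\<close>, loses that of \<open>z\<close>, and the latter cannot exceed
  \<open>d\<close>.\<close>

lemma tdeg_le_lead_two_columns:
  fixes f :: "(nat \<times> nat \<Rightarrow> 'a::{field,infinite}) \<Rightarrow> 'a"
  assumes lead: "lead ((r, j) # (r, Suc j) # vs) f E a" and deg: "tdeg_le j d f"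
    and dist: "distinct ((r, j) # (r, Suc j) # vs)"
  defines "v \<equiv> (r, j)" and "w \<equiv> (r, Suc j)"
  shows "\<exists>g. lead vs g E a \<and> E w \<le> d \<and> tdeg_le j (d + E v - E w) g"
proof -
  from lead obtain P Q where P: "poly_rep (insert w (set vs)) v (E v) P f"
    and Q: "poly_rep (set vs) w (E w) Q (\<lambda>x. coeff (P x) (E v))"
    and lead': "lead vs (\<lambda>x. coeff (Q x) (E w)) E a"
    unfolding v_def w_def by auto
  have nv: "v \<notin> set vs" "w \<notin> set vs" "v \<noteq> w"
    using dist unfolding v_def w_def by auto
  have Pp: "(\<lambda>x. coeff (P x) k) \<in> pfun (insert w (set vs))" "degree (P x) \<le> E v" "f x = poly (P x) (x v)" for k x
    using P unfolding poly_rep_def by blast+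
  \<comment> \<open>At the leading power of \<open>v\<close> the representation is forced to be
    \<open>Q\<close>, so that its bound is \<open>E w\<close>; the other coefficients may have any
    bound.\<close>
  have "\<forall>k. \<exists>e R. poly_rep (set vs) w e R (\<lambda>x. coeff (P x) k) \<and> (k = E v \<longrightarrow> e = E w \<and> R = Q)"
    using pfun_poly_rep[OF Pp(1)] Q by metis
  then obtain e R where R: "\<And>k. poly_rep (set vs) w (e k) (R k) (\<lambda>x. coeff (P x) k)"
    and top: "e (E v) = E w" "R (E v) = Q"
    by metis
  have Rp: "(\<lambda>x. coeff (R k x) s) \<in> pfun (set vs)" "degree (R k x) \<le> e k"
      "coeff (P x) k = poly (R k x) (x w)" for k s x
    using R[of k] unfolding poly_rep_def by blast+
  define S where "S = E w + E v + (\<Sum>k\<le>E v. e k)"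
  have eS: "e k \<le> S" if "k \<le> E v" for k
    unfolding S_def using member_le_sum[of k "{..E v}" e] that by simp
  have main: "\<exists>p. (\<forall>t. coeff (Q (add_col j t x)) (E w) = poly p t) \<and> degree p \<le> d + E v - E w \<and>
      (d < E w \<longrightarrow> p = 0)" for x
  proof -
    have "\<forall>k s. \<exists>p. (\<forall>t. coeff (R k (add_col j t x)) s = poly p t)"
      using pfun_add_col_poly[OF Rp(1)] by blast
    then obtain p where p: "\<And>k s t. coeff (R k (add_col j t x)) s = poly (p k s) t"
      by metis
    have "degree (\<Sum>k\<le>E v. \<Sum>s\<le>S. smult (y ^ k) ([:z, y:] ^ s * p k s)) \<le> d" for y z
    proof -
      define x' where "x' = x(v := y, w := z)"
      obtain q where q: "degree q \<le> d" "\<And>t. f (add_col j t x') = poly q t"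
        using deg unfolding tdeg_le_def by blast
      have "poly q t = poly (\<Sum>k\<le>E v. \<Sum>s\<le>S. smult (y ^ k) ([:z, y:] ^ s * p k s)) t" for t
      proof -
        have vw: "add_col j t x' v = y" "add_col j t x' w = z + t * y"
          unfolding x'_def v_def w_def by (auto simp: add_col_def)
        have co: "coeff (R k (add_col j t x')) s = coeff (R k (add_col j t x)) s" for k s
        proof (rule pfun_cong[OF Rp(1)])
          fix u assume u: "u \<in> set vs"
          obtain r' c where rc: "u = (r', c)" by (cases u)
          have "(r', c) \<noteq> v" "(r', c) \<noteq> w" "c = Suc j \<Longrightarrow> (r', j) \<noteq> v \<and> (r', j) \<noteq> w"
            using u rc nv by (auto simp: v_def w_def)
          then show "add_col j t x' u = add_col j t x u"
            unfolding rc add_col_def x'_def by auto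
        qed
        have "poly q t = (\<Sum>k\<le>E v. coeff (P (add_col j t x')) k * y ^ k)"
          unfolding q(2)[symmetric] Pp(3) vw poly_altdef[of "P _"] using Pp(2)
          by (intro sum.mono_neutral_left) (auto dest: le_degree intro: order_trans)
        also have "\<dots> = (\<Sum>k\<le>E v. (\<Sum>s\<le>S. coeff (R k (add_col j t x')) s * (z + t * y) ^ s) * y ^ k)"
        proof (rule sum.cong[OF refl])
          fix k assume "k \<in> {..E v}"
          then have "degree (R k (add_col j t x')) \<le> S"
            using Rp(2) eS by (meson atMost_iff order_trans)
          then show "coeff (P (add_col j t x')) k * y ^ k
             = (\<Sum>s\<le>S. coeff (R k (add_col j t x')) s * (z + t * y) ^ s) * y ^ k"
            unfolding Rp(3) vw poly_altdef[of "R _ _"]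
            by (intro arg_cong2[of _ _ _ _ "(*)"] refl sum.mono_neutral_left)
              (auto dest: le_degree intro: order_trans)
        qed
        also have "\<dots> = poly (\<Sum>k\<le>E v. \<Sum>s\<le>S. smult (y ^ k) ([:z, y:] ^ s * p k s)) t"
          by (simp add: co p poly_sum sum_distrib_left sum_distrib_right ac_simps)
        finally show ?thesis .
      qed
      then have "q = (\<Sum>k\<le>E v. \<Sum>s\<le>S. smult (y ^ k) ([:z, y:] ^ s * p k s))"
        by (rule poly_eqI_infinite)
      with q(1) show ?thesis by simp
    qed
    moreover have "p (E v) s = 0" if "s > E w" for s
    proof (rule poly_eqI_infinite)
      fix t
      show "poly (p (E v) s) t = poly 0 t"
        using Rp(2)[of "E v" "add_col j t x"] that
        unfolding p[symmetric] top by (simp add: coeff_eq_0)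
    qed
    moreover have "E w + E v \<le> S"
      unfolding S_def by simp
    ultimately have "degree (p (E v) (E w)) \<le> d + E v - E w \<and> (d < E w \<longrightarrow> p (E v) (E w) = 0)"
      using bivariate_degree[where a = "E v" and S = S and p = p and d = d and b = "E w"] by blast
    then show ?thesis
      using p[of "E v" _ "E w"] unfolding top by blast
  qed
  \<comment> \<open>A point where the extracted coefficient survives excludes
    \<open>d < E w\<close>.\<close>
  obtain x where x: "coeff (Q x) (E w) \<noteq> 0"
    using lead_nonvanishing[OF lead'] dist by auto
  have "add_col j 0 x = x"
    by (auto simp: add_col_def fun_eq_iff)
  then have "E w \<le> d"
    using main[of x] x by (metis leI poly_0)
  then show ?thesis
    using lead' main unfolding tdeg_le_def by blast
qed

lemma tdeg_le_lead_other_columns: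
  fixes f :: "(nat \<times> nat \<Rightarrow> 'a::{field,infinite}) \<Rightarrow> 'a"
  assumes "lead (us @ vs) f E a" "tdeg_le j d f" "distinct (us @ vs)" "\<And>u. u \<in> set us \<Longrightarrow> snd u \<noteq> j \<and> snd u \<noteq> Suc j"
  shows "\<exists>g. lead vs g E a \<and> tdeg_le j d g"
  using assms
proof (induction us arbitrary: f)
  case (Cons u us)
  then have "\<exists>g. lead (us @ vs) g E a \<and> tdeg_le j d g"
    by (intro tdeg_le_lead_other_column[of u _ f]) auto
  with Cons show ?case by (auto simp del: lead.simps)
qed auto

definition row_vars :: "nat \<Rightarrow> nat \<Rightarrow> (nat \<times> nat) list" where
  "row_vars N r = map (Pair r) [0..<N]"

definition mat_vars :: "nat \<Rightarrow> nat \<Rightarrow> nat \<Rightarrow> (nat \<times> nat) list" where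
  "mat_vars N r R = concat (map (row_vars N) [r..<R])"

lemma set_row_vars [simp]: "set (row_vars N r) = {r} \<times> {..<N}"
  unfolding row_vars_def by auto

lemma set_mat_vars [simp]: "set (mat_vars N r R) = {r..<R} \<times> {..<N}"
  unfolding mat_vars_def by auto

lemma mat_vars_eq: "r < R \<Longrightarrow> mat_vars N r R = row_vars N r @ mat_vars N (Suc r) R"
  unfolding mat_vars_def by (simp add: upt_conv_Cons)

lemma distinct_mat_vars [simp]: "distinct (mat_vars N r R)"
proof (induction "R - r" arbitrary: r)
  case (Suc k)
  then have "distinct (mat_vars N (Suc r) R)" "r < R" by auto
  then show ?case
    by (auto simp: mat_vars_eq row_vars_def distinct_map inj_on_def)
qed (auto simp: mat_vars_def)

lemma row_vars_split: "c < N \<Longrightarrow> row_vars N r = map (Pair r) [0..<c] @ (r, c) # map (Pair r) [Suc c..<N]"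
  unfolding row_vars_def
  by (metis (no_types, lifting) le_add1 less_imp_le_nat list.simps(9) map_append upt_add_eq_append upt_conv_Cons
      add_diff_inverse_nat not_less plus_nat.add_0)

text \<open>The bound \<open>d\<close> works like an account: a row first pays its exponent in
  column \<open>Suc j\<close> and only then deposits its exponent in column \<open>j\<close>. Hence
  the closed range on the left and the half-open one on the right.\<close>

lemma lead_ballot_aux:
  fixes f :: "(nat \<times> nat \<Rightarrow> 'a::{field,infinite}) \<Rightarrow> 'a"
  assumes "lead (mat_vars N r R) f E a" "tdeg_le j d f" "Suc j < N" "r \<le> i" "i < R"
  shows "(\<Sum>s=r..i. E (s, Suc j)) \<le> d + (\<Sum>s=r..<i. E (s, j))"
  using assms
proof (induction "R - r" arbitrary: r f d)
  case (Suc k)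
  let ?rest = "map (Pair r) [Suc (Suc j)..<N] @ mat_vars N (Suc r) R"
  have split: "mat_vars N r R = map (Pair r) [0..<j] @ (r, j) # (r, Suc j) # ?rest"
    using Suc.prems by (simp add: mat_vars_eq row_vars_split[of j] upt_conv_Cons)
  have "distinct (mat_vars N r R)"
    by simp
  note dist = this[unfolded split]
  have cols: "snd u \<noteq> j \<and> snd u \<noteq> Suc j" if "u \<in> set (map (Pair r) [0..<j])" for u
    using that by auto
  have cols': "snd u \<noteq> j \<and> snd u \<noteq> Suc j" if "u \<in> set (map (Pair r) [Suc (Suc j)..<N])" for u
    using that by auto
  obtain g where g: "lead ((r, j) # (r, Suc j) # ?rest) g E a" "tdeg_le j d g"
    using tdeg_le_lead_other_columns[OF Suc.prems(1)[unfolded split] Suc.prems(2) dist cols]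
    by blast
  then obtain h where h: "lead ?rest h E a" "E (r, Suc j) \<le> d" "tdeg_le j (d + E (r, j) - E (r, Suc j)) h"
    using tdeg_le_lead_two_columns[OF g] dist by auto
  then obtain h' where h': "lead (mat_vars N (Suc r) R) h' E a" "tdeg_le j (d + E (r, j) - E (r, Suc j)) h'"
    using tdeg_le_lead_other_columns[OF h(1,3) _ cols'] dist by auto
  show ?case
  proof (cases "i = r")
    case True
    then show ?thesis using h(2) by simp
  next
    case False
    then have "(\<Sum>s=Suc r..i. E (s, Suc j)) \<le> d + E (r, j) - E (r, Suc j) + (\<Sum>s=Suc r..<i. E (s, j))"
      using Suc.hyps(2) Suc.prems by (intro Suc.hyps(1)[OF _ h']) auto
    then show ?thesis
      using False Suc.prems h(2) by (simp add: sum.atLeast_Suc_atMost sum.atLeast_Suc_lessThan)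
  qed
qed auto

lemma lead_ballot:
  fixes f :: "(nat \<times> nat \<Rightarrow> 'a::{field,infinite}) \<Rightarrow> 'a"
  assumes "lead (mat_vars N 0 R) f E a" "\<And>t x. f (add_col j t x) = f x" "Suc j < N" "i < R"
  shows "(\<Sum>s\<le>i. E (s, Suc j)) \<le> (\<Sum>s<i. E (s, j))"
proof -
  have "tdeg_le j 0 f"
    unfolding tdeg_le_def using assms(2) by (metis degree_pCons_0 le_refl poly_const_conv)
  from lead_ballot_aux[OF assms(1) this assms(3) _ assms(4)] show ?thesis
    by (simp add: atMost_atLeast0 lessThan_atLeast0)
qed


section \<open>Flag minors\<close>

text \<open>The column offset \<open>c\<close> makes room for the induction by expansion along the
  first row; the flag minors have \<open>c = 0\<close>.\<close>

definition minor :: "nat list \<Rightarrow> nat \<Rightarrow> (nat \<times> nat \<Rightarrow> 'a::comm_ring_1) \<Rightarrow> 'a" where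
  "minor I c x = det (mat (length I) (length I) (\<lambda>(a, b). x (I ! a, c + b)))"

lemma pfun_det:
  assumes "\<And>a b. a < m \<Longrightarrow> b < m \<Longrightarrow> (\<lambda>x. F x a b) \<in> pfun S"
  shows "(\<lambda>x. det (mat m m (\<lambda>(a, b). F x a b))) \<in> pfun S"
proof -
  have "(\<lambda>x. det (mat m m (\<lambda>(a, b). F x a b)))
      = (\<lambda>x. \<Sum>p\<in>{p. p permutes {0..<m}}. signof p * (\<Prod>i\<in>{0..<m}. F x i (p i)))"
  proof
    fix x
    show "det (mat m m (\<lambda>(a, b). F x a b))
      = (\<Sum>p\<in>{p. p permutes {0..<m}}. signof p * (\<Prod>i\<in>{0..<m}. F x i (p i)))"
      unfolding det_def dim_row_mat dim_col_mat if_P[OF refl]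
    proof (intro sum.cong refl arg_cong2[of _ _ _ _ "(*)"] prod.cong)
      fix p i assume "p \<in> {p. p permutes {0..<m}}" "i \<in> {0..<m}"
      then have "i < m" "p i < m"
        using permutes_in_image[of p "{0..<m}" i] by auto
      then show "mat m m (\<lambda>(a, b). F x a b) $$ (i, p i) = F x i (p i)"
        by simp
    qed
  qed
  also have "\<dots> \<in> pfun S"
  proof (intro pfun_sum pfun.mult pfun.const pfun_prod assms)
    fix p i assume "p \<in> {p. p permutes {0..<m}}" "i \<in> {0..<m}"
    then show "i < m" "p i < m"
      using permutes_in_image[of p "{0..<m}" i] by auto
  qed
  finally show ?thesis .
qed

lemma minor_pfun:
  "set I \<subseteq> A \<Longrightarrow> c + length I \<le> N \<Longrightarrow> minor I c \<in> pfun (A \<times> {c..<N})"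
  unfolding minor_def[abs_def] by (intro pfun_det pfun.var) (auto simp: subset_iff)

lemma minor_Nil [simp]: "minor [] c = (\<lambda>_. 1)"
  by (auto simp: minor_def det_dim_zero)

text \<open>Laplace expansion along the first row, arranged so that the remainder \<open>g\<close>
  avoids the variable \<open>(i, c)\<close> whenever \<open>i\<close> is not in
  \<open>A\<close>.\<close>

lemma minor_Cons:
  fixes c N :: nat
  assumes "set I \<subseteq> A" "c + Suc (length I) \<le> N"
  shows "\<exists>g \<in> pfun ({i} \<times> {Suc c..<N} \<union> A \<times> {c..<N}).
    minor (i # I) c = (\<lambda>x. x (i, c) * minor I (Suc c) x + g x :: 'a::comm_ring_1)"
proof -
  define m where "m = length I"
  define M where "M x = mat (Suc m) (Suc m) (\<lambda>(a, b). x ((i # I) ! a, c + b))" for x :: "nat \<times> nat \<Rightarrow> 'a"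
  define g where "g x = (\<Sum>j<m. M x $$ (0, Suc j) * cofactor (M x) 0 (Suc j))" for x
  have "minor (i # I) c x = x (i, c) * minor I (Suc c) x + g x" for x :: "nat \<times> nat \<Rightarrow> 'a"
  proof -
    have "minor (i # I) c x = (\<Sum>j<Suc m. M x $$ (0, j) * cofactor (M x) 0 j)"
      unfolding minor_def m_def[symmetric]
      by (subst laplace_expansion_row[symmetric, of "M x" "Suc m" 0]) (auto simp: M_def m_def)
    also have "\<dots> = M x $$ (0, 0) * cofactor (M x) 0 0 + g x"
      unfolding g_def by (rule sum.lessThan_Suc_shift)
    also have "mat_delete (M x) 0 0 = mat m m (\<lambda>(a, b). x (I ! a, Suc c + b))"
      by (rule eq_matI) (auto simp: mat_delete_def M_def)
    then have "cofactor (M x) 0 0 = minor I (Suc c) x"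
      by (simp add: cofactor_def minor_def m_def)
    finally show ?thesis by (simp add: M_def)
  qed
  moreover have "g \<in> pfun ({i} \<times> {Suc c..<N} \<union> A \<times> {c..<N})"
  proof -
    have "(\<lambda>x. det (mat m m (\<lambda>(a, b). x (I ! a, c + (if b < Suc j then b else Suc b)))))
      \<in> pfun ({i} \<times> {Suc c..<N} \<union> A \<times> {c..<N})" if "j < m" for j
      using assms that unfolding m_def
      by (intro pfun_det pfun.var) (auto simp: subset_iff)
    moreover have "mat_delete (M x) 0 (Suc j) = mat m m (\<lambda>(a, b). x (I ! a, c + (if b < Suc j then b else Suc b)))"
      if "j < m" for j x
      using that by (intro eq_matI) (auto simp: mat_delete_def M_def)
    ultimately have "(\<lambda>x. det (mat_delete (M x) 0 (Suc j))) \<in> pfun ({i} \<times> {Suc c..<N} \<union> A \<times> {c..<N})"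
      if "j < m" for j
      using that by simp
    moreover have "(\<lambda>x. M x $$ (0, Suc j)) \<in> pfun ({i} \<times> {Suc c..<N} \<union> A \<times> {c..<N})" if "j < m" for j
      using assms that unfolding M_def m_def by (auto intro: pfun.var)
    ultimately show ?thesis
      unfolding g_def[abs_def] cofactor_def
      by (intro pfun_sum pfun.mult pfun.const) auto
  qed
  ultimately show ?thesis by blast
qed

text \<open>For increasing \<open>I\<close>, the exponents of the diagonal term of \<open>minor I c\<close>.\<close>
definition diag_exp :: "nat list \<Rightarrow> nat \<Rightarrow> nat \<times> nat \<Rightarrow> nat" where
  "diag_exp I c = (\<lambda>(r, s). if c \<le> s \<and> s < c + length I \<and> I ! (s - c) = r then 1 else 0)"

lemma diag_exp_row_notin: "r \<notin> set I \<Longrightarrow> diag_exp I c (r, s) = 0"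
  unfolding diag_exp_def by auto

lemma diag_exp_Nil: "diag_exp [] c = (\<lambda>_. 0)"
  by (auto simp: diag_exp_def fun_eq_iff)

lemma diag_exp_Cons:
  assumes "r \<noteq> i"
  shows "diag_exp (i # I) c (r, s) = diag_exp I (Suc c) (r, s)"
proof (cases "c < s")
  case True
  then obtain d where "s = c + Suc d"
    using less_imp_Suc_add by auto
  then show ?thesis
    unfolding diag_exp_def by simp
qed (use assms in \<open>auto simp: diag_exp_def\<close>)

text \<open>If \<open>r\<close> occurs in \<open>I\<close> it comes first, and the entry in column
  \<open>c\<close> is the largest variable of that row that occurs. It occurs linearly, and its
  coefficient is the minor of the remaining rows, one column further right.\<close>

lemma lead_minor:
  assumes "sorted_wrt (<) I" "set I \<subseteq> {r..<R}" "c + length I \<le> N"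
  shows "lead (mat_vars N r R) (minor I c :: _ \<Rightarrow> 'a::{field}) (diag_exp I c) 1"
  using assms
proof (induction "R - r" arbitrary: r I c)
  case 0
  then have "I = []" by auto
  then show ?case
    using 0 by (simp add: mat_vars_def)
next
  case (Suc k)
  then have R: "r < R" by simp
  show ?case
  proof (cases I)
    case Nil
    then show ?thesis
      using lead_const[of "1::'a" "mat_vars N r R"] by (simp add: diag_exp_Nil)
  next
    case (Cons i I')
    show ?thesis
    proof (cases "i = r")
      case True
      have I': "sorted_wrt (<) I'" "set I' \<subseteq> {Suc r..<R}" "Suc c + length I' \<le> N"
        using Suc.prems True unfolding Cons by (auto simp: Suc_le_eq)
      then have r: "r \<notin> set I'" by auto
      let ?vs = "map (Pair r) [Suc c..<N] @ mat_vars N (Suc r) R"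
      have "lead (mat_vars N (Suc r) R) (minor I' (Suc c) :: _ \<Rightarrow> 'a) (diag_exp I' (Suc c)) 1"
        using Suc.hyps I' by (intro Suc.hyps(1)) auto
      then have "lead ?vs (minor I' (Suc c) :: _ \<Rightarrow> 'a) (diag_exp I' (Suc c)) 1"
        using r by (intro lead_skip) (auto simp: diag_exp_row_notin)
      then have lead: "lead ?vs (minor I' (Suc c) :: _ \<Rightarrow> 'a) (diag_exp I c) 1"
      proof (subst lead_cong[where E' = "diag_exp I' (Suc c)"])
        fix v assume "v \<in> set ?vs"
        then obtain s q where v: "v = (s, q)" "s = r \<and> Suc c \<le> q \<or> s \<noteq> r"
          by auto
        show "diag_exp I c v = diag_exp I' (Suc c) v"
        proof (cases "s = r")
          case True
          then have "Suc c \<le> q" using v by simp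
          have "I ! (q - c) \<noteq> r" if "q < c + length I"
          proof -
            have "I ! (q - c) = I' ! (q - Suc c)" "q - Suc c < length I'"
              using \<open>Suc c \<le> q\<close> that unfolding Cons by (auto simp: nth_Cons')
            then show ?thesis
              using r nth_mem by metis
          qed
          then have "diag_exp I c v = 0"
            using True unfolding v diag_exp_def by simp
          moreover have "diag_exp I' (Suc c) v = 0"
            unfolding v True using r by (rule diag_exp_row_notin)
          ultimately show ?thesis by simp
        next
          case False
          then show ?thesis
            using True unfolding v Cons by (simp add: diag_exp_Cons)
        qed
      qed
      obtain g where g: "g \<in> pfun ({i} \<times> {Suc c..<N} \<union> {Suc r..<R} \<times> {c..<N})"
        "minor I c = (\<lambda>x. x (i, c) * minor I' (Suc c) x + g x :: 'a)"
        using minor_Cons[of I' "{Suc r..<R}" c N i] I' unfolding Cons by auto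
      have "g \<in> pfun (set ?vs)"
        by (rule pfun_mono[OF g(1)]) (use True in auto)
      have "minor I' (Suc c) \<in> pfun (set ?vs)"
        by (rule pfun_mono[OF minor_pfun[OF I'(2,3)]]) auto
      have co: "(\<lambda>x. coeff [:g x, minor I' (Suc c) x:] k) \<in> pfun (set ?vs)" for k
      proof (cases k)
        case (Suc l)
        with \<open>minor I' (Suc c) \<in> pfun (set ?vs)\<close> show ?thesis
          by (cases l) (simp_all add: pfun.const)
      qed (use \<open>g \<in> pfun (set ?vs)\<close> in simp)
      have "poly_rep (set ?vs) (r, c) 1 (\<lambda>x. [:g x, minor I' (Suc c) x:]) (minor I c)"
        unfolding poly_rep_def using co True by (auto simp: g(2))
      moreover have "diag_exp I c (r, c) = 1"
        unfolding Cons True diag_exp_def by simp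
      ultimately have "lead ((r, c) # ?vs) (minor I c :: _ \<Rightarrow> 'a) (diag_exp I c) 1"
        unfolding lead.simps using lead
        by (intro exI[of _ "\<lambda>x. [:g x, minor I' (Suc c) x:]"] conjI) simp_all
      then have "lead (map (Pair r) [0..<c] @ (r, c) # ?vs) (minor I c :: _ \<Rightarrow> 'a) (diag_exp I c) 1"
        by (rule lead_skip) (auto simp: diag_exp_def)
      moreover have "mat_vars N r R = map (Pair r) [0..<c] @ (r, c) # ?vs"
        using R Suc.prems Cons by (simp add: mat_vars_eq row_vars_split[of c])
      ultimately show ?thesis by simp
    next
      case False
      have "r < a" if "a \<in> set I" for a
      proof -
        have "r \<le> i" "i \<le> a"
          using Suc.prems that unfolding Cons by auto
        with False show ?thesis by simp
      qed
      then have I: "set I \<subseteq> {Suc r..<R}" "r \<notin> set I"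
        using Suc.prems(2) by fastforce+
      have "lead (mat_vars N (Suc r) R) (minor I c :: _ \<Rightarrow> 'a) (diag_exp I c) 1"
        using Suc.hyps(2) Suc.prems I(1) by (intro Suc.hyps(1)) auto
      then have "lead (row_vars N r @ mat_vars N (Suc r) R) (minor I c :: _ \<Rightarrow> 'a) (diag_exp I c) 1"
        using I(2) by (intro lead_skip) (auto simp: diag_exp_row_notin)
      then show ?thesis using R by (simp add: mat_vars_eq)
    qed
  qed
qed

text \<open>\<open>r s\<close> counts the factors with more than \<open>s\<close> rows. It is at
  once the shape of the product as a tableau and its weight under scaling of column
  \<open>s\<close>.\<close>

inductive flagprod :: "nat \<Rightarrow> (nat \<Rightarrow> nat) \<Rightarrow> ((nat \<times> nat \<Rightarrow> 'a::comm_ring_1) \<Rightarrow> 'a) \<Rightarrow> bool" for N where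
  one: "flagprod N (\<lambda>_. 0) (\<lambda>_. 1)"
| minor: "flagprod N r h \<Longrightarrow> sorted_wrt (<) I \<Longrightarrow> set I \<subseteq> {..<N} \<Longrightarrow> I \<noteq> [] \<Longrightarrow>
    flagprod N (\<lambda>s. r s + (if s < length I then 1 else 0)) (\<lambda>x. minor I 0 x * h x)"

lemma sorted_wrt_less_length: "sorted_wrt (<) I \<Longrightarrow> set I \<subseteq> {..<N::nat} \<Longrightarrow> length I \<le> N"
  by (metis card_lessThan card_mono distinct_card finite_lessThan strict_sorted_iff)

lemma flagprod_pfun: "flagprod N r h \<Longrightarrow> h \<in> pfun ({..<N} \<times> {..<N})"
proof (induction rule: flagprod.induct)
  case (minor r h I)
  then have "minor I 0 \<in> pfun ({..<N} \<times> {0..<N})"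
    by (intro minor_pfun) (auto dest: sorted_wrt_less_length)
  with minor show ?case
    by (auto intro: pfun.mult simp: lessThan_atLeast0)
qed (auto intro: pfun.const)

definition rmul :: "nat \<Rightarrow> (nat \<times> nat \<Rightarrow> 'a::comm_ring_1) \<Rightarrow> (nat \<times> nat \<Rightarrow> 'a) \<Rightarrow> nat \<times> nat \<Rightarrow> 'a" where
  "rmul N x b = (\<lambda>(r, c). \<Sum>u<N. x (r, u) * b (u, c))"

text \<open>For upper triangular \<open>b\<close> the leftmost columns of the product involve only
  the leftmost columns of \<open>x\<close>, so the submatrix is itself a product of square
  matrices.\<close>

lemma minor_rmul:
  fixes b :: "nat \<times> nat \<Rightarrow> 'a::comm_ring_1"
  assumes "length I \<le> N" and upper: "\<And>u c. c < u \<Longrightarrow> u < N \<Longrightarrow> b (u, c) = 0"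
  shows "minor I 0 (rmul N x b) = (\<Prod>s<length I. b (s, s)) * minor I 0 x"
proof -
  define m where "m = length I"
  define X where "X = mat m m (\<lambda>(a, c). x (I ! a, c))"
  define B where "B = mat m m b"
  have "mat m m (\<lambda>(a, c). rmul N x b (I ! a, c)) = X * B"
  proof (rule eq_matI)
    fix a c assume "a < dim_row (X * B)" "c < dim_col (X * B)"
    then have ac: "a < m" "c < m" by (auto simp: X_def B_def)
    have "(\<Sum>u<N. x (I ! a, u) * b (u, c)) = (\<Sum>u<m. x (I ! a, u) * b (u, c))"
      using assms(1) ac upper unfolding m_def[symmetric]
      by (intro sum.mono_neutral_right) (auto simp: not_less)
    also have "\<dots> = (X * B) $$ (a, c)"
      using ac by (auto simp: X_def B_def scalar_prod_def lessThan_atLeast0)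
    finally show "mat m m (\<lambda>(a, c). rmul N x b (I ! a, c)) $$ (a, c) = (X * B) $$ (a, c)"
      using ac by (simp add: rmul_def)
  qed (auto simp: X_def B_def)
  moreover have "det (X * B) = det X * det B"
    by (rule det_mult[of _ m]) (auto simp: X_def B_def)
  ultimately have "minor I 0 (rmul N x b) = det X * det B"
    unfolding minor_def m_def[symmetric] by simp
  also have "det B = (\<Prod>s<m. b (s, s))"
  proof -
    have "upper_triangular B" "B \<in> carrier_mat m m"
      using assms unfolding B_def m_def upper_triangular_def by auto
    then have "det B = prod_list (diag_mat B)"
      by (rule det_upper_triangular)
    also have "\<dots> = (\<Prod>s<m. b (s, s))"
      unfolding diag_mat_def B_def
      by (simp add: prod.distinct_set_conv_list[symmetric] lessThan_atLeast0 cong: map_cong)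
    finally show ?thesis .
  qed
  finally show ?thesis
    unfolding X_def minor_def m_def by simp
qed

lemma flagprod_rmul:
  assumes "flagprod N r h" and upper: "\<And>u c. c < u \<Longrightarrow> u < N \<Longrightarrow> b (u, c) = 0"
  shows "h (rmul N x b) = (\<Prod>s<N. b (s, s) ^ r s) * h x"
  using assms(1)
proof (induction rule: flagprod.induct)
  case (minor r h I)
  have len: "length I \<le> N"
    using minor by (auto dest: sorted_wrt_less_length)
  have "(\<Prod>s<N. b (s, s) ^ (if s < length I then 1 else 0)) = (\<Prod>s<length I. b (s, s))"
    using len by (intro prod.mono_neutral_cong_right) auto
  then have w: "(\<Prod>s<N. b (s, s) ^ (r s + (if s < length I then 1 else 0)))
    = (\<Prod>s<N. b (s, s) ^ r s) * (\<Prod>s<length I. b (s, s))"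
    unfolding power_add prod.distrib by simp
  have "minor I 0 (rmul N x b) = (\<Prod>s<length I. b (s, s)) * minor I 0 x"
    using len upper by (rule minor_rmul)
  then show ?case
    unfolding w minor.IH by (simp only: ac_simps)
qed simp

text \<open>The drop from \<open>r (c - 1)\<close> to \<open>r c\<close> is the number of factors
  with exactly \<open>c\<close> rows.\<close>

lemma flagprod_factor:
  assumes "flagprod N r h" "0 < c" "r c < r (c - 1)"
  shows "\<exists>I h' r'. h = (\<lambda>x. minor I 0 x * h' x) \<and> flagprod N r' h' \<and> length I = c \<and>
    sorted_wrt (<) I \<and> set I \<subseteq> {..<N} \<and> (\<forall>s. r s = r' s + (if s < c then 1 else 0))"
  using assms
proof (induction rule: flagprod.induct)
  case (minor r h J)
  show ?case
  proof (cases "length J = c")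
    case True
    then show ?thesis using minor.hyps
      by (intro exI[of _ J] exI[of _ h] exI[of _ r]) auto
  next
    case False
    then have "r c < r (c - 1)"
      using minor.prems by (auto split: if_splits)
    then obtain I h' r' where *: "h = (\<lambda>x. minor I 0 x * h' x)" "flagprod N r' h'" "length I = c"
      "sorted_wrt (<) I" "set I \<subseteq> {..<N}" "\<forall>s. r s = r' s + (if s < c then 1 else 0)"
      using minor by blast
    have "flagprod N (\<lambda>s. r' s + (if s < length J then 1 else 0)) (\<lambda>x. minor J 0 x * h' x)"
      using * minor by (intro flagprod.minor) auto
    then show ?thesis
      using * by (intro exI[of _ I] exI[of _ "\<lambda>x. minor J 0 x * h' x"]
          exI[of _ "\<lambda>s. r' s + (if s < length J then 1 else 0)"]) (auto simp: ac_simps)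
  qed
qed simp

text \<open>In terms of tableaux: columns increase strictly, because the entries up to
  \<open>i\<close> in row \<open>Suc j\<close> must all fit under entries less than \<open>i\<close>
  in row \<open>j\<close>.\<close>

definition ballot :: "nat \<Rightarrow> (nat \<times> nat \<Rightarrow> nat) \<Rightarrow> bool" where
  "ballot N E \<longleftrightarrow> (\<forall>j i. Suc j < N \<longrightarrow> i < N \<longrightarrow> (\<Sum>s\<le>i. E (s, Suc j)) \<le> (\<Sum>s<i. E (s, j)))"

text \<open>The ballot inequality at the last index \<open>N - 1\<close>; in the tableau, lower rows
  are not longer.\<close>

lemma ballot_column_antimono:
  assumes "ballot N E" "s \<le> t" "t < N"
  shows "(\<Sum>i<N. E (i, t)) \<le> (\<Sum>i<N. E (i, s))"
  using assms(2,3)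
proof (induction rule: dec_induct)
  case (step t)
  then have "(\<Sum>i<N. E (i, Suc t)) = (\<Sum>i\<le>N - 1. E (i, Suc t))"
    by (intro sum.cong) auto
  also have "\<dots> \<le> (\<Sum>i<N - 1. E (i, t))"
    using assms(1) step unfolding ballot_def by auto
  also have "\<dots> \<le> (\<Sum>i<N. E (i, t))"
    by (intro sum_mono2) auto
  finally show ?case using step by auto
qed simp

text \<open>
  Read \<open>E (i, s)\<close> as the number of entries \<open>i\<close> in row \<open>s\<close> of a semistandard tableau. The proof peels
  off its leftmost column, whose entry in row \<open>s\<close> is the least \<open>i\<close> with \<open>E (i, s) > 0\<close>.
\<close>
lemma ballot_realized_by_flagprod:
  assumes "ballot N E"
  shows "\<exists>h :: _ \<Rightarrow> 'a::field. flagprod N (\<lambda>s. if s < N then \<Sum>i<N. E (i, s) else 0) h \<and>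
    lead (mat_vars N 0 N) h E 1"
  using assms
proof (induction "\<Sum>i<N. E (i, 0)" arbitrary: E)
  case 0
  then have "(\<Sum>i<N. E (i, s)) = 0" if "s < N" for s
    using ballot_column_antimono[of N E 0 s] that by simp
  then have zero: "E (i, s) = 0" if "i < N" "s < N" for i s
    using that by simp
  then have "(\<lambda>s. if s < N then \<Sum>i<N. E (i, s) else 0) = (\<lambda>_. 0)"
    by (auto simp: fun_eq_iff)
  moreover have "lead (mat_vars N 0 N) (\<lambda>_. 1 :: 'a) E 1"
    using zero by (subst lead_cong[where E' = "\<lambda>_. 0"]) (auto intro: lead_const)
  ultimately show ?case
    using flagprod.one by metis
next
  case (Suc n)
  define col where "col s = (\<Sum>i<N. E (i, s))" for s
  \<comment> \<open>The height of the leftmost column of the tableau, that is, the number of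
    nonempty rows.\<close>
  define c where "c = (LEAST c. c = N \<or> col c = 0)"
  have c: "c = N \<or> col c = 0" "c \<le> N"
    unfolding c_def by (rule LeastI2[of _ N]; simp) (rule Least_le; simp)
  have pos: "col s > 0" if "s < c" for s
    using not_less_Least[of s "\<lambda>c. c = N \<or> col c = 0"] that unfolding c_def by auto
  have col0: "col s = 0" if "c \<le> s" "s < N" for s
    using c(1) ballot_column_antimono[OF Suc.prems that] that unfolding col_def by auto
  define i where "i s = (LEAST q. E (q, s) > 0)" for s
  have i: "E (i s, s) > 0" "i s < N" and below: "\<And>q. q < i s \<Longrightarrow> E (q, s) = 0" if s: "s < c" for s
  proof -
    have "\<exists>q<N. E (q, s) > 0"
      using pos[OF s] unfolding col_def by (rule contrapos_pp) simp
    then obtain q where q: "q < N" "E (q, s) > 0"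
      by blast
    show "E (i s, s) > 0"
      unfolding i_def by (rule LeastI[of "\<lambda>q. E (q, s) > 0", OF q(2)])
    show "i s < N"
      using Least_le[of "\<lambda>q. E (q, s) > 0", OF q(2)] q(1) unfolding i_def by simp
    show "E (q, s) = 0" if "q < i s" for q
      using not_less_Least[of q "\<lambda>q. E (q, s) > 0"] that unfolding i_def by simp
  qed
  \<comment> \<open>Otherwise the ballot inequality at \<open>i (Suc s)\<close> bounds a positive
    sum by one whose terms all vanish.\<close>
  have i_less: "i s < i (Suc s)" if "Suc s < c" for s
  proof (rule ccontr)
    assume *: "\<not> i s < i (Suc s)"
    have "0 < E (i (Suc s), Suc s)"
      using i that by simp
    also have "\<dots> \<le> (\<Sum>q\<le>i (Suc s). E (q, Suc s))"
      by (rule member_le_sum) auto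
    also have "\<dots> \<le> (\<Sum>q<i (Suc s). E (q, s))"
      using Suc.prems that i(2)[OF that] c(2) unfolding ballot_def by auto
    also have "\<dots> = 0"
      using below[of s] that * by (auto intro!: sum.neutral)
    finally show False by simp
  qed
  have i_mono: "i s < i t" if "s < t" "t < c" for s t
    using that
  proof (induction t)
    case (Suc t)
    then show ?case using i_less[of t] by (cases "s = t") auto
  qed simp
  define I where "I = map i [0..<c]"
  have I: "sorted_wrt (<) I" "set I \<subseteq> {..<N}" "length I = c"
    unfolding I_def using i i_mono by (auto simp: sorted_wrt_iff_nth_less)
  define D where "D = diag_exp I 0"
  have D: "D (q, s) = (if s < c \<and> i s = q then 1 else 0)" for q s
    unfolding D_def diag_exp_def I_def by auto
  define E' where "E' v = E v - D v" for v
  have E: "E v = E' v + D v" for v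
    using i(1) unfolding E'_def by (cases v) (auto simp: D)
  have sumE: "(\<Sum>q\<in>A. E (q, s)) = (\<Sum>q\<in>A. E' (q, s)) + (if s < c \<and> i s \<in> A then 1 else 0)"
    if "finite A" for A s
    using that by (auto simp: E sum.distrib D)
  have "ballot N E'"
    unfolding ballot_def
  proof (intro allI impI)
    fix j k assume jk: "Suc j < N" "k < N"
    have *: "(\<Sum>s\<le>k. E (s, Suc j)) \<le> (\<Sum>s<k. E (s, j))"
      using Suc.prems jk unfolding ballot_def by blast
    show "(\<Sum>s\<le>k. E' (s, Suc j)) \<le> (\<Sum>s<k. E' (s, j))"
    \<comment> \<open>In the first case the left sum drops by exactly one and the right sum by at
      most one. In the second case no entry up to \<open>k\<close> occurs in row
      \<open>Suc j\<close>.\<close>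
    proof (cases "Suc j < c \<and> i (Suc j) \<le> k")
      case True
      then show ?thesis
        using * sumE[of "{..k}" "Suc j"] sumE[of "{..<k}" j] by (simp split: if_splits)
    next
      case False
      have "E' (s, Suc j) = 0" if "s \<le> k" for s
      proof (cases "Suc j < c")
        case True
        then have "E (s, Suc j) = 0"
          using below[of "Suc j" s] False that by auto
        then show ?thesis unfolding E'_def by simp
      next
        case False
        then have "(\<Sum>i<N. E (i, Suc j)) = 0"
          using col0[of "Suc j"] jk unfolding col_def by simp
        then show ?thesis
          using that jk unfolding E'_def by simp
      qed
      then show ?thesis by simp
    qed
  qed
  have "c > 0"
  proof (rule ccontr)
    assume "\<not> c > 0"
    then have "N = 0 \<or> col 0 = 0" using c by simp
    then show False using Suc.hyps(2) unfolding col_def by auto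
  qed
  then have "(\<Sum>q<N. E' (q, 0)) = n"
    using sumE[of "{..<N}" 0] Suc.hyps(2) i(2)[of 0] by simp
  from Suc.hyps(1)[OF this[symmetric] \<open>ballot N E'\<close>]
  obtain h :: "_ \<Rightarrow> 'a" where h: "flagprod N (\<lambda>s. if s < N then \<Sum>i<N. E' (i, s) else 0) h"
    "lead (mat_vars N 0 N) h E' 1"
    by blast
  have "flagprod N (\<lambda>s. (if s < N then \<Sum>i<N. E' (i, s) else 0) + (if s < length I then 1 else 0))
      (\<lambda>x. minor I 0 x * h x)"
    using I \<open>c > 0\<close> by (intro flagprod.minor h(1)) auto
  moreover have "(\<lambda>s. (if s < N then \<Sum>i<N. E' (i, s) else 0) + (if s < length I then 1 else 0))
      = (\<lambda>s. if s < N then \<Sum>i<N. E (i, s) else 0)"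
    using sumE[of "{..<N}"] i(2) c(2) I(3) by (auto simp: fun_eq_iff)
  moreover have "lead (mat_vars N 0 N) (\<lambda>x. minor I 0 x * h x) (\<lambda>v. D v + E' v) (1 * 1)"
    unfolding D_def using I c(2) by (intro lead_mult[OF lead_minor h(2)]) auto
  moreover have "(\<lambda>v. D v + E' v) = E"
    by (auto simp: E fun_eq_iff)
  ultimately show ?case
    by auto
qed

section \<open>Column weights and the span of the products of flag minors\<close>

definition scale_col :: "nat \<Rightarrow> 'a::comm_ring_1 \<Rightarrow> (nat \<times> nat \<Rightarrow> 'a) \<Rightarrow> nat \<times> nat \<Rightarrow> 'a" where
  "scale_col s t x = (\<lambda>(r, c). if c = s then t * x (r, c) else x (r, c))"

text \<open>Homogeneity in column \<open>s\<close> is inherited by leading coefficients.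
  \<open>\<alpha>\<close> collects the exponents of the variables stripped so far; at the end a
  nonzero constant is left, which forces \<open>\<alpha> = \<beta>\<close>.\<close>

lemma lead_column_weight:
  fixes f :: "(nat \<times> nat \<Rightarrow> 'a::{field,infinite}) \<Rightarrow> 'a"
  assumes "lead vs f E a" "distinct vs"
    and "\<And>x t. t \<noteq> 0 \<Longrightarrow> t ^ \<alpha> * f (scale_col s t x) = t ^ \<beta> * f x"
  shows "\<alpha> + (\<Sum>v\<in>{v \<in> set vs. snd v = s}. E v) = \<beta>"
  using assms
proof (induction vs arbitrary: f \<alpha>)
  case Nil
  then have "monom a \<alpha> = monom a \<beta>"
    by (intro poly_eqI_infinite_nz) (simp add: poly_monom ac_simps)
  then have "coeff (monom a \<alpha>) \<alpha> = coeff (monom a \<beta>) \<alpha>"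
    by simp
  then show ?case
    using Nil by (simp split: if_splits)
next
  case (Cons v vs)
  from Cons.prems obtain P where P: "poly_rep (set vs) v (E v) P f"
    and lead: "lead vs (\<lambda>x. coeff (P x) (E v)) E a"
    by auto
  have Pp: "(\<lambda>x. coeff (P x) k) \<in> pfun (set vs)" "degree (P x) \<le> E v" "f x = poly (P x) (x v)" for k x
    using P unfolding poly_rep_def by blast+
  define \<delta> :: nat where "\<delta> = (if snd v = s then 1 else 0)"
  have v: "v \<notin> set vs" using Cons.prems by simp
  have co: "coeff (P (x(v := z))) k = coeff (P x) k" for x z k
    by (rule pfun_cong[OF Pp(1)]) (use v in auto)
  have f: "f (x(v := z)) = (\<Sum>k\<le>E v. z ^ k * coeff (P x) k)" for x z
  proof -
    have "f (x(v := z)) = (\<Sum>k\<le>E v. coeff (P (x(v := z))) k * z ^ k)"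
      unfolding Pp(3) poly_altdef using Pp(2)
      by (auto intro!: sum.mono_neutral_left dest: le_degree intro: order_trans)
    then show ?thesis by (simp add: co mult.commute)
  qed
  have "t ^ (\<alpha> + \<delta> * E v) * coeff (P (scale_col s t x)) (E v) = t ^ \<beta> * coeff (P x) (E v)"
    if "t \<noteq> 0" for x t
  proof -
    have "(\<Sum>k\<le>E v. z ^ k * (t ^ (\<alpha> + \<delta> * k) * coeff (P (scale_col s t x)) k))
        = (\<Sum>k\<le>E v. z ^ k * (t ^ \<beta> * coeff (P x) k))" for z
    proof -
      have upd: "scale_col s t (x(v := z)) = (scale_col s t x)(v := t ^ \<delta> * z)"
        by (auto simp: scale_col_def \<delta>_def fun_eq_iff)
      have "t ^ \<alpha> * f (scale_col s t (x(v := z))) = t ^ \<beta> * f (x(v := z))"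
        using Cons.prems(3) that by blast
      then show ?thesis
        unfolding upd f sum_distrib_left power_add power_mult by (simp add: power_mult_distrib ac_simps)
    qed
    from coeff_eq_of_sums_eq[OF this, of "E v"] show ?thesis by simp
  qed
  from Cons.IH[OF lead _ this]
  have "\<alpha> + \<delta> * E v + (\<Sum>v\<in>{v \<in> set vs. snd v = s}. E v) = \<beta>"
    using Cons.prems by simp
  moreover have "{u \<in> set (v # vs). snd u = s} = (if snd v = s then {v} else {}) \<union> {v \<in> set vs. snd v = s}"
    by auto
  ultimately show ?case
    using v by (simp add: \<delta>_def split: if_splits)
qed

inductive_set flagspan :: "nat \<Rightarrow> (nat \<Rightarrow> nat) \<Rightarrow> ((nat \<times> nat \<Rightarrow> 'a::comm_ring_1) \<Rightarrow> 'a) set" for N r where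
  zero: "(\<lambda>_. 0) \<in> flagspan N r"
| add: "f \<in> flagspan N r \<Longrightarrow> flagprod N r h \<Longrightarrow> (\<lambda>x. f x + a * h x) \<in> flagspan N r"

lemma flagprod_add_col:
  assumes "flagprod N r h" "Suc j < N"
  shows "h (add_col j t x) = h x"
proof -
  define b where "b = (\<lambda>(u, c). if u = c then 1 else if u = j \<and> c = Suc j then t else 0)"
  have "h (add_col j t x) = h (rmul N x b)"
  proof (rule pfun_cong[OF flagprod_pfun[OF assms(1)]])
    fix v :: "nat \<times> nat" assume "v \<in> {..<N} \<times> {..<N}"
    then obtain q c where v: "v = (q, c)" "c < N" by auto
    have "rmul N x b v = (\<Sum>u<N. (if u = c then x (q, u) else 0) + (if u = j \<and> c = Suc j then t * x (q, u) else 0))"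
      unfolding rmul_def v b_def by (auto intro!: sum.cong)
    also have "\<dots> = x (q, c) + (if c = Suc j then t * x (q, j) else 0)"
      using v assms(2) by (auto simp: sum.distrib cong: if_cong)
    finally show "add_col j t x v = rmul N x b v"
      by (simp add: v add_col_def)
  qed
  also have "\<dots> = (\<Prod>s<N. b (s, s) ^ r s) * h x"
    by (rule flagprod_rmul[OF assms(1)]) (auto simp: b_def)
  finally show ?thesis by (simp add: b_def)
qed

lemma flagprod_scale_col:
  assumes "flagprod N r h" "s < N"
  shows "h (scale_col s t x) = t ^ r s * h x"
proof -
  define b where "b = (\<lambda>(u, c). if u = c then if c = s then t else 1 else 0)"
  have "h (scale_col s t x) = h (rmul N x b)"
  proof (rule pfun_cong[OF flagprod_pfun[OF assms(1)]])
    fix v :: "nat \<times> nat" assume "v \<in> {..<N} \<times> {..<N}"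
    then obtain q c where v: "v = (q, c)" "c < N" by auto
    have "rmul N x b v = (\<Sum>u<N. if u = c then x (q, u) * (if c = s then t else 1) else 0)"
      unfolding rmul_def v b_def prod.case by (intro sum.cong refl) simp
    also have "\<dots> = x (q, c) * (if c = s then t else 1)"
      using v by (simp only: sum.delta finite_lessThan lessThan_iff if_True)
    finally show "scale_col s t x v = rmul N x b v"
      by (simp add: v scale_col_def)
  qed
  also have "\<dots> = (\<Prod>s<N. b (s, s) ^ r s) * h x"
    by (rule flagprod_rmul[OF assms(1)]) (auto simp: b_def)
  also have "(\<Prod>s<N. b (s, s) ^ r s) = (\<Prod>u<N. if u = s then t ^ r u else 1)"
    by (intro prod.cong refl) (simp add: b_def)
  also have "\<dots> = t ^ r s"
    using assms(2) by simp
  finally show ?thesis .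
qed

theorem unipotent_invariants_in_flagspan:
  fixes f :: "(nat \<times> nat \<Rightarrow> 'a::{field,infinite}) \<Rightarrow> 'a"
  assumes "f \<in> pfun ({..<N} \<times> {..<N})"
    and "\<And>j t x. Suc j < N \<Longrightarrow> f (add_col j t x) = f x"
    and "\<And>s t x. s < N \<Longrightarrow> t \<noteq> 0 \<Longrightarrow> f (scale_col s t x) = t ^ r s * f x"
    and "\<And>s. N \<le> s \<Longrightarrow> r s = 0"
  shows "f \<in> flagspan N r"
proof -
  have vars: "set (mat_vars N 0 N) = {..<N} \<times> {..<N}"
    by auto
  have "f \<in> flagspan N r"
    if "f = (\<lambda>_. 0) \<or> lead (mat_vars N 0 N) f E a"
      and "\<And>j t x. Suc j < N \<Longrightarrow> f (add_col j t x) = f x"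
      and "\<And>s t x. s < N \<Longrightarrow> t \<noteq> 0 \<Longrightarrow> f (scale_col s t x) = t ^ r s * f x" for f :: "_ \<Rightarrow> 'a" and E a
    using that
  proof (induction E arbitrary: f a rule: wf_induct_rule[OF wf_lex_less[of "mat_vars N 0 N"]])
    case (1 E)
    show ?case
    proof (cases "f = (\<lambda>_. 0)")
      case True
      then show ?thesis by (simp add: flagspan.zero)
    next
      case False
      then have lead: "lead (mat_vars N 0 N) f E a"
        using "1.prems" by blast
      have "ballot N E"
        unfolding ballot_def using lead_ballot[OF lead] "1.prems"(2) by blast
      then obtain h :: "_ \<Rightarrow> 'a" where h: "flagprod N (\<lambda>s. if s < N then \<Sum>i<N. E (i, s) else 0) h"
        "lead (mat_vars N 0 N) h E 1"
        using ballot_realized_by_flagprod by blast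
      \<comment> \<open>The weight fixes the shape: the product \<open>h\<close> has the weight of
        \<open>f\<close>, so the difference satisfies the same hypotheses and the descent can go
        on.\<close>
      have "(\<Sum>i<N. E (i, s)) = r s" if "s < N" for s
      proof -
        have "0 + (\<Sum>v\<in>{v \<in> set (mat_vars N 0 N). snd v = s}. E v) = r s"
          by (rule lead_column_weight[OF lead]) (use "1.prems"(3) that in auto)
        moreover have "{v \<in> set (mat_vars N 0 N). snd v = s} = (\<lambda>i. (i, s)) ` {..<N}"
          using that by auto
        ultimately show ?thesis
          by (simp add: sum.reindex inj_on_def)
      qed
      then have "(\<lambda>s. if s < N then \<Sum>i<N. E (i, s) else 0) = r"
        using assms(4) by (auto simp: fun_eq_iff)
      with h(1) have hr: "flagprod N r h" by simp
      have "lead (mat_vars N 0 N) (\<lambda>x. a * h x) E (a * 1)"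
        by (rule lead_scale[OF h(2) lead_nonzero_coeff[OF lead]])
      then consider "(\<lambda>x. f x - a * h x) = (\<lambda>_. 0)"
        | E' a' where "lead (mat_vars N 0 N) (\<lambda>x. f x - a * h x) E' a'" "lex_less (mat_vars N 0 N) E' E"
        using lead_diff[of "mat_vars N 0 N" f E a "\<lambda>x. a * h x"] lead by auto
      then have "(\<lambda>x. f x - a * h x) \<in> flagspan N r"
      proof cases
        case 1
        then show ?thesis by (simp add: flagspan.zero)
      next
        case 2
        show ?thesis
        proof (rule "1.IH")
          show "(E', E) \<in> {(E, F). lex_less (mat_vars N 0 N) E F}"
            using 2 by simp
        next
          show "(\<lambda>x. f x - a * h x) = (\<lambda>_. 0) \<or> lead (mat_vars N 0 N) (\<lambda>x. f x - a * h x) E' a'"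
            using 2 by blast
        next
          fix j t x assume "Suc j < N"
          then show "f (add_col j t x) - a * h (add_col j t x) = f x - a * h x"
            using "1.prems"(2) flagprod_add_col[OF hr] by simp
        next
          fix s t x assume "s < N" "t \<noteq> (0 :: 'a)"
          then show "f (scale_col s t x) - a * h (scale_col s t x) = t ^ r s * (f x - a * h x)"
            using "1.prems"(3) flagprod_scale_col[OF hr] by (simp add: right_diff_distrib ac_simps)
        qed
      qed
      from flagspan.add[OF this hr, of a] show ?thesis by simp
    qed
  qed
  moreover obtain E a where "f = (\<lambda>_. 0) \<or> lead (mat_vars N 0 N) f E a"
    using exists_lead[of f "mat_vars N 0 N"] assms(1) unfolding vars by auto
  ultimately show ?thesis
    using assms(2,3) by blast
qed


section \<open>Elementary matrices\<close>

lemma SL_simps [simp]: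
  "mult (SL n) = (*)" "one (SL n) = 1\<^sub>m n" "A \<in> carrier (SL n) \<longleftrightarrow> A \<in> carrier_mat n n \<and> det A = 1"
  unfolding SL_def by auto

lemma group_SL: "group (SL n :: 'a::field mat monoid)"
proof (rule groupI)
  fix A :: "'a mat" assume "A \<in> carrier (SL n)"
  then have A: "A \<in> carrier_mat n n" "det A = 1" by auto
  have "det (adj_mat A * A) = det (adj_mat A) * det A"
    by (rule det_mult) (use A adj_mat in auto)
  then have "det (adj_mat A) = 1"
    using adj_mat[OF A(1)] A(2) by simp
  then show "\<exists>B\<in>carrier (SL n). B \<otimes>\<^bsub>SL n\<^esub> A = \<one>\<^bsub>SL n\<^esub>"
    using adj_mat[OF A(1)] A(2) by (intro bexI[of _ "adj_mat A"]) auto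
qed (auto simp: det_mult)

interpretation SL: group "SL n" for n :: nat
  by (rule group_SL)

lemma SL_inv_eq_adj: "A \<in> carrier_mat n n \<Longrightarrow> det A = 1 \<Longrightarrow> inv\<^bsub>SL n\<^esub> A = adj_mat A"
proof -
  assume A: "A \<in> carrier_mat n n" "det A = 1"
  have "det (A * adj_mat A) = det A * det (adj_mat A)"
    by (rule det_mult) (use A adj_mat in auto)
  then have "det (adj_mat A) = 1"
    using adj_mat[OF A(1)] A(2) by simp
  then show ?thesis
    using adj_mat[OF A(1)] A by (intro SL.inv_equality) auto
qed

text \<open>Root elements with rows and columns numbered from 0.\<close>
abbreviation el :: "nat \<Rightarrow> nat \<Rightarrow> nat \<Rightarrow> 'a::field \<Rightarrow> 'a mat" where
  "el n i j t \<equiv> root_elem n (Suc i) (Suc j) t"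

lemma el_carrier [simp]: "root_elem n i j t \<in> carrier_mat n n"
  unfolding root_elem_def by auto

lemma el_dims [simp]: "dim_row (root_elem n i j t) = n" "dim_col (root_elem n i j t) = n"
  unfolding root_elem_def by auto

lemma el_index:
  "r < n \<Longrightarrow> c < n \<Longrightarrow> el n i j t $$ (r, c) = (if r = c then 1 else if r = i \<and> c = j then t else 0)"
  unfolding root_elem_def by auto

lemma det_el: "i \<noteq> j \<Longrightarrow> det (el n i j t) = (1 :: 'a::field)"
proof -
  assume ij: "i \<noteq> j"
  have "el n i j t = addrow_mat n t i j"
    by (rule eq_matI) (use ij in \<open>auto simp: el_index\<close>)
  then show ?thesis using det_addrow_mat[OF ij] by metis
qed

lemma el_mult:
  assumes "A \<in> carrier_mat n n" "i < n" "j < n" "i \<noteq> j" "r < n" "c < n"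
  shows "(el n i j t * A) $$ (r, c) = A $$ (r, c) + (if r = i then t * A $$ (j, c) else (0 :: 'a::field))"
proof -
  have "(el n i j t * A) $$ (r, c) = (\<Sum>u<n. el n i j t $$ (r, u) * A $$ (u, c))"
    using assms by (auto simp: scalar_prod_def lessThan_atLeast0)
  also have "\<dots> = (\<Sum>u<n. (if u = r then A $$ (u, c) else 0) + (if u = j then if r = i then t * A $$ (u, c) else 0 else 0))"
    using assms by (intro sum.cong refl) (auto simp: el_index)
  finally show ?thesis
    using assms unfolding sum.distrib by simp
qed

lemma mult_el:
  assumes "A \<in> carrier_mat n n" "i < n" "j < n" "i \<noteq> j" "r < n" "c < n"
  shows "(A * el n i j t) $$ (r, c) = A $$ (r, c) + (if c = j then t * A $$ (r, i) else (0 :: 'a::field))"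
proof -
  have "(A * el n i j t) $$ (r, c) = (\<Sum>u<n. A $$ (r, u) * el n i j t $$ (u, c))"
    using assms by (auto simp: scalar_prod_def lessThan_atLeast0)
  also have "\<dots> = (\<Sum>u<n. (if u = c then A $$ (r, u) else 0) + (if u = i then if c = j then t * A $$ (r, u) else 0 else 0))"
    using assms by (intro sum.cong refl) (auto simp: el_index)
  finally show ?thesis
    using assms unfolding sum.distrib by simp
qed

lemma el_zero [simp]: "root_elem n i j 0 = 1\<^sub>m n"
  unfolding root_elem_def by (rule eq_matI) auto

lemma el_add:
  assumes "i < n" "j < n" "i \<noteq> j"
  shows "el n i j s * el n i j t = el n i j (s + t :: 'a::field)"
  by (rule eq_matI) (use assms in \<open>auto simp: el_mult el_index simp del: index_mult_mat(1)\<close>)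

lemma el_in_SL: "i \<noteq> j \<Longrightarrow> el n i j t \<in> carrier (SL n)"
  by (simp add: det_el)

lemma inv_el:
  assumes "i < n" "j < n" "i \<noteq> j"
  shows "inv\<^bsub>SL n\<^esub> (el n i j t) = el n i j (- t)"
  using assms by (intro SL.inv_equality) (simp_all add: el_add det_el)

text \<open>The right-hand side is a group commutator, the inverses being root elements of negated
  parameter. It reaches the other roots from the simple ones.\<close>

lemma el_commutator:
  assumes "i < n" "j < n" "k < n" "i \<noteq> j" "i \<noteq> k" "j \<noteq> k"
  shows "el n i j t = el n i k t * (el n k j 1 * (el n i k (- t) * el n k j (- 1 :: 'a::field)))"
proof -
  define X where "X = el n i k (- t) * el n k j (- 1 :: 'a)"
  define Y where "Y = el n k j (1 :: 'a) * X"
  have carr: "X \<in> carrier_mat n n" "Y \<in> carrier_mat n n"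
    unfolding X_def Y_def by auto
  have X: "X $$ (r, c) = el n k j (- 1) $$ (r, c) + (if r = i then - t * el n k j (- 1) $$ (k, c) else 0)"
    if "r < n" "c < n" for r c
    unfolding X_def using assms that by (intro el_mult) auto
  have Y: "Y $$ (r, c) = X $$ (r, c) + (if r = k then 1 * X $$ (j, c) else 0)" if "r < n" "c < n" for r c
    unfolding Y_def using assms that carr by (intro el_mult) auto
  have Z: "(el n i k t * Y) $$ (r, c) = Y $$ (r, c) + (if r = i then t * Y $$ (k, c) else 0)" if "r < n" "c < n" for r c
    using assms that carr by (intro el_mult) auto
  have "el n i j t = el n i k t * Y"
  proof (rule eq_matI)
    fix r c assume "r < dim_row (el n i k t * Y)" "c < dim_col (el n i k t * Y)"
    then have "r < n" "c < n" using carr by auto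
    then show "el n i j t $$ (r, c) = (el n i k t * Y) $$ (r, c)"
      unfolding Z[OF \<open>r < n\<close> \<open>c < n\<close>] using assms by (simp add: X Y el_index)
  qed (use carr in auto)
  then show ?thesis unfolding X_def Y_def .
qed

section \<open>Gaussian elimination by root elements inside a diagonal block\<close>

definition agrees_off :: "nat \<Rightarrow> nat \<Rightarrow> nat \<Rightarrow> 'a::field mat \<Rightarrow> bool" where
  "agrees_off n a b A \<longleftrightarrow> A \<in> carrier_mat n n \<and> det A = 1 \<and>
    (\<forall>r<n. \<forall>c<n. \<not> (r \<in> {a..<b} \<and> c \<in> {a..<b}) \<longrightarrow> A $$ (r, c) = (if r = c then 1 else 0))"

lemma agrees_off_el_mult:
  assumes "agrees_off n a b A" "i \<in> {a..<b}" "j \<in> {a..<b}" "i \<noteq> j" "b \<le> n"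
  shows "agrees_off n a b (el n i j t * A)"
  unfolding agrees_off_def
proof (intro conjI allI impI)
  have A: "A \<in> carrier_mat n n" "det A = 1"
    using assms unfolding agrees_off_def by auto
  show "el n i j t * A \<in> carrier_mat n n" using A by auto
  show "det (el n i j t * A) = 1"
    using A assms by (simp add: det_mult[of _ n] det_el)
  fix r c assume "r < n" "c < n" "\<not> (r \<in> {a..<b} \<and> c \<in> {a..<b})"
  then show "(el n i j t * A) $$ (r, c) = (if r = c then 1 else 0)"
    using A assms unfolding agrees_off_def by (subst el_mult) auto
qed

lemma agrees_off_mult_el:
  assumes "agrees_off n a b A" "i \<in> {a..<b}" "j \<in> {a..<b}" "i \<noteq> j" "b \<le> n"
  shows "agrees_off n a b (A * el n i j t)"
  unfolding agrees_off_def
proof (intro conjI allI impI)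
  have A: "A \<in> carrier_mat n n" "det A = 1"
    using assms unfolding agrees_off_def by auto
  show "A * el n i j t \<in> carrier_mat n n" using A by auto
  show "det (A * el n i j t) = 1"
    using A assms by (simp add: det_mult[of _ n] det_el)
  fix r c assume "r < n" "c < n" "\<not> (r \<in> {a..<b} \<and> c \<in> {a..<b})"
  then show "(A * el n i j t) $$ (r, c) = (if r = c then 1 else 0)"
    using A assms unfolding agrees_off_def by (subst mult_el) auto
qed

lemma el_mult_cancel:
  assumes "A \<in> carrier_mat n n" "i < n" "j < n" "i \<noteq> j"
  shows "el n i j (- t) * (el n i j t * A) = (A :: 'a::field mat)"
  using assms by (simp add: assoc_mult_mat[symmetric, of _ n n _ n _ n] el_add)

lemma mult_el_cancel:
  assumes "A \<in> carrier_mat n n" "i < n" "j < n" "i \<noteq> j"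
  shows "A * el n i j t * el n i j (- t) = (A :: 'a::field mat)"
  using assms by (simp add: assoc_mult_mat[of _ n n _ n _ n] el_add)

context
  fixes n b :: nat and K :: "'a::field mat set"
  assumes b: "b \<le> n"
    and K_mult: "\<And>A B. A \<in> K \<Longrightarrow> B \<in> K \<Longrightarrow> A * B \<in> K"
    and K_one: "1\<^sub>m n \<in> K"
begin

private definition els :: "nat \<Rightarrow> bool" where
  "els a \<longleftrightarrow> (\<forall>i\<in>{a..<b}. \<forall>j\<in>{a..<b}. \<forall>t. i \<noteq> j \<longrightarrow> el n i j t \<in> K)"

private lemma el_mult_cancel_in:
  assumes "els a" "el n i j t * A \<in> K" "A \<in> carrier_mat n n" "i \<in> {a..<b}" "j \<in> {a..<b}" "i \<noteq> j"
  shows "A \<in> K"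
proof -
  have "el n i j (- t) * (el n i j t * A) \<in> K"
    by (rule K_mult) (use assms in \<open>auto simp: els_def\<close>)
  then show ?thesis
    using assms b by (simp add: el_mult_cancel)
qed

private lemma mult_el_cancel_in:
  assumes "els a" "A * el n i j t \<in> K" "A \<in> carrier_mat n n" "i \<in> {a..<b}" "j \<in> {a..<b}" "i \<noteq> j"
  shows "A \<in> K"
proof -
  have "A * el n i j t * el n i j (- t) \<in> K"
    by (rule K_mult) (use assms in \<open>auto simp: els_def\<close>)
  then show ?thesis
    using assms b by (simp add: mult_el_cancel)
qed

private lemma clear_row:
  assumes "els a" "a < b" and IH: "\<And>A. agrees_off n (Suc a) b A \<Longrightarrow> A \<in> K"
    and "agrees_off n a b A" "a < m" "m \<le> b" "A $$ (a, a) = 1"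
    and "\<And>r. a < r \<Longrightarrow> r < b \<Longrightarrow> A $$ (r, a) = 0" "\<And>c. a < c \<Longrightarrow> c < m \<Longrightarrow> A $$ (a, c) = 0"
  shows "A \<in> K"
  using assms(4-)
proof (induction "b - m" arbitrary: m A)
  case 0
  have "agrees_off n (Suc a) b A"
    unfolding agrees_off_def
  proof (intro conjI allI impI)
    fix r c assume rc: "r < n" "c < n" "\<not> (r \<in> {Suc a..<b} \<and> c \<in> {Suc a..<b})"
    show "A $$ (r, c) = (if r = c then 1 else 0)"
    proof (cases "r \<in> {a..<b} \<and> c \<in> {a..<b}")
      case True
      then have "r = a \<or> c = a" using rc by auto
      then show ?thesis
        using True 0 by (cases "r = c") (auto simp: le_less)
    next
      case False
      then show ?thesis using 0 rc unfolding agrees_off_def by blast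
    qed
  qed (use 0 in \<open>auto simp: agrees_off_def\<close>)
  then show ?case by (rule IH)
next
  case (Suc k)
  have A: "A \<in> carrier_mat n n"
    using Suc.prems unfolding agrees_off_def by auto
  have ix: "(A * el n a m (- A $$ (a, m))) $$ (r, c) = A $$ (r, c) + (if c = m then - A $$ (a, m) * A $$ (r, a) else 0)"
    if "r < n" "c < n" for r c
    using that Suc b assms(2) by (intro mult_el[OF A]) auto
  have "A * el n a m (- A $$ (a, m)) \<in> K"
  proof (rule Suc.hyps(1)[of "Suc m"])
    show "agrees_off n a b (A * el n a m (- A $$ (a, m)))"
      using Suc.prems Suc.hyps(2) assms(2) b by (intro agrees_off_mult_el) auto
    show "(A * el n a m (- A $$ (a, m))) $$ (a, a) = 1"
      using Suc.prems assms(2) b by (simp add: ix del: index_mult_mat(1))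
    show "(A * el n a m (- A $$ (a, m))) $$ (r, a) = 0" if "a < r" "r < b" for r
      using Suc.prems assms(2) b that by (simp add: ix del: index_mult_mat(1))
    show "(A * el n a m (- A $$ (a, m))) $$ (a, c) = 0" if "a < c" "c < Suc m" for c
      using Suc.prems Suc.hyps(2) assms(2) b that by (auto simp: ix simp del: index_mult_mat(1))
  qed (use Suc in auto)
  then show ?case
    using Suc.prems Suc.hyps(2) assms(2) by (intro mult_el_cancel_in[OF assms(1) _ A]) auto
qed

private lemma clear_column:
  assumes "els a" "a < b" and IH: "\<And>A. agrees_off n (Suc a) b A \<Longrightarrow> A \<in> K"
    and "agrees_off n a b A" "a < m" "m \<le> b" "A $$ (a, a) = 1"
    and "\<And>r. a < r \<Longrightarrow> r < m \<Longrightarrow> A $$ (r, a) = 0"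
  shows "A \<in> K"
  using assms(4-)
proof (induction "b - m" arbitrary: m A)
  case 0
  then show ?case
    by (intro clear_row[OF assms(1,2) IH, of A "Suc a"]) (use assms(2) in auto)
next
  case (Suc k)
  have A: "A \<in> carrier_mat n n"
    using Suc.prems unfolding agrees_off_def by auto
  have ix: "(el n m a (- A $$ (m, a)) * A) $$ (r, c) = A $$ (r, c) + (if r = m then - A $$ (m, a) * A $$ (a, c) else 0)"
    if "r < n" "c < n" for r c
    using that Suc b assms(2) by (intro el_mult[OF A]) auto
  have "el n m a (- A $$ (m, a)) * A \<in> K"
  proof (rule Suc.hyps(1)[of "Suc m"])
    show "agrees_off n a b (el n m a (- A $$ (m, a)) * A)"
      using Suc.prems Suc.hyps(2) assms(2) b by (intro agrees_off_el_mult) auto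
    show "(el n m a (- A $$ (m, a)) * A) $$ (a, a) = 1"
      using Suc.prems assms(2) b by (simp add: ix del: index_mult_mat(1))
    show "(el n m a (- A $$ (m, a)) * A) $$ (r, a) = 0" if "a < r" "r < Suc m" for r
      using Suc.prems Suc.hyps(2) assms(2) b that by (auto simp: ix simp del: index_mult_mat(1))
  qed (use Suc in auto)
  then show ?case
    using Suc.prems Suc.hyps(2) assms(2) by (intro el_mult_cancel_in[OF assms(1) _ A]) auto
qed

text \<open>A nonzero entry below the pivot allows a row operation that turns the pivot into 1, so
  no diagonal matrix has to be divided out.\<close>

private lemma make_pivot:
  assumes "els a" "a < b" and IH: "\<And>A. agrees_off n (Suc a) b A \<Longrightarrow> A \<in> K"
    and "agrees_off n a b A" "r \<in> {a<..<b}" "A $$ (r, a) \<noteq> 0"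
  shows "A \<in> K"
proof -
  have A: "A \<in> carrier_mat n n"
    using assms unfolding agrees_off_def by auto
  let ?t = "(1 - A $$ (a, a)) / A $$ (r, a)"
  have "el n a r ?t * A \<in> K"
  proof (rule clear_column[OF assms(1,2) IH, of _ "Suc a"])
    show "agrees_off n a b (el n a r ?t * A)"
      using assms b by (intro agrees_off_el_mult) auto
    show "(el n a r ?t * A) $$ (a, a) = 1"
      using assms b by (subst el_mult[OF A]) auto
  qed (use assms(2) in auto)
  then show ?thesis
    using assms by (intro el_mult_cancel_in[OF assms(1) _ A]) auto
qed

text \<open>Elimination shrinks the block from the top left. Closure of \<open>K\<close> under
  products is enough, since each operation is undone by the root element of negated
  parameter.\<close>

lemma agrees_off_in_generated:
  assumes "\<And>i j t. i \<in> {a..<b} \<Longrightarrow> j \<in> {a..<b} \<Longrightarrow> i \<noteq> j \<Longrightarrow> el n i j t \<in> K"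
    and "a \<le> b" "agrees_off n a b A"
  shows "A \<in> K"
  using assms(2,1,3)
proof (induction arbitrary: A rule: inc_induct)
  case base
  then have "A = 1\<^sub>m n"
    unfolding agrees_off_def by (intro eq_matI) auto
  then show ?case using K_one by simp
next
  case (step a)
  have els: "els a"
    unfolding els_def using step.prems(1) by blast
  have IH: "B \<in> K" if "agrees_off n (Suc a) b B" for B
    using step.IH step.prems(1) that by simp
  have A: "A \<in> carrier_mat n n" "det A = 1"
    using step.prems unfolding agrees_off_def by auto
  show ?case
  proof (cases "\<exists>r\<in>{a<..<b}. A $$ (r, a) \<noteq> 0")
    case True
    then show ?thesis
      using make_pivot[OF els _ IH] step by blast
  next
    case False
    \<comment> \<open>With zeros everywhere else in its column, a zero pivot would make the
      determinant vanish.\<close>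
    have "A $$ (a, a) \<noteq> 0"
    proof
      assume "A $$ (a, a) = 0"
      then have zero: "A $$ (r, a) = 0" if "r < n" for r
        using that False step b unfolding agrees_off_def
        by (cases "r \<in> {a..<b}"; cases "r = a") auto
      have "det A = (\<Sum>r<n. A $$ (r, a) * cofactor A r a)"
        by (rule laplace_expansion_column[OF A(1)]) (use step b in auto)
      then show False using zero A by simp
    qed
    show ?thesis
    proof (cases "Suc a < b")
      case True
      \<comment> \<open>Adding the pivot row to the next row creates the nonzero entry that
        \<open>make_pivot\<close> asks for.\<close>
      have "el n (Suc a) a 1 * A \<in> K"
      proof (rule make_pivot[OF els step.hyps(2) IH, of _ "Suc a"])
        show "agrees_off n a b (el n (Suc a) a 1 * A)"
          using step b True by (intro agrees_off_el_mult) auto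
        show "(el n (Suc a) a 1 * A) $$ (Suc a, a) \<noteq> 0"
          using False \<open>A $$ (a, a) \<noteq> 0\<close> True b by (subst el_mult[OF A(1)]) auto
      qed (use True in auto)
      then show ?thesis
        using True by (intro el_mult_cancel_in[OF els _ A(1)]) auto
    next
      case False
      then have b': "b = Suc a" using step by simp
      have diag: "A $$ (r, c) = (if r = c then if r = a then A $$ (a, a) else 1 else 0)" if "r < n" "c < n" for r c
        using step.prems(2) that unfolding agrees_off_def b' by auto
      have "det A = prod_list (diag_mat A)"
        by (rule det_upper_triangular[OF _ A(1)]) (use A diag in \<open>auto simp: upper_triangular_def\<close>)
      also have "\<dots> = (\<Prod>r<n. A $$ (r, r))"
        using A unfolding diag_mat_def
        by (simp add: prod.distinct_set_conv_list[symmetric] lessThan_atLeast0)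
      also have "\<dots> = (\<Prod>r<n. if r = a then A $$ (a, a) else 1)"
        by (intro prod.cong refl) (subst diag; simp)
      also have "\<dots> = A $$ (a, a)"
        using b step by simp
      finally have "A $$ (a, a) = 1" using A by simp
      then have "A = 1\<^sub>m n"
        using A diag by (intro eq_matI) auto
      then show ?thesis using K_one by simp
    qed
  qed
qed

end


section \<open>The block subgroups\<close>

text \<open>The array \<open>x\<close> is arbitrary, with no condition on the determinant, so that
  functions on the group can be compared with polynomials on all matrices.\<close>

definition emb :: "nat \<Rightarrow> nat \<Rightarrow> nat \<Rightarrow> (nat \<times> nat \<Rightarrow> 'a::field) \<Rightarrow> 'a mat" where
  "emb n d N x = mat n n (\<lambda>(r, c). if r \<in> {d..<d+N} \<and> c \<in> {d..<d+N} then x (r - d, c - d)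
     else if r = c then 1 else 0)"

definition blk :: "nat \<Rightarrow> 'a mat \<Rightarrow> nat \<times> nat \<Rightarrow> 'a" where
  "blk d g = (\<lambda>(r, c). g $$ (d + r, d + c))"

lemma emb_carrier [simp]: "emb n d N x \<in> carrier_mat n n"
  unfolding emb_def by auto

lemma emb_dims [simp]: "dim_row (emb n d N x) = n" "dim_col (emb n d N x) = n"
  unfolding emb_def by auto

lemma emb_index:
  "r < n \<Longrightarrow> c < n \<Longrightarrow> emb n d N x $$ (r, c) = (if r \<in> {d..<d+N} \<and> c \<in> {d..<d+N} then x (r - d, c - d)
     else if r = c then 1 else 0)"
  unfolding emb_def by auto

lemma emb_blk: "agrees_off n d (d + N) A \<Longrightarrow> emb n d N (blk d A) = A"
  unfolding agrees_off_def emb_def blk_def by (intro eq_matI) auto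

lemma agrees_off_emb: "agrees_off n d (d + N) (emb n d N x) \<longleftrightarrow> det (emb n d N x) = 1"
  unfolding agrees_off_def by (auto simp: emb_index)

lemma det_upper_triangular_prod:
  assumes "A \<in> carrier_mat n n" "upper_triangular A"
  shows "det A = (\<Prod>r<n. A $$ (r, r) :: 'a::field)"
proof -
  have "det A = prod_list (diag_mat A)"
    by (rule det_upper_triangular[OF assms(2,1)])
  then show ?thesis
    using assms(1) unfolding diag_mat_def
    by (simp add: prod.distinct_set_conv_list[symmetric] lessThan_atLeast0)
qed

lemma index_mult_mat_sum:
  assumes "A \<in> carrier_mat n n" "B \<in> carrier_mat n n" "r < n" "c < n"
  shows "(A * B) $$ (r, c) = (\<Sum>u<n. A $$ (r, u) * B $$ (u, c))"
  using assms by (auto simp: scalar_prod_def lessThan_atLeast0)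

lemma agrees_off_mult:
  assumes A: "agrees_off n a b A" and B: "agrees_off n a b (B :: 'a::field mat)"
  shows "agrees_off n a b (A * B)"
  unfolding agrees_off_def
proof (intro conjI allI impI)
  have carr: "A \<in> carrier_mat n n" "B \<in> carrier_mat n n" "det A = 1" "det B = 1"
    using A B unfolding agrees_off_def by auto
  show "A * B \<in> carrier_mat n n" using carr by auto
  show "det (A * B) = 1"
    using carr by (simp add: det_mult[of _ n])
  fix r c assume rc: "r < n" "c < n" "\<not> (r \<in> {a..<b} \<and> c \<in> {a..<b})"
  have id: "A $$ (r, u) = (if r = u then 1 else 0)" if "\<not> r \<in> {a..<b}" "u < n" for u
    using A that rc unfolding agrees_off_def by auto
  have id': "B $$ (u, c) = (if u = c then 1 else 0)" if "\<not> c \<in> {a..<b}" "u < n" for u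
    using B that rc unfolding agrees_off_def by auto
  have "(A * B) $$ (r, c) = (\<Sum>u<n. A $$ (r, u) * B $$ (u, c))"
    by (rule index_mult_mat_sum[OF carr(1,2) rc(1,2)])
  also have "\<dots> = (if r = c then 1 else 0)"
  proof (cases "r \<in> {a..<b}")
    case False
    then have "(\<Sum>u<n. A $$ (r, u) * B $$ (u, c)) = (\<Sum>u<n. if u = r then B $$ (u, c) else 0)"
      using id by (intro sum.cong) auto
    also have "\<dots> = B $$ (r, c)" using rc by simp
    finally show ?thesis
      using B rc unfolding agrees_off_def by auto
  next
    case True
    then have "c \<notin> {a..<b}" using rc by auto
    then have "(\<Sum>u<n. A $$ (r, u) * B $$ (u, c)) = (\<Sum>u<n. if u = c then A $$ (r, u) else 0)"
      using id' by (intro sum.cong) auto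
    also have "\<dots> = A $$ (r, c)" using rc by simp
    finally show ?thesis
      using A rc unfolding agrees_off_def by auto
  qed
  finally show "(A * B) $$ (r, c) = (if r = c then 1 else 0)" .
qed

text \<open>\<open>d\<close> is the number of rows before the block and \<open>N\<close> its size.
  The two corners are \<open>q = 1, d = 1\<close> and \<open>q = n - 1, d = 0\<close>, both with
  \<open>N = n - 1\<close>.\<close>

locale block =
  fixes n q d N :: nat
  assumes N_ge_2: "2 \<le> N" and d_N: "d + N \<le> n" and simple_roots: "{1..n-1} - {q} = {Suc d..<d+N}"
begin

lemma G_sub_mult: "A \<in> G_sub n q \<Longrightarrow> B \<in> G_sub n q \<Longrightarrow> A * B \<in> G_sub n q"
  unfolding G_sub_def using generate.eng[of A "SL n" _ B] by simp

lemma G_sub_one: "1\<^sub>m n \<in> G_sub n q"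
  unfolding G_sub_def using generate.one[of "SL n"] by simp

lemma el_in_G_sub:
  assumes "i \<in> {d..<d+N}" "j \<in> {d..<d+N}" "i \<noteq> j"
  shows "el n i j (t :: 'a::field) \<in> G_sub n q"
proof -
  have simple: "el n i (Suc i) (t :: 'a) \<in> G_sub n q \<and> el n (Suc i) i t \<in> G_sub n q"
    if "d \<le> i" "Suc i < d + N" for i t
  proof -
    have "Suc i \<in> {1..n-1} - {q}"
      unfolding simple_roots using that by auto
    then show ?thesis
      unfolding G_sub_def by (auto intro!: generate.incl bexI[of _ "Suc i"])
  qed
  have comm: "el n i j t \<in> G_sub n q"
    if "\<And>t :: 'a. el n i k t \<in> G_sub n q" "\<And>t :: 'a. el n k j t \<in> G_sub n q"
      "i < n" "j < n" "k < n" "i \<noteq> j" "i \<noteq> k" "j \<noteq> k" for i j k and t :: 'a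
    unfolding el_commutator[OF that(3-8)] by (intro G_sub_mult that(1,2))
  have upper: "el n i (Suc i + m) t \<in> G_sub n q" if "d \<le> i" "Suc i + m < d + N" for i m and t :: 'a
    using that
  proof (induction m arbitrary: t)
    case (Suc m)
    show ?case
      by (rule comm[of _ "Suc i + m"]) (use Suc simple[of "Suc i + m"] d_N in auto)
  qed (use simple in auto)
  have lower: "el n (Suc i + m) i t \<in> G_sub n q" if "d \<le> i" "Suc i + m < d + N" for i m and t :: 'a
    using that
  proof (induction m arbitrary: t)
    case (Suc m)
    show ?case
      by (rule comm[of _ "Suc i + m"]) (use Suc simple[of "Suc i + m"] d_N in auto)
  qed (use simple in auto)
  show ?thesis
  proof (cases "i < j")
    case True
    then show ?thesis using upper[of i "j - Suc i" t] assms by auto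
  next
    case False
    then show ?thesis using lower[of j "i - Suc j" t] assms by auto
  qed
qed

text \<open>Commutators give all root elements of the block and elimination gives all of its
  matrices of determinant 1, so membership becomes a condition on entries.\<close>

lemma G_sub_eq: "(G_sub n q :: 'a::field mat set) = {A. agrees_off n d (d + N) A}"
proof (intro equalityI subsetI CollectI)
  fix A :: "'a mat" assume A: "A \<in> {A. agrees_off n d (d + N) A}"
  show "A \<in> G_sub n q"
  proof (rule agrees_off_in_generated[of "d + N" n "G_sub n q" d])
    show "agrees_off n d (d + N) A" using A by simp
  qed (use d_N in \<open>simp_all add: G_sub_mult G_sub_one el_in_G_sub\<close>)
next
  have one: "agrees_off n d (d + N) (1\<^sub>m n :: 'a mat)"
    unfolding agrees_off_def by auto
  have el: "agrees_off n d (d + N) (el n i j (t :: 'a))"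
    if "i \<in> {d..<d+N}" "j \<in> {d..<d+N}" "i \<noteq> j" for i j t
    using agrees_off_el_mult[OF one that d_N, of t] by simp
  have gen: "\<exists>i\<in>{d..<d+N}. \<exists>j\<in>{d..<d+N}. \<exists>t. i \<noteq> j \<and> h = el n i j t"
    if "h \<in> (\<Union>i\<in>{1..n-1} - {q}. range (root_elem n i (i+1)) \<union> range (root_elem n (i+1) i))" for h :: "'a mat"
  proof -
    from that obtain i t where i: "i \<in> {Suc d..<d+N}" "h = root_elem n i (i+1) t \<or> h = root_elem n (i+1) i t"
      unfolding simple_roots by blast
    then obtain k where "i = Suc k" by (cases i) auto
    then have "k \<in> {d..<d+N}" "Suc k \<in> {d..<d+N}" "h = el n k (Suc k) t \<or> h = el n (Suc k) k t"
      using i by auto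
    then show ?thesis
      by (metis n_not_Suc_n)
  qed
  fix A :: "'a mat" assume "A \<in> G_sub n q"
  then show "agrees_off n d (d + N) A"
    unfolding G_sub_def
  proof (induction rule: generate.induct)
    case (incl h)
    obtain i j t where "i \<in> {d..<d+N}" "j \<in> {d..<d+N}" "i \<noteq> j" "h = el n i j t"
      using gen[OF incl] by blast
    then show ?case using el[of i j t] by simp
  next
    case (inv h)
    obtain i j t where "i \<in> {d..<d+N}" "j \<in> {d..<d+N}" "i \<noteq> j" "h = el n i j t"
      using gen[OF inv] by blast
    then show ?case using el[of i j "- t"] d_N by (simp add: inv_el)
  qed (auto simp: one intro: agrees_off_mult)
qed

lemma emb_in_G_sub: "emb n d N x \<in> G_sub n q \<longleftrightarrow> det (emb n d N x) = 1"
  unfolding G_sub_eq using agrees_off_emb by auto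

lemma emb_blk_G_sub: "A \<in> G_sub n q \<Longrightarrow> emb n d N (blk d A) = A"
  unfolding G_sub_eq using emb_blk by auto

lemma G_sub_SL: "A \<in> G_sub n q \<Longrightarrow> A \<in> carrier_mat n n \<and> det A = 1"
  unfolding G_sub_eq agrees_off_def by auto

lemma subgroup_G_sub: "subgroup (G_sub n q :: 'a::field mat set) (SL n)"
  unfolding G_sub_def
proof (rule SL.generate_is_subgroup, rule subsetI)
  fix A :: "'a mat"
  assume "A \<in> (\<Union>i\<in>{1..n-1} - {q}. range (root_elem n i (i+1)) \<union> range (root_elem n (i+1) i))"
  then obtain i t where "i \<in> {1..n - 1}" "A = root_elem n i (i + 1) t \<or> A = root_elem n (i + 1) i t"
    by blast
  moreover then obtain k where "i = Suc k" by (cases i) auto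
  ultimately show "A \<in> carrier (SL n)"
    by (auto simp: det_el)
qed

lemma G_sub_inv: "A \<in> G_sub n q \<Longrightarrow> inv\<^bsub>SL n\<^esub> A \<in> G_sub n q"
  by (rule subgroup.m_inv_closed[OF subgroup_G_sub])

text \<open>The coroot element with \<open>t\<close> in row \<open>d + s\<close> and its inverse in the following row.\<close>
abbreviation cr :: "nat \<Rightarrow> 'a::field \<Rightarrow> 'a mat" where
  "cr s t \<equiv> coroot_elem n (Suc (d + s)) t"

lemma cr_index: "r < n \<Longrightarrow> c < n \<Longrightarrow>
  cr s t $$ (r, c) = (if r \<noteq> c then 0 else if r = d + s then t else if r = Suc (d + s) then inverse t else 1)"
  unfolding coroot_elem_def by auto

lemma cr_carrier [simp]: "coroot_elem n i t \<in> carrier_mat n n"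
  unfolding coroot_elem_def by auto

lemma det_cr:
  assumes "Suc s < N" "t \<noteq> (0 :: 'a::field)"
  shows "det (cr s t) = 1"
proof -
  have "det (cr s t) = (\<Prod>r<n. cr s t $$ (r, r))"
    by (rule det_upper_triangular_prod) (auto simp: upper_triangular_def cr_index coroot_elem_def)
  also have "\<dots> = (\<Prod>r\<in>{d + s, Suc (d + s)}. cr s t $$ (r, r))"
    using assms d_N by (intro prod.mono_neutral_right) (auto simp: cr_index)
  also have "\<dots> = 1"
    using assms d_N by (simp add: cr_index)
  finally show ?thesis .
qed

lemma cr_in_G_sub:
  assumes "Suc s < N" "t \<noteq> (0 :: 'a::field)"
  shows "cr s t \<in> G_sub n q"
  unfolding G_sub_eq agrees_off_def using assms by (auto simp: det_cr cr_index)

lemma T_gens: "(\<Union>i\<in>{1..n-1} - {q}. coroot_elem n i ` (UNIV - {0 :: 'a::field}))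
    = {cr s t | s t. Suc s < N \<and> t \<noteq> 0}"
proof -
  have "(\<Union>i\<in>{Suc d..<d+N}. coroot_elem n i ` (UNIV - {0 :: 'a})) = {cr s t | s t. Suc s < N \<and> t \<noteq> 0}"
  proof (intro equalityI subsetI)
    fix h :: "'a mat" assume "h \<in> (\<Union>i\<in>{Suc d..<d+N}. coroot_elem n i ` (UNIV - {0}))"
    then obtain i t where "i \<in> {Suc d..<d+N}" "t \<noteq> 0" "h = coroot_elem n i t" by blast
    then have "h = cr (i - Suc d) t \<and> Suc (i - Suc d) < N \<and> t \<noteq> 0" by auto
    then show "h \<in> {cr s t | s t. Suc s < N \<and> t \<noteq> 0}" by blast
  next
    fix h :: "'a mat" assume "h \<in> {cr s t | s t. Suc s < N \<and> t \<noteq> 0}"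
    then obtain s t where "Suc s < N" "t \<noteq> 0" "h = cr s t" by blast
    then show "h \<in> (\<Union>i\<in>{Suc d..<d+N}. coroot_elem n i ` (UNIV - {0}))"
      by (intro UN_I[of "Suc (d + s)"]) auto
  qed
  then show ?thesis unfolding simple_roots .
qed

lemma cr_inv:
  assumes "Suc s < N" "t \<noteq> (0 :: 'a::field)"
  shows "inv\<^bsub>SL n\<^esub> (cr s t) = cr s (inverse t)"
proof (rule SL.inv_equality)
  show "cr s (inverse t) \<otimes>\<^bsub>SL n\<^esub> cr s t = \<one>\<^bsub>SL n\<^esub>"
  proof (simp, rule eq_matI)
    fix r c assume "r < dim_row (1\<^sub>m n :: 'a mat)" "c < dim_col (1\<^sub>m n :: 'a mat)"
    then have rc: "r < n" "c < n" by auto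
    have "(cr s (inverse t) * cr s t) $$ (r, c) = (\<Sum>u<n. cr s (inverse t) $$ (r, u) * cr s t $$ (u, c))"
      using rc by (intro index_mult_mat_sum) auto
    also have "\<dots> = (\<Sum>u<n. if u = r then if r = c then 1 else 0 else 0)"
      using rc assms by (intro sum.cong refl) (auto simp: cr_index)
    also have "\<dots> = 1\<^sub>m n $$ (r, c)" using rc by auto
    finally show "(cr s (inverse t) * cr s t) $$ (r, c) = 1\<^sub>m n $$ (r, c)" .
  qed (auto simp: coroot_elem_def)
qed (use assms in \<open>auto simp: det_cr\<close>)

lemma T_sub_induct [consumes 1, case_names one cr mult]:
  assumes "t \<in> T_sub n q" and "P (1\<^sub>m n)"
    and "\<And>s z. Suc s < N \<Longrightarrow> z \<noteq> 0 \<Longrightarrow> P (cr s z)"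
    and "\<And>s t. s \<in> T_sub n q \<Longrightarrow> P s \<Longrightarrow> t \<in> T_sub n q \<Longrightarrow> P t \<Longrightarrow> P (s * t)"
  shows "P (t :: 'a::field mat)"
  using assms(1)[unfolded T_sub_def T_gens]
proof (induction rule: generate.induct)
  case one
  then show ?case using assms(2) by simp
next
  case (incl h)
  then show ?case using assms(3) by blast
next
  case (inv h)
  then obtain s z where "Suc s < N" "z \<noteq> 0" "h = cr s z" by blast
  then show ?case using assms(3)[of s "inverse z"] by (simp add: cr_inv)
next
  case (eng h1 h2)
  then show ?case using assms(4)[of h1 h2] unfolding T_sub_def T_gens by simp
qed

lemma cr_in_T_sub: "Suc s < N \<Longrightarrow> t \<noteq> 0 \<Longrightarrow> cr s t \<in> T_sub n q"
  unfolding T_sub_def T_gens by (intro generate.incl) blast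

lemma T_sub_one: "1\<^sub>m n \<in> T_sub n q"
  unfolding T_sub_def using generate.one[of "SL n"] by simp

lemma T_sub_mult: "s \<in> T_sub n q \<Longrightarrow> t \<in> T_sub n q \<Longrightarrow> s * t \<in> T_sub n q"
  unfolding T_sub_def using generate.eng[of _ "SL n"] by simp

lemma T_sub_inv: "t \<in> T_sub n q \<Longrightarrow> inv\<^bsub>SL n\<^esub> t \<in> T_sub n q"
  unfolding T_sub_def T_gens by (rule SL.generate_m_inv_closed) (auto simp: det_cr)

lemma T_sub_in_G_sub: "t \<in> T_sub n q \<Longrightarrow> t \<in> G_sub n q"
  by (induction rule: T_sub_induct) (auto intro: G_sub_one cr_in_G_sub G_sub_mult)

lemma diagonal_mult:
  assumes "A \<in> carrier_mat n n" "B \<in> carrier_mat n n" "\<And>r c. r < n \<Longrightarrow> c < n \<Longrightarrow> r \<noteq> c \<Longrightarrow> A $$ (r, c) = (0::'a::field)"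
    "r < n" "c < n"
  shows "(A * B) $$ (r, c) = A $$ (r, r) * B $$ (r, c)"
proof -
  have "(A * B) $$ (r, c) = (\<Sum>u<n. A $$ (r, u) * B $$ (u, c))"
    by (rule index_mult_mat_sum) (use assms in auto)
  also have "\<dots> = (\<Sum>u\<in>{r}. A $$ (r, u) * B $$ (u, c))"
    using assms by (intro sum.mono_neutral_right) auto
  finally show ?thesis by simp
qed

lemma T_sub_diagonal:
  assumes "t \<in> T_sub n q" "r < n" "c < n" "r \<noteq> c"
  shows "t $$ (r, c) = (0 :: 'a::field)"
  using assms
proof (induction arbitrary: r c rule: T_sub_induct)
  case (mult s t)
  then have "s \<in> carrier_mat n n" "t \<in> carrier_mat n n"
    using T_sub_in_G_sub G_sub_SL by blast+
  then have "(s * t) $$ (r, c) = s $$ (r, r) * t $$ (r, c)"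
    using mult by (intro diagonal_mult) auto
  then show ?case using mult by simp
qed (auto simp: cr_index)

lemma diag_part_T_sub:
  assumes "t \<in> T_sub n q"
  shows "diag_part n t = (t :: 'a::field mat)"
proof -
  have "t \<in> carrier_mat n n"
    using G_sub_SL T_sub_in_G_sub assms by blast
  then show ?thesis
    unfolding diag_part_def by (intro eq_matI) (auto simp: T_sub_diagonal[OF assms])
qed

text \<open>Generators have inverses of the same kind, which removes the inverse case. The roots
  that avoid \<open>q\<close> are the pairs of positions inside the block.\<close>

lemma B_sub_induct [consumes 1, case_names torus root mult]:
  fixes b :: "'a::field mat"
  assumes "b \<in> B_sub n q" and T: "\<And>t. t \<in> T_sub n q \<Longrightarrow> P t"
    and el: "\<And>i j z. i < j \<Longrightarrow> i \<in> {d..<d+N} \<Longrightarrow> j \<in> {d..<d+N} \<Longrightarrow> P (el n i j z)"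
    and mult: "\<And>g h. g \<in> B_sub n q \<Longrightarrow> P g \<Longrightarrow> h \<in> B_sub n q \<Longrightarrow> P h \<Longrightarrow> P (g * h)"
  shows "P b"
proof -
  have root: "\<exists>i j. h = el n i j t \<and> i < j \<and> i \<in> {d..<d+N} \<and> j \<in> {d..<d+N}"
    if "1 \<le> i" "i < j" "j \<le> n" "q \<notin> {i..<j}" "h = root_elem n i j t" for i j t and h :: "'a mat"
  proof -
    have "i \<in> {Suc d..<d+N}" "j - 1 \<in> {Suc d..<d+N}"
      unfolding simple_roots[symmetric] using that by auto
    then show ?thesis
      using that by (intro exI[of _ "i - 1"] exI[of _ "j - 1"]) auto
  qed
  show ?thesis
    using assms(1) unfolding B_sub_def
  proof (induction rule: generate.induct)
    case one
    then show ?case using T[OF T_sub_one] by simp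
  next
    case (incl h)
    then consider "h \<in> T_sub n q" | i j t where "1 \<le> i" "i < j" "j \<le> n" "q \<notin> {i..<j}" "h = root_elem n i j t"
      by blast
    then show ?case
    proof cases
      case 2
      then obtain i j where "h = el n i j t" "i < j" "i \<in> {d..<d+N}" "j \<in> {d..<d+N}"
        using root[OF 2] by blast
      then show ?thesis using el[of i j t] by simp
    qed (rule T)
  next
    case (inv h)
    then consider "h \<in> T_sub n q" | i j t where "1 \<le> i" "i < j" "j \<le> n" "q \<notin> {i..<j}" "h = root_elem n i j t"
      by blast
    then show ?case
    proof cases
      case 1
      then show ?thesis using T[OF T_sub_inv] by blast
    next
      case 2
      then obtain i j where "h = el n i j t" "i < j" "i \<in> {d..<d+N}" "j \<in> {d..<d+N}"
        using root[OF 2] by blast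
      then show ?thesis using el[of i j "- t"] d_N by (simp add: inv_el)
    qed
  next
    case (eng g h)
    then show ?case
      using mult[of g h] unfolding B_sub_def by simp
  qed
qed

lemma upper_triangular_mult:
  fixes g h :: "'a::field mat"
  assumes carr: "g \<in> carrier_mat n n" "h \<in> carrier_mat n n" and "upper_triangular g" "upper_triangular h"
  shows "upper_triangular (g * h)" "diag_part n (g * h) = diag_part n g * diag_part n h"
proof -
  have up: "g $$ (r, c) = 0" "h $$ (r, c) = 0" if "c < r" "r < n" for r c
    using assms that unfolding upper_triangular_def by auto
  have ix: "(g * h) $$ (r, c) = (\<Sum>u<n. g $$ (r, u) * h $$ (u, c))" if "r < n" "c < n" for r c
    using index_mult_mat_sum[OF carr that] .
  have "(g * h) $$ (r, c) = 0" if "c < r" "r < n" for r c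
  proof -
    have "g $$ (r, u) * h $$ (u, c) = 0" if "u < n" for u
      using up[of u r] up[of c u] that \<open>c < r\<close> \<open>r < n\<close> by (cases "u < r") auto
    then have "(\<Sum>u<n. g $$ (r, u) * h $$ (u, c)) = 0"
      by (intro sum.neutral) simp
    then show ?thesis using ix[of r c] that by simp
  qed
  then show "upper_triangular (g * h)"
    using carr unfolding upper_triangular_def by auto
  show "diag_part n (g * h) = diag_part n g * diag_part n h"
  proof (rule eq_matI)
    fix r c assume "r < dim_row (diag_part n g * diag_part n h)" "c < dim_col (diag_part n g * diag_part n h)"
    then have rc: "r < n" "c < n" by (auto simp: diag_part_def)
    have "(diag_part n g * diag_part n h) $$ (r, c) = diag_part n g $$ (r, r) * diag_part n h $$ (r, c)"
      using rc by (intro diagonal_mult) (auto simp: diag_part_def)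
    moreover have "(g * h) $$ (r, r) = g $$ (r, r) * h $$ (r, r)"
    proof -
      have "(\<Sum>u<n. g $$ (r, u) * h $$ (u, r)) = (\<Sum>u\<in>{r}. g $$ (r, u) * h $$ (u, r))"
        using rc up by (intro sum.mono_neutral_right) (auto simp: neq_iff)
      then show ?thesis using ix rc by simp
    qed
    ultimately show "diag_part n (g * h) $$ (r, c) = (diag_part n g * diag_part n h) $$ (r, c)"
      using rc by (auto simp: diag_part_def)
  qed (auto simp: diag_part_def)
qed

lemma B_sub_cases:
  fixes b :: "'a::field mat"
  assumes "b \<in> B_sub n q"
  shows "b \<in> G_sub n q \<and> upper_triangular b \<and> diag_part n b \<in> T_sub n q"
  using assms
proof (induction rule: B_sub_induct)
  case (torus t)
  then show ?case
    using T_sub_in_G_sub[OF torus] G_sub_SL[OF T_sub_in_G_sub[OF torus]] T_sub_diagonal[OF torus]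
    by (auto simp: diag_part_T_sub upper_triangular_def)
next
  case (root i j z)
  have "diag_part n (el n i j z) = 1\<^sub>m n"
    unfolding diag_part_def by (rule eq_matI) (use root in \<open>auto simp: el_index\<close>)
  then show ?case
    using root by (auto simp: el_in_G_sub T_sub_one upper_triangular_def el_index)
next
  case (mult g h)
  then show ?case
    by (simp add: G_sub_SL upper_triangular_mult G_sub_mult T_sub_mult)
qed

end


section \<open>Sections over the flag variety of a block\<close>

lemma mult_diagonal:
  assumes "A \<in> carrier_mat n n" "B \<in> carrier_mat n n" "\<And>r c. r < n \<Longrightarrow> c < n \<Longrightarrow> r \<noteq> c \<Longrightarrow> B $$ (r, c) = (0::'a::field)"
    "r < n" "c < n"
  shows "(A * B) $$ (r, c) = A $$ (r, c) * B $$ (c, c)"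
proof -
  have "(A * B) $$ (r, c) = (\<Sum>u<n. A $$ (r, u) * B $$ (u, c))"
    by (rule index_mult_mat_sum) (use assms in auto)
  also have "\<dots> = (\<Sum>u\<in>{c}. A $$ (r, u) * B $$ (u, c))"
    using assms by (intro sum.mono_neutral_right) auto
  finally show ?thesis by simp
qed

lemma pfun_compose:
  assumes "f \<in> pfun S" "\<And>v. v \<in> S \<Longrightarrow> (\<lambda>x. F x v) \<in> pfun S'"
  shows "(\<lambda>x. f (F x)) \<in> pfun S'"
  using assms(1) by (induction rule: pfun.induct) (auto intro: pfun.intros assms(2))

lemma pfun_blk_poly_fun:
  assumes "h \<in> pfun ({..<N} \<times> {..<N})" "d + N \<le> n"
  shows "(\<lambda>g. h (blk d g)) \<in> poly_fun n"
  using assms(1)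
proof (induction rule: pfun.induct)
  case (var v)
  then show ?case
    using assms(2) unfolding blk_def by (auto intro: poly_fun.entry)
qed (auto intro: poly_fun.intros)

lemma pfun_det_emb: "(\<lambda>x. det (emb n d N x)) \<in> pfun ({..<N} \<times> {..<N})"
  unfolding emb_def
proof (rule pfun_det)
  fix a b
  show "(\<lambda>x. if a \<in> {d..<d + N} \<and> b \<in> {d..<d + N} then x (a - d, b - d) else if a = b then 1 else 0)
      \<in> pfun ({..<N} \<times> {..<N})"
    by (cases "a \<in> {d..<d + N} \<and> b \<in> {d..<d + N}") (auto intro!: pfun.var pfun.const)
qed

context block
begin

text \<open>\<open>b s\<close> is the value of the weight on the coroot at place \<open>s\<close> of
  the block; natural exponents encode dominance.\<close>

definition has_weight :: "('a::field mat \<Rightarrow> 'a) \<Rightarrow> (nat \<Rightarrow> nat) \<Rightarrow> bool" where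
  "has_weight \<kappa> b \<longleftrightarrow> (\<forall>s\<in>T_sub n q. \<forall>t\<in>T_sub n q. \<kappa> (s * t) = \<kappa> s * \<kappa> t) \<and>
    (\<forall>s z. Suc s < N \<longrightarrow> z \<noteq> 0 \<longrightarrow> \<kappa> (cr s z) = z ^ b s)"

lemma T_sub_carrier: "t \<in> T_sub n q \<Longrightarrow> t \<in> carrier_mat n n"
  using G_sub_SL T_sub_in_G_sub by blast

lemma has_weight_one:
  assumes "has_weight \<kappa> b"
  shows "\<kappa> (1\<^sub>m n) = (1 :: 'a::field)"
proof -
  have "cr 0 (1 :: 'a) = 1\<^sub>m n"
    by (rule eq_matI) (auto simp: coroot_elem_def)
  moreover have "\<forall>s z. Suc s < N \<longrightarrow> z \<noteq> 0 \<longrightarrow> \<kappa> (cr s z) = z ^ b s"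
    using assms unfolding has_weight_def by blast
  from this[rule_format, of 0 1] have "\<kappa> (cr 0 1) = 1"
    using N_ge_2 by simp
  ultimately show ?thesis by simp
qed

text \<open>The weight fixes only the differences of the shape \<open>r\<close>: the diagonal
  entries of the block multiply to 1, so a common shift of \<open>r\<close> does not matter. This
  leaves room for a power of the determinant.\<close>

lemma has_weight_value:
  assumes \<kappa>: "has_weight \<kappa> b" and r: "\<And>s. Suc s < N \<Longrightarrow> r s = r (Suc s) + b s"
    and "t \<in> T_sub n q"
  shows "\<kappa> t = (\<Prod>s<N. t $$ (d + s, d + s) ^ r s :: 'a::field)"
  using assms(3)
proof (induction rule: T_sub_induct)
  case one
  then show ?case
    using d_N by (simp add: has_weight_one[OF \<kappa>])
next
  case (cr s z)
  have "(\<Prod>u<N. cr s z $$ (d + u, d + u) ^ r u) = (\<Prod>u\<in>{s, Suc s}. cr s z $$ (d + u, d + u) ^ r u)"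
    using cr d_N by (intro prod.mono_neutral_right) (auto simp: cr_index)
  also have "\<dots> = z ^ r s * inverse z ^ r (Suc s)"
    using cr d_N by (simp add: cr_index)
  also have "\<dots> = z ^ b s"
    using cr r[of s] by (simp add: power_add field_simps)
  finally show ?case
    using \<kappa> cr unfolding has_weight_def by simp
next
  case (mult s t)
  have "(s * t) $$ (r, r) = s $$ (r, r) * t $$ (r, r)" if "r < n" for r
    using mult that T_sub_diagonal T_sub_carrier by (intro diagonal_mult) auto
  then have "(\<Prod>u<N. (s * t) $$ (d + u, d + u) ^ r u)
      = (\<Prod>u<N. s $$ (d + u, d + u) ^ r u * t $$ (d + u, d + u) ^ r u)"
    using d_N by (intro prod.cong refl) (simp add: power_mult_distrib)
  then show ?case
    using mult \<kappa> unfolding has_weight_def by (simp add: prod.distrib)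
qed

lemma blk_mult:
  assumes "A \<in> G_sub n q" "B \<in> G_sub n q" "r < N" "c < N"
  shows "blk d (A * B) (r, c) = rmul N (blk d A) (blk d B) (r, c :: nat) " 
proof -
  have "(A * B) $$ (d + r, d + c) = (\<Sum>u<n. A $$ (d + r, u) * B $$ (u, d + c))"
    using assms d_N G_sub_SL by (intro index_mult_mat_sum) auto
  also have "\<dots> = (\<Sum>u\<in>(\<lambda>u. d + u) ` {..<N}. A $$ (d + r, u) * B $$ (u, d + c))"
  proof (rule sum.mono_neutral_right)
    show "\<forall>u\<in>{..<n} - (\<lambda>u. d + u) ` {..<N}. A $$ (d + r, u) * B $$ (u, d + c) = 0"
    proof
      fix u assume u: "u \<in> {..<n} - (\<lambda>u. d + u) ` {..<N}"
      have "u \<notin> {d..<d+N}"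
      proof
        assume "u \<in> {d..<d+N}"
        then have "u = d + (u - d)" "u - d < N" by auto
        then show False using u by blast
      qed
      then have "B $$ (u, d + c) = 0"
        using assms(2,4) u d_N unfolding G_sub_eq agrees_off_def by auto
      then show "A $$ (d + r, u) * B $$ (u, d + c) = 0" by simp
    qed
  qed (use d_N in auto)
  also have "\<dots> = (\<Sum>u<N. A $$ (d + r, d + u) * B $$ (d + u, d + c))"
    by (simp add: sum.reindex)
  finally show ?thesis
    by (simp add: blk_def rmul_def)
qed

lemma flagprod_in_induced:
  assumes h: "flagprod N r h" and \<kappa>: "has_weight \<kappa> b"
    and r: "\<And>s. Suc s < N \<Longrightarrow> r s = r (Suc s) + b s"
  shows "(\<lambda>g. if g \<in> G_sub n q then a * h (blk d g) else (0 :: 'a::field))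
    \<in> rspace (induced_module n (G_sub n q) (B_sub n q) \<kappa>)"
proof -
  have "(\<lambda>g. a * h (blk d g)) \<in> poly_fun n"
    using flagprod_pfun[OF h] d_N by (intro poly_fun.mult poly_fun.const pfun_blk_poly_fun)
  then have "regular_on n (G_sub n q) (\<lambda>g. if g \<in> G_sub n q then a * h (blk d g) else 0)"
    unfolding regular_on_def by force
  moreover have "h (blk d (g * b)) = \<kappa> (diag_part n b) * h (blk d g)"
    if g: "g \<in> G_sub n q" and b: "b \<in> B_sub n q" for g b
  proof -
    have b': "b \<in> G_sub n q" "upper_triangular b" "diag_part n b \<in> T_sub n q" "b \<in> carrier_mat n n"
      using B_sub_cases[OF b] G_sub_SL by auto
    have "h (blk d (g * b)) = h (rmul N (blk d g) (blk d b))"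
      using blk_mult[OF g b'(1)] by (intro pfun_cong[OF flagprod_pfun[OF h]]) auto
    also have "\<dots> = (\<Prod>s<N. blk d b (s, s) ^ r s) * h (blk d g)"
    proof (rule flagprod_rmul[OF h])
      show "blk d b (u, c) = 0" if "c < u" "u < N" for u c
        using b'(2,4) that d_N unfolding blk_def upper_triangular_def by auto
    qed
    also have "(\<Prod>s<N. blk d b (s, s) ^ r s) = (\<Prod>s<N. diag_part n b $$ (d + s, d + s) ^ r s)"
      using d_N by (intro prod.cong) (auto simp: blk_def diag_part_def)
    also have "\<dots> = \<kappa> (diag_part n b)"
      by (rule has_weight_value[OF \<kappa> r b'(3), symmetric])
    finally show ?thesis .
  qed
  moreover have "g * b \<in> G_sub n q" if "g \<in> G_sub n q" "b \<in> B_sub n q" for g b :: "'a mat"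
    using that B_sub_cases G_sub_mult by blast
  ultimately show ?thesis
    unfolding induced_module_def by auto
qed

abbreviation dt :: "(nat \<times> nat \<Rightarrow> 'a::field) \<Rightarrow> 'a" where
  "dt x \<equiv> det (emb n d N x)"

text \<open>
  A regular function on the block subgroup is made into a polynomial on all matrices by precomposing
  with the retraction that divides the last column by the determinant.
\<close>
abbreviation unimod :: "(nat \<times> nat \<Rightarrow> 'a::field) \<Rightarrow> nat \<times> nat \<Rightarrow> 'a" where
  "unimod x \<equiv> scale_col (N - 1) (1 / dt x) x"

lemma emb_index_block:
  "r < N \<Longrightarrow> c < N \<Longrightarrow> emb n d N x $$ (d + r, d + c) = x (r, c)"
  using d_N by (subst emb_index) auto

lemma emb_scale_col:
  assumes "s < N"
  shows "emb n d N (scale_col s t x) = emb n d N x * mat n n (\<lambda>(r, c). if r \<noteq> c then 0 else if r = d + s then t else 1 :: 'a::field)"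
    (is "_ = _ * ?D")
proof (rule eq_matI)
  fix r c assume "r < dim_row (emb n d N x * ?D)" "c < dim_col (emb n d N x * ?D)"
  then have rc: "r < n" "c < n" by auto
  have "(emb n d N x * ?D) $$ (r, c) = emb n d N x $$ (r, c) * ?D $$ (c, c)"
    using rc by (intro mult_diagonal) auto
  then show "emb n d N (scale_col s t x) $$ (r, c) = (emb n d N x * ?D) $$ (r, c)"
    using rc assms by (auto simp: emb_index scale_col_def)
qed auto

lemma dt_scale_col:
  assumes "s < N"
  shows "dt (scale_col s t x) = (t :: 'a::field) * dt x"
proof -
  let ?D = "mat n n (\<lambda>(r, c). if r \<noteq> c then 0 else if r = d + s then t else 1)"
  have "det ?D = (\<Prod>r<n. ?D $$ (r, r))"
    by (rule det_upper_triangular_prod) (auto simp: upper_triangular_def)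
  also have "\<dots> = (\<Prod>r<n. if r = d + s then t else 1)"
    by (intro prod.cong) auto
  also have "\<dots> = t"
    using assms d_N by simp
  finally show ?thesis
    unfolding emb_scale_col[OF assms] by (subst det_mult[of _ n]) auto
qed

lemma emb_add_col:
  assumes "Suc j < N"
  shows "emb n d N (add_col j t x) = emb n d N x * el n (d + j) (d + Suc j) (t :: 'a::field)"
proof (rule eq_matI)
  fix r c assume "r < dim_row (emb n d N x * el n (d + j) (d + Suc j) t)" "c < dim_col (emb n d N x * el n (d + j) (d + Suc j) t)"
  then have rc: "r < n" "c < n" by auto
  have mult: "(emb n d N x * el n (d + j) (d + Suc j) t) $$ (r, c)
      = emb n d N x $$ (r, c) + (if c = d + Suc j then t * emb n d N x $$ (r, d + j) else 0)"
    using rc assms d_N by (intro mult_el) auto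
  show "emb n d N (add_col j t x) $$ (r, c) = (emb n d N x * el n (d + j) (d + Suc j) t) $$ (r, c)"
  proof (cases "r \<in> {d..<d+N} \<and> c \<in> {d..<d+N}")
    case True
    define r' c' where "r' = r - d" and "c' = c - d"
    then have "r = d + r'" "c = d + c'" "r' < N" "c' < N"
      using True by auto
    then show ?thesis
      unfolding mult using assms by (simp add: emb_index_block add_col_def)
  next
    case False
    then have "emb n d N x $$ (r, d + j) = 0" if "c = d + Suc j"
    proof -
      have "r \<notin> {d..<d+N}" using False that assms by auto
      then have "r \<noteq> d + j" using assms by auto
      with \<open>r \<notin> {d..<d+N}\<close> show ?thesis
        using rc assms d_N by (subst emb_index) auto
    qed
    moreover have "emb n d N y $$ (r, c) = (if r = c then 1 else 0)" for y :: "_ \<Rightarrow> 'a"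
      unfolding emb_index[OF rc] if_not_P[OF False] ..
    ultimately show ?thesis
      unfolding mult by simp
  qed
qed auto

lemma dt_add_col:
  assumes "Suc j < N"
  shows "dt (add_col j t x) = (dt x :: 'a::field)"
proof -
  have "det (emb n d N x * el n (d + j) (d + Suc j) t) = dt x * det (el n (d + j) (d + Suc j) t)"
    by (rule det_mult[of _ n]) auto
  then show ?thesis
    using det_el[of "d + j" "d + Suc j" n t] emb_add_col[OF assms, of t x] by simp
qed

lemma emb_normal_in_G_sub: "dt x \<noteq> 0 \<Longrightarrow> emb n d N (unimod x) \<in> G_sub n q"
  unfolding emb_in_G_sub using N_ge_2 by (subst dt_scale_col) auto

text \<open>\<open>unimod\<close> divides by \<open>dt x\<close> only, so a power of
  \<open>dt x\<close> clears every denominator. The identity is stated where \<open>dt x\<close> is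
  nonzero, which determines \<open>Q\<close> by density.\<close>

lemma clear_denominators:
  fixes P :: "'a::field mat \<Rightarrow> 'a"
  assumes "P \<in> poly_fun n"
  shows "\<exists>M Q. Q \<in> pfun ({..<N} \<times> {..<N}) \<and>
    (\<forall>x. dt x \<noteq> 0 \<longrightarrow> Q x = dt x ^ M * P (emb n d N (unimod x)))"
  using assms
proof (induction rule: poly_fun.induct)
  case (const c)
  show ?case
    by (intro exI[of _ 0] exI[of _ "\<lambda>_. c"]) (auto intro: pfun.const)
next
  case (entry i j)
  show ?case
  proof (cases "i \<in> {d..<d+N} \<and> j \<in> {d..<d+N}")
    case True
    have "(\<lambda>x. x (i - d, j - d) * (if j - d = N - 1 then 1 else dt x)) \<in> pfun ({..<N} \<times> {..<N})"
      using True by (cases "j - d = N - 1")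
        (auto intro!: pfun.mult pfun.var pfun.const pfun_det_emb)
    then show ?thesis
      using True entry
      by (intro exI[of _ 1] exI[of _ "\<lambda>x. x (i - d, j - d) * (if j - d = N - 1 then 1 else dt x)"])
        (auto simp: emb_index scale_col_def)
  next
    case False
    then show ?thesis
      using entry by (intro exI[of _ 0] exI[of _ "\<lambda>_. if i = j then 1 else 0"])
        (auto simp: emb_index intro: pfun.const)
  qed
next
  case (add f g)
  then obtain M1 Q1 M2 Q2 where
    "Q1 \<in> pfun ({..<N} \<times> {..<N})" "\<And>x. dt x \<noteq> 0 \<Longrightarrow> Q1 x = dt x ^ M1 * f (emb n d N (unimod x))"
    "Q2 \<in> pfun ({..<N} \<times> {..<N})" "\<And>x. dt x \<noteq> 0 \<Longrightarrow> Q2 x = dt x ^ M2 * g (emb n d N (unimod x))"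
    by blast
  then show ?case
    by (intro exI[of _ "M1 + M2"] exI[of _ "\<lambda>x. Q1 x * dt x ^ M2 + Q2 x * dt x ^ M1"])
      (auto intro!: pfun.add pfun.mult pfun_power pfun_det_emb simp: algebra_simps power_add)
next
  case (mult f g)
  then obtain M1 Q1 M2 Q2 where
    "Q1 \<in> pfun ({..<N} \<times> {..<N})" "\<And>x. dt x \<noteq> 0 \<Longrightarrow> Q1 x = dt x ^ M1 * f (emb n d N (unimod x))"
    "Q2 \<in> pfun ({..<N} \<times> {..<N})" "\<And>x. dt x \<noteq> 0 \<Longrightarrow> Q2 x = dt x ^ M2 * g (emb n d N (unimod x))"
    by blast
  then show ?case
    by (intro exI[of _ "M1 + M2"] exI[of _ "\<lambda>x. Q1 x * Q2 x"])
      (auto intro!: pfun.mult simp: algebra_simps power_add)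
qed

lemma el_in_B_sub:
  assumes "Suc j < N"
  shows "el n (d + j) (d + Suc j) (t :: 'a::field) \<in> B_sub n q"
proof -
  have "Suc (d + j) \<in> {1..n-1} - {q}"
    unfolding simple_roots using assms by auto
  then have "q \<notin> {Suc (d + j)..<Suc (d + Suc j)}" by auto
  then have "range (el n (d + j) (d + Suc j) :: 'a \<Rightarrow> _)
      \<in> {range (root_elem n i j) | i j. 1 \<le> i \<and> i < j \<and> j \<le> n \<and> q \<notin> {i..<j}}"
    using assms d_N by (intro CollectI exI[of _ "Suc (d + j)"] exI[of _ "Suc (d + Suc j)"]) auto
  then show ?thesis
    unfolding B_sub_def by (intro generate.incl UnI2 UnionI) auto
qed

lemma diag_part_el: "i \<noteq> j \<Longrightarrow> diag_part n (el n i j t) = 1\<^sub>m n"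
  unfolding diag_part_def by (rule eq_matI) (auto simp: el_index)

text \<open>A telescoping product of consecutive coroot elements: the entries in between cancel and
  the weights add up.\<close>

lemma two_entry_torus:
  assumes \<kappa>: "has_weight \<kappa> b" and "s \<le> m" "Suc m < N" "t \<noteq> (0 :: 'a::field)"
  defines "\<tau> \<equiv> \<lambda>m. mat n n (\<lambda>(r, c). if r \<noteq> c then 0 else if r = d + s then t else if r = Suc (d + m) then inverse t else 1)"
  shows "\<tau> m \<in> T_sub n q \<and> \<kappa> (\<tau> m) = t ^ (\<Sum>u=s..m. b u)"
  using assms(2,3)
proof (induction rule: dec_induct)
  case base
  have "\<tau> s = cr s t"
    unfolding \<tau>_def coroot_elem_def by (rule eq_matI) auto
  then show ?case
    using \<kappa> base assms(4) cr_in_T_sub[of s t] unfolding has_weight_def by simp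
next
  case (step m)
  have "\<tau> (Suc m) = \<tau> m * cr (Suc m) t"
  proof (rule eq_matI)
    fix r c assume "r < dim_row (\<tau> m * cr (Suc m) t)" "c < dim_col (\<tau> m * cr (Suc m) t)"
    then have rc: "r < n" "c < n" by (auto simp: \<tau>_def coroot_elem_def)
    have "(\<tau> m * cr (Suc m) t) $$ (r, c) = \<tau> m $$ (r, c) * cr (Suc m) t $$ (c, c)"
      using rc by (intro mult_diagonal) (auto simp: \<tau>_def coroot_elem_def)
    then show "\<tau> (Suc m) $$ (r, c) = (\<tau> m * cr (Suc m) t) $$ (r, c)"
      using rc step.hyps assms(4) by (auto simp: \<tau>_def coroot_elem_def)
  qed (auto simp: \<tau>_def coroot_elem_def)
  moreover have "\<tau> m \<in> T_sub n q" "\<kappa> (\<tau> m) = t ^ (\<Sum>u=s..m. b u)"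
    using step by auto
  moreover have "cr (Suc m) t \<in> T_sub n q"
    using step assms(4) by (intro cr_in_T_sub) auto
  moreover have "\<kappa> (cr (Suc m) t) = t ^ b (Suc m)"
    using \<kappa> step assms(4) unfolding has_weight_def by auto
  ultimately show ?case
    using \<kappa> step.hyps unfolding has_weight_def
    by (simp add: T_sub_mult power_add)
qed

lemma T_sub_in_B_sub: "t \<in> T_sub n q \<Longrightarrow> t \<in> B_sub n q"
  unfolding B_sub_def by (intro generate.incl) auto

text \<open>The polynomial \<open>Q\<close> extends \<open>f\<close> to all matrices, as
  \<open>dt ^ M\<close> times \<open>f\<close> after the retraction. It is invariant under column
  additions, and its shape consists of the partial sums of \<open>b\<close>, raised by
  \<open>M\<close> because each column scaling also scales \<open>dt\<close>.\<close>

lemma induced_in_flagspan: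
  fixes f :: "'a::{field,infinite} mat \<Rightarrow> 'a"
  assumes \<kappa>: "has_weight \<kappa> b" and f: "f \<in> rspace (induced_module n (G_sub n q) (B_sub n q) \<kappa>)"
  shows "\<exists>M. \<exists>Q\<in>flagspan N (\<lambda>s. if s < N then M + (\<Sum>u\<in>{s..<N-1}. b u) else 0). \<forall>g\<in>G_sub n q. f g = Q (blk d g)"
proof -
  have feq: "f (g * b) = \<kappa> (diag_part n b) * f g" if "g \<in> G_sub n q" "b \<in> B_sub n q" for g b
    using f that unfolding induced_module_def by simp
  obtain P where P: "P \<in> poly_fun n" "\<And>g. g \<in> G_sub n q \<Longrightarrow> f g = P g"
    using f unfolding induced_module_def regular_on_def by auto
  obtain M Q where Q: "Q \<in> pfun ({..<N} \<times> {..<N})"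
    and QP: "\<And>x. dt x \<noteq> 0 \<Longrightarrow> Q x = dt x ^ M * P (emb n d N (unimod x))"
    using clear_denominators[OF P(1)] by blast
  have Qf: "Q x = dt x ^ M * f (emb n d N (unimod x))" if "dt x \<noteq> 0" for x
    using QP[OF that] P(2)[OF emb_normal_in_G_sub[OF that]] by simp
  define r where "r = (\<lambda>s. if s < N then M + (\<Sum>u\<in>{s..<N-1}. b u) else 0)"
  have density: "F = G" if "F \<in> pfun ({..<N} \<times> {..<N})" "G \<in> pfun ({..<N} \<times> {..<N})"
      "\<And>x. dt x \<noteq> 0 \<Longrightarrow> F x = G x" for F G :: "_ \<Rightarrow> 'a"
  proof -
    have "(\<lambda>x. F x - G x) = (\<lambda>_. 0) \<or> dt = (\<lambda>_. 0 :: 'a)"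
      using that by (intro pfun_mult_eq_0[of _ "{..<N} \<times> {..<N}"] pfun_diff pfun_det_emb) auto
    moreover have "emb n d N (\<lambda>(r, c). if r = c then 1 else 0) = (1\<^sub>m n :: 'a mat)"
      by (rule eq_matI) (auto simp: emb_index)
    then have "dt (\<lambda>(r, c). if r = c then 1 else 0 :: 'a) = 1" by simp
    ultimately have "(\<lambda>x. F x - G x) = (\<lambda>_. 0)"
      by (metis (no_types, lifting) zero_neq_one)
    then show ?thesis
      by (auto simp: fun_eq_iff)
  qed
  have "Q (add_col j t x) = Q x" if j: "Suc j < N" for j t x
  proof -
    have "(\<lambda>x. Q (add_col j t x)) = Q"
    proof (rule density[OF _ Q])
      show "(\<lambda>x. Q (add_col j t x)) \<in> pfun ({..<N} \<times> {..<N})"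
      proof (rule pfun_compose[OF Q])
        fix v :: "nat \<times> nat" assume v: "v \<in> {..<N} \<times> {..<N}"
        then show "(\<lambda>x. add_col j t x v) \<in> pfun ({..<N} \<times> {..<N})"
          using j by (cases v; cases "snd v = Suc j")
            (auto simp: add_col_def intro!: pfun.intros)
      qed
    next
      fix x :: "nat \<times> nat \<Rightarrow> 'a" assume x: "dt x \<noteq> 0"
      \<comment> \<open>The column operation meets the division by \<open>dt x\<close> only when its
        target is the last column.\<close>
      define t' where "t' = (if Suc j = N - 1 then t / dt x else t)"
      have "unimod (add_col j t x) = add_col j t' (unimod x)"
        unfolding dt_add_col[OF j] t'_def using j
        by (auto simp: scale_col_def add_col_def fun_eq_iff add_divide_distrib)
      then have "emb n d N (unimod (add_col j t x)) = emb n d N (unimod x) * el n (d + j) (d + Suc j) t'"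
        using emb_add_col[OF j] by simp
      then have "f (emb n d N (unimod (add_col j t x))) = \<kappa> (1\<^sub>m n) * f (emb n d N (unimod x))"
        using feq[OF emb_normal_in_G_sub[OF x] el_in_B_sub[OF j, of t']] by (simp add: diag_part_el)
      then show "Q (add_col j t x) = Q x"
        using Qf[OF x] Qf[of "add_col j t x"] x dt_add_col[OF j, of t x] has_weight_one[OF \<kappa>] by simp
    qed
    then show ?thesis by (rule fun_cong)
  qed
  moreover have "Q (scale_col s t x) = t ^ r s * Q x" if s: "s < N" and t: "t \<noteq> 0" for s t x
  proof -
    have "(\<lambda>x. Q (scale_col s t x)) = (\<lambda>x. t ^ r s * Q x)"
    proof (rule density)
      show "(\<lambda>x. Q (scale_col s t x)) \<in> pfun ({..<N} \<times> {..<N})"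
      proof (rule pfun_compose[OF Q])
        fix v :: "nat \<times> nat" assume v: "v \<in> {..<N} \<times> {..<N}"
        then show "(\<lambda>x. scale_col s t x v) \<in> pfun ({..<N} \<times> {..<N})"
          by (cases v; cases "snd v = s") (auto simp: scale_col_def intro!: pfun.intros)
      qed
      show "(\<lambda>x. t ^ r s * Q x) \<in> pfun ({..<N} \<times> {..<N})"
        by (intro pfun.mult pfun.const Q)
    next
      fix x :: "nat \<times> nat \<Rightarrow> 'a" assume x: "dt x \<noteq> 0"
      have dt': "dt (scale_col s t x) = t * dt x"
        by (rule dt_scale_col[OF s])
      show "Q (scale_col s t x) = t ^ r s * Q x"
      \<comment> \<open>The retraction undoes a scaling of the last column, so only
        \<open>dt ^ M\<close> notices it. A scaling of another column turns into the torus element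
        with \<open>t\<close> at \<open>s\<close> and its inverse in the last place.\<close>
      proof (cases "s = N - 1")
        case True
        have "unimod (scale_col s t x) = unimod x"
          unfolding dt' using t by (auto simp: scale_col_def True fun_eq_iff)
        then show ?thesis
          using Qf[OF x] Qf[of "scale_col s t x"] x t s unfolding dt'
          by (simp add: power_mult_distrib r_def True)
      next
        case False
        define \<tau> where "\<tau> = mat n n (\<lambda>(r, c). if r \<noteq> c then 0 else if r = d + s then t
          else if r = Suc (d + (N - 2)) then inverse t else 1)"
        have \<tau>: "\<tau> \<in> T_sub n q" "\<kappa> \<tau> = t ^ (\<Sum>u=s..N-2. b u)"
          using two_entry_torus[OF \<kappa>, of s "N - 2" t] False s t N_ge_2 unfolding \<tau>_def by auto
        have "emb n d N (unimod (scale_col s t x)) = emb n d N (unimod x) * \<tau>"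
        proof (rule eq_matI)
          fix r c assume "r < dim_row (emb n d N (unimod x) * \<tau>)" "c < dim_col (emb n d N (unimod x) * \<tau>)"
          then have rc: "r < n" "c < n" by (auto simp: \<tau>_def)
          have "(emb n d N (unimod x) * \<tau>) $$ (r, c) = emb n d N (unimod x) $$ (r, c) * \<tau> $$ (c, c)"
            using rc by (intro mult_diagonal) (auto simp: \<tau>_def)
          moreover have "\<tau> $$ (c, c) = (if c = d + s then t else if c = Suc (d + (N - 2)) then inverse t else 1)"
            using rc unfolding \<tau>_def by simp
          ultimately have mult: "(emb n d N (unimod x) * \<tau>) $$ (r, c) = emb n d N (unimod x) $$ (r, c) *
              (if c = d + s then t else if c = Suc (d + (N - 2)) then inverse t else 1)"
            by simp
          show "emb n d N (unimod (scale_col s t x)) $$ (r, c) = (emb n d N (unimod x) * \<tau>) $$ (r, c)"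
          proof (cases "r \<in> {d..<d+N} \<and> c \<in> {d..<d+N}")
            case True
            then obtain r' c' where rc': "r = d + r'" "c = d + c'"
              by (meson atLeastLessThan_iff nat_le_iff_add)
            have rc'_less: "r' < N" "c' < N"
              using True unfolding rc' by simp_all
            have eqs: "d + c' = Suc (d + (N - 2)) \<longleftrightarrow> c' = N - 1" "d + c' = d + s \<longleftrightarrow> c' = s"
              using N_ge_2 by auto
            show ?thesis
              unfolding mult unfolding rc' dt' emb_index_block[OF rc'_less] eqs unfolding scale_col_def prod.case
              using \<open>s \<noteq> N - 1\<close>
              by (cases "c' = s"; cases "c' = N - 1") (simp_all add: divide_inverse ac_simps del: One_nat_def)
          next
            case False
            then have "c = d + s \<or> c = Suc (d + (N - 2)) \<Longrightarrow> r \<noteq> c"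
              using s N_ge_2 by auto
            moreover have "emb n d N y $$ (r, c) = (if r = c then 1 else 0)" for y :: "_ \<Rightarrow> 'a"
              unfolding emb_index[OF rc] if_not_P[OF False] ..
            ultimately show ?thesis
              unfolding mult by auto
          qed
        qed (auto simp: \<tau>_def)
        then have "f (emb n d N (unimod (scale_col s t x))) = \<kappa> \<tau> * f (emb n d N (unimod x))"
          using feq[OF emb_normal_in_G_sub[OF x] T_sub_in_B_sub[OF \<tau>(1)]] diag_part_T_sub[OF \<tau>(1)] by simp
        moreover have "{s..<N-1} = {s..N-2}"
          using N_ge_2 by auto
        ultimately show ?thesis
          using Qf[OF x] Qf[of "scale_col s t x"] x t s unfolding dt' \<tau>(2)
          by (simp add: power_mult_distrib power_add r_def)
      qed
    qed
    then show ?thesis by (rule fun_cong)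
  qed
  ultimately have "Q \<in> flagspan N r"
    by (intro unipotent_invariants_in_flagspan[OF Q]) (auto simp: r_def)
  moreover have "f g = Q (blk d g)" if g: "g \<in> G_sub n q" for g
  proof -
    have dt1: "dt (blk d g) = 1"
      using emb_blk_G_sub[OF g] G_sub_SL[OF g] by simp
    have "unimod (blk d g) = blk d g"
      unfolding dt1 by (auto simp: scale_col_def fun_eq_iff)
    then show ?thesis
      using Qf[of "blk d g"] dt1 emb_blk_G_sub[OF g] by simp
  qed
  ultimately show ?thesis
    unfolding r_def by blast
qed

text \<open>\<open>V\<close> is closed under sums only; scalars are absorbed into the section
  \<open>h\<close>.\<close>

theorem induced_generated_by_minors:
  fixes f :: "'a::{field,infinite} mat \<Rightarrow> 'a"
  assumes \<kappa>: "has_weight \<kappa> b" and \<kappa>': "has_weight \<kappa>' b'" and c: "0 < c" "c < N"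
    and b: "\<And>s. Suc s < N \<Longrightarrow> b s = b' s + (if Suc s = c then 1 else 0)"
    and f: "f \<in> rspace (induced_module n (G_sub n q) (B_sub n q) \<kappa>)"
    and zero: "(\<lambda>_. 0) \<in> V" and add: "\<And>u w. u \<in> V \<Longrightarrow> w \<in> V \<Longrightarrow> (\<lambda>g. u g + w g) \<in> V"
    and minor: "\<And>I h. sorted_wrt (<) I \<Longrightarrow> set I \<subseteq> {..<N} \<Longrightarrow> length I = c \<Longrightarrow>
      h \<in> rspace (induced_module n (G_sub n q) (B_sub n q) \<kappa>') \<Longrightarrow> (\<lambda>g. minor I 0 (blk d g) * h g) \<in> V"
  shows "f \<in> V"
proof -
  obtain M Q where Q: "Q \<in> flagspan N (\<lambda>s. if s < N then M + (\<Sum>u\<in>{s..<N-1}. b u) else 0)"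
    and fQ: "\<And>g. g \<in> G_sub n q \<Longrightarrow> f g = Q (blk d g)"
    using induced_in_flagspan[OF \<kappa> f] by blast
  define r where "r = (\<lambda>s. if s < N then M + (\<Sum>u\<in>{s..<N-1}. b u) else 0)"
  have r: "r s = r (Suc s) + b s" if "Suc s < N" for s
    using that unfolding r_def by (simp add: sum.atLeast_Suc_lessThan)
  have "(\<lambda>g. if g \<in> G_sub n q then Q (blk d g) else 0) \<in> V"
    using Q[folded r_def]
  proof (induction rule: flagspan.induct)
    case zero
    then show ?case using assms(7) by (simp cong: if_cong)
  next
    case (add F h a)
    \<comment> \<open>\<open>b (c - 1)\<close> is positive because it exceeds
      \<open>b' (c - 1)\<close> by one. So each product of this shape contains a minor with
      \<open>c\<close> rows, and what remains has weight \<open>\<kappa>'\<close>.\<close>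
    have "r c < r (c - 1)"
      using r[of "c - 1"] b[of "c - 1"] c by simp
    from flagprod_factor[OF add(2) c(1) this]
    obtain I h' r' where I: "h = (\<lambda>x. minor I 0 x * h' x)" "flagprod N r' h'" "length I = c"
      "sorted_wrt (<) I" "set I \<subseteq> {..<N}" "\<And>s. r s = r' s + (if s < c then 1 else 0)"
      by blast
    have "r' s = r' (Suc s) + b' s" if "Suc s < N" for s
      using I(6)[of s] I(6)[of "Suc s"] r[OF that] b[OF that] by (simp split: if_splits)
    then have "(\<lambda>g. if g \<in> G_sub n q then a * h' (blk d g) else 0)
        \<in> rspace (induced_module n (G_sub n q) (B_sub n q) \<kappa>')"
      by (rule flagprod_in_induced[OF I(2) \<kappa>'])
    from minor[OF I(4,5,3) this]
    have "(\<lambda>g. minor I 0 (blk d g) * (if g \<in> G_sub n q then a * h' (blk d g) else 0)) \<in> V" .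
    from assms(8)[OF add(3) this]
    show ?case
      unfolding I(1) by (simp add: if_distrib ac_simps cong: if_cong)
  qed
  moreover have "(\<lambda>g. if g \<in> G_sub n q then Q (blk d g) else 0) = f"
    using f fQ unfolding induced_module_def by (auto simp: fun_eq_iff)
  ultimately show ?thesis by simp
qed

end


section \<open>Rational modules\<close>

definition linear_on :: "('a::field \<Rightarrow> 'v::ab_group_add \<Rightarrow> 'v) \<Rightarrow> 'v set \<Rightarrow> ('v \<Rightarrow> 'a) \<Rightarrow> bool" where
  "linear_on sc V \<xi> \<longleftrightarrow> (\<forall>x\<in>V. \<forall>y\<in>V. \<xi> (x + y) = \<xi> x + \<xi> y) \<and> (\<forall>c. \<forall>x\<in>V. \<xi> (sc c x) = c * \<xi> x)"

lemma exists_functional: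
  fixes sc :: "'a::field \<Rightarrow> 'v::ab_group_add \<Rightarrow> 'v"
  assumes "vector_space sc" and B: "\<not> module.dependent sc B"
  shows "\<exists>\<xi>. (\<forall>V. linear_on sc V \<xi>) \<and> (\<forall>x\<in>B. \<xi> x = f x) \<and> (\<forall>x\<in>module.span sc (B \<inter> {x. f x = 0}). \<xi> x = 0)"
proof -
  interpret vector_space sc by fact
  interpret self: vector_space "(*) :: 'a \<Rightarrow> 'a \<Rightarrow> 'a"
    by unfold_locales (auto simp: algebra_simps)
  interpret vector_space_pair sc "(*) :: 'a \<Rightarrow> 'a \<Rightarrow> 'a" ..
  obtain \<xi> where \<xi>: "Vector_Spaces.linear sc (*) \<xi>" "\<forall>x\<in>B. \<xi> x = f x"
    using linear_independent_extend[OF B] by blast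
  have "\<forall>x\<in>span (B \<inter> {x. f x = 0}). \<xi> x = 0"
  proof
    fix x assume x: "x \<in> span (B \<inter> {x. f x = 0})"
    show "\<xi> x = 0"
      by (rule linear_eq_0_on_span[OF \<xi>(1) _ x]) (use \<xi>(2) in auto)
  qed
  moreover have "linear_on sc V \<xi>" for V
    using linear_add[OF \<xi>(1)] linear_scale[OF \<xi>(1)] unfolding linear_on_def by blast
  ultimately show ?thesis
    using \<xi>(2) by blast
qed

lemma functional_separating_subspace:
  fixes sc :: "'a::field \<Rightarrow> 'v::ab_group_add \<Rightarrow> 'v"
  assumes "vector_space sc" and W: "module.subspace sc W" "w \<notin> W"
  shows "\<exists>\<xi>. (\<forall>V. linear_on sc V \<xi>) \<and> \<xi> w = 1 \<and> (\<forall>u\<in>W. \<xi> u = 0)"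
proof -
  interpret vector_space sc by fact
  obtain B where B: "B \<subseteq> W" "independent B" "W \<subseteq> span B"
    using basis_exists[of W] by metis
  have "span B \<subseteq> W"
    using B(1) W(1) by (simp add: span_minimal)
  then have "w \<notin> span B" using W(2) by blast
  then have ind: "independent (insert w B)" and "w \<notin> B"
    using B(2) by (auto simp: independent_insert intro: span_base)
  obtain \<xi> where \<xi>: "\<forall>V. linear_on sc V \<xi>" "\<forall>x\<in>insert w B. \<xi> x = (if x = w then 1 else 0)"
    "\<forall>x\<in>span (insert w B \<inter> {x. (if x = w then 1 else 0 :: 'a) = 0}). \<xi> x = 0"
    using exists_functional[OF assms(1) ind, of "\<lambda>x. if x = w then 1 else 0"] by blast
  have "insert w B \<inter> {x. (if x = w then 1 else 0 :: 'a) = 0} = B"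
    using \<open>w \<notin> B\<close> by auto
  with \<xi> B(3) show ?thesis by auto
qed

text \<open>Along such a curve every polynomial function is a polynomial in the parameter. The
  curves in use are root subgroups.\<close>

definition poly_curve :: "nat \<Rightarrow> ('a::field \<Rightarrow> 'a mat) \<Rightarrow> bool" where
  "poly_curve n \<gamma> \<longleftrightarrow> (\<forall>t. \<gamma> t \<in> carrier (SL n)) \<and> (\<forall>i<n. \<forall>j<n. \<exists>p. \<forall>t. \<gamma> t $$ (i, j) = poly p t)"

lemma poly_fun_curve:
  assumes "P \<in> poly_fun n" "poly_curve n \<gamma>"
  shows "\<exists>p. \<forall>t. P (\<gamma> t) = poly p t"
  using assms(1)
proof (induction rule: poly_fun.induct)
  case (const c)
  show ?case by (intro exI[of _ "[:c:]"]) simp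
next
  case (entry i j)
  then show ?case using assms(2) unfolding poly_curve_def by blast
next
  case (add f g)
  then show ?case by (metis poly_add)
next
  case (mult f g)
  then show ?case by (metis poly_mult)
qed

lemma poly_curve_el:
  assumes "i \<noteq> j"
  shows "poly_curve n (el n i j :: 'a::field \<Rightarrow> _)"
  unfolding poly_curve_def
proof (intro conjI allI impI)
  show "el n i j t \<in> carrier (SL n)" for t :: 'a
    by (rule el_in_SL[OF assms])
  fix r c assume "r < n" "c < n"
  then show "\<exists>p. \<forall>t :: 'a. el n i j t $$ (r, c) = poly p t"
    by (intro exI[of _ "if r = c then [:1:] else if r = i \<and> c = j then [:0, 1:] else 0"]) (auto simp: el_index)
qed

lemma poly_fun_sum: "(\<And>i. i \<in> A \<Longrightarrow> f i \<in> poly_fun n) \<Longrightarrow> (\<lambda>g. \<Sum>i\<in>A. f i g) \<in> poly_fun n"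
  by (induction A rule: infinite_finite_induct) (auto intro: poly_fun.intros)

lemma regular_on_sum:
  assumes "\<And>i. i \<in> A \<Longrightarrow> regular_on n H (f i)"
  shows "regular_on n H (\<lambda>g. \<Sum>i\<in>A. a i * f i g)"
proof -
  obtain P where P: "\<And>i. i \<in> A \<Longrightarrow> P i \<in> poly_fun n" "\<And>i g. i \<in> A \<Longrightarrow> g \<in> H \<Longrightarrow> f i g = P i g"
    using assms unfolding regular_on_def by metis
  have "(\<lambda>g. \<Sum>i\<in>A. a i * P i g) \<in> poly_fun n"
    by (intro poly_fun_sum poly_fun.mult poly_fun.const P)
  moreover have "\<forall>g\<in>H. (\<Sum>i\<in>A. a i * f i g) = (\<Sum>i\<in>A. a i * P i g)"
    using P(2) by (auto intro: sum.cong)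
  ultimately show ?thesis
    unfolding regular_on_def by (intro bexI[of _ "\<lambda>g. \<Sum>i\<in>A. a i * P i g"])
qed

locale rat_module =
  fixes n :: nat and L :: "('a::{field,infinite}, 'v::ab_group_add) repn"
  assumes rational: "rational_module n (carrier (SL n)) L"
begin

abbreviation "V \<equiv> rspace L"
abbreviation "sc \<equiv> rscale L"
abbreviation "act \<equiv> ract L"
abbreviation "lin \<equiv> linear_on sc V"

lemma linear: "linear_action n (carrier (SL n)) L"
  using rational unfolding rational_module_def by blast

sublocale vs: vector_space "rscale L"
  using linear unfolding linear_action_def by blast

lemma subspace_V: "vs.subspace V"
  using linear unfolding linear_action_def by blast

lemma V_closed [intro, simp]:
  "0 \<in> V" "x \<in> V \<Longrightarrow> y \<in> V \<Longrightarrow> x + y \<in> V" "x \<in> V \<Longrightarrow> sc c x \<in> V"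
  using subspace_V unfolding vs.subspace_def by auto

lemma V_sum: "(\<And>i. i \<in> A \<Longrightarrow> f i \<in> V) \<Longrightarrow> sum f A \<in> V"
  by (rule vs.subspace_sum[OF subspace_V])

lemma act_simps:
  "g \<in> carrier (SL n) \<Longrightarrow> x \<in> V \<Longrightarrow> act g x \<in> V"
  "g \<in> carrier (SL n) \<Longrightarrow> x \<in> V \<Longrightarrow> y \<in> V \<Longrightarrow> act g (x + y) = act g x + act g y"
  "g \<in> carrier (SL n) \<Longrightarrow> x \<in> V \<Longrightarrow> act g (sc c x) = sc c (act g x)"
  "x \<in> V \<Longrightarrow> act (1\<^sub>m n) x = x"
  "g \<in> carrier (SL n) \<Longrightarrow> h \<in> carrier (SL n) \<Longrightarrow> x \<in> V \<Longrightarrow> act (g * h) x = act g (act h x)"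
  using linear unfolding linear_action_def by blast+

lemma act_zero: "g \<in> carrier (SL n) \<Longrightarrow> act g 0 = 0"
  using act_simps(3)[of g 0 0] by simp

lemma act_sum: "g \<in> carrier (SL n) \<Longrightarrow> (\<And>i. i \<in> A \<Longrightarrow> w i \<in> V) \<Longrightarrow>
    act g (\<Sum>i\<in>A. sc (c i) (w i)) = (\<Sum>i\<in>A. sc (c i) (act g (w i)))"
proof (induction A rule: infinite_finite_induct)
  case (insert a A)
  then have "(\<Sum>i\<in>A. sc (c i) (w i)) \<in> V" by (intro V_sum) auto
  then show ?case using insert by (simp add: act_simps)
qed (auto simp: act_zero)

lemma lin_simps:
  "lin \<xi> \<Longrightarrow> x \<in> V \<Longrightarrow> y \<in> V \<Longrightarrow> \<xi> (x + y) = \<xi> x + \<xi> y"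
  "lin \<xi> \<Longrightarrow> x \<in> V \<Longrightarrow> \<xi> (sc c x) = c * \<xi> x"
  unfolding linear_on_def by auto

lemma lin_zero: "lin \<xi> \<Longrightarrow> \<xi> 0 = 0"
  using lin_simps(2)[of \<xi> 0 0] by simp

lemma lin_sum: "lin \<xi> \<Longrightarrow> (\<And>i. i \<in> A \<Longrightarrow> w i \<in> V) \<Longrightarrow>
    \<xi> (\<Sum>i\<in>A. sc (c i) (w i)) = (\<Sum>i\<in>A. c i * \<xi> (w i))"
proof (induction A rule: infinite_finite_induct)
  case (insert a A)
  then have "(\<Sum>i\<in>A. sc (c i) (w i)) \<in> V" by (intro V_sum) auto
  then show ?case using insert by (simp add: lin_simps)
qed (auto simp: lin_zero)

lemma lin_act: "lin \<xi> \<Longrightarrow> g \<in> carrier (SL n) \<Longrightarrow> lin (\<lambda>x. \<xi> (act g x))"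
  unfolding linear_on_def by (simp add: act_simps)

text \<open>Linear forms separate points, which reduces identities of vectors to identities of
  scalar polynomials.\<close>

lemma lin_ext:
  assumes "x \<in> V" "y \<in> V" "\<And>\<xi>. lin \<xi> \<Longrightarrow> \<xi> x = \<xi> y"
  shows "x = y"
proof (rule ccontr)
  assume "x \<noteq> y"
  then have "x + sc (-1) y \<notin> {0}" by simp
  then obtain \<xi> where \<xi>: "\<forall>V. linear_on sc V \<xi>" "\<xi> (x + sc (-1) y) = 1"
    using functional_separating_subspace[OF vs.vector_space_axioms, of "{0}" "x + sc (-1) y"] by auto
  then have lin: "lin \<xi>" by blast
  have "\<xi> (x + sc (-1) y) = \<xi> x + - 1 * \<xi> y"
    unfolding lin_simps(1)[OF lin assms(1) V_closed(3)[OF assms(2)]] lin_simps(2)[OF lin assms(2)] ..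
  then show False
    using \<xi>(2) assms(3)[OF lin] by simp
qed

lemma expansion_unique:
  assumes "\<And>k. X k \<in> V" "\<And>k. Y k \<in> V"
    and "\<And>t. (\<Sum>k\<le>D. sc (t ^ k) (X k)) = (\<Sum>k\<le>D. sc (t ^ k) (Y k))" and "k \<le> D"
  shows "X k = Y k"
proof (rule lin_ext)
  fix \<xi> assume \<xi>: "lin \<xi>"
  have "(\<Sum>k\<le>D. t ^ k * \<xi> (X k)) = (\<Sum>k\<le>D. t ^ k * \<xi> (Y k))" for t
    using arg_cong[OF assms(3)[of t], of \<xi>] assms(1,2) by (simp add: lin_sum[OF \<xi>])
  then show "\<xi> (X k) = \<xi> (Y k)"
    using coeff_eq_of_sums_eq[where a = "\<lambda>k. \<xi> (X k)" and b = "\<lambda>k. \<xi> (Y k)" and d = D and k = k] assms(4) by blast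
qed (use assms in auto)

lemma act_rational:
  assumes "w \<in> V"
  shows "\<exists>(r::nat) u f. (\<forall>i<r. u i \<in> V \<and> regular_on n (carrier (SL n)) (f i)) \<and>
    (\<forall>g\<in>carrier (SL n). act g w = (\<Sum>i<r. sc (f i g) (u i)))"
  using rational assms unfolding rational_module_def by blast

text \<open>The orbit map of \<open>w\<close> involves finitely many regular functions, each a
  polynomial along the curve; the sum is then regrouped by powers of the parameter.\<close>

lemma curve_expansion:
  assumes \<gamma>: "poly_curve n \<gamma>" and w: "w \<in> V"
  shows "\<exists>X D. (\<forall>k. X k \<in> V) \<and> (\<forall>k>D. X k = 0) \<and> (\<forall>t. act (\<gamma> t) w = (\<Sum>k\<le>D. sc (t ^ k) (X k)))"
proof -
  obtain r :: nat and u f where u: "\<And>i. i < r \<Longrightarrow> u i \<in> V" "\<And>i. i < r \<Longrightarrow> regular_on n (carrier (SL n)) (f i)"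
    and act: "\<And>g. g \<in> carrier (SL n) \<Longrightarrow> act g w = (\<Sum>i<r. sc (f i g) (u i))"
    using act_rational[OF w] by blast
  have SL: "\<gamma> t \<in> carrier (SL n)" for t
    using \<gamma> unfolding poly_curve_def by blast
  have "\<exists>p. \<forall>t. f i (\<gamma> t) = poly p t" if i: "i < r" for i
  proof -
    obtain P where "P \<in> poly_fun n" "\<forall>g\<in>carrier (SL n). f i g = P g"
      using u(2)[OF i] unfolding regular_on_def by blast
    then show ?thesis
      using poly_fun_curve[OF _ \<gamma>, of P] SL by metis
  qed
  then obtain p where p: "\<And>i t. i < r \<Longrightarrow> f i (\<gamma> t) = poly (p i) t"
    by metis
  define D where "D = (\<Sum>i<r. degree (p i))"
  define X where "X k = (\<Sum>i<r. sc (coeff (p i) k) (u i))" for k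
  have D: "degree (p i) \<le> D" if "i < r" for i
    unfolding D_def using member_le_sum[of i "{..<r}" "\<lambda>i. degree (p i)"] that by auto
  have "act (\<gamma> t) w = (\<Sum>k\<le>D. sc (t ^ k) (X k))" for t
  proof -
    have "act (\<gamma> t) w = (\<Sum>i<r. sc (poly (p i) t) (u i))"
      unfolding act[OF SL] by (intro sum.cong refl) (simp add: p)
    also have "\<dots> = (\<Sum>i<r. \<Sum>k\<le>D. sc (t ^ k) (sc (coeff (p i) k) (u i)))"
    proof (rule sum.cong[OF refl])
      fix i assume "i \<in> {..<r}"
      then have "poly (p i) t = (\<Sum>k\<le>D. t ^ k * coeff (p i) k)"
        unfolding poly_altdef mult.commute[of "t ^ _"] using D[of i]
        by (intro sum.mono_neutral_left) (auto dest: le_degree intro: order_trans)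
      then show "sc (poly (p i) t) (u i) = (\<Sum>k\<le>D. sc (t ^ k) (sc (coeff (p i) k) (u i)))"
        by (simp add: vs.scale_sum_left)
    qed
    also have "\<dots> = (\<Sum>k\<le>D. sc (t ^ k) (X k))"
      unfolding X_def vs.scale_sum_right by (rule sum.swap)
    finally show ?thesis .
  qed
  moreover have "X k = 0" if "k > D" for k
    unfolding X_def
  proof (intro sum.neutral ballI)
    fix i assume "i \<in> {..<r}"
    then have "degree (p i) < k" using D[of i] that by simp
    then show "sc (coeff (p i) k) (u i) = 0" by (simp add: coeff_eq_0)
  qed
  moreover have "X k \<in> V" for k
    unfolding X_def using u(1) by (intro V_sum) auto
  ultimately show ?thesis by blast
qed

lemma expansion_extend:
  assumes "\<And>k. k > D \<Longrightarrow> X k = 0" "D \<le> D'"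
  shows "(\<Sum>k\<le>D. sc (t ^ k) (X k)) = (\<Sum>k\<le>D'. sc (t ^ k) (X k))"
  using assms by (intro sum.mono_neutral_left) auto

lemma curve_functional_poly:
  assumes "poly_curve n \<gamma>" "w \<in> V" "lin \<xi>"
  shows "\<exists>p. \<forall>t. \<xi> (act (\<gamma> t) w) = poly p t"
proof -
  obtain X D where X: "\<forall>k. X k \<in> V" "\<forall>t. act (\<gamma> t) w = (\<Sum>k\<le>D. sc (t ^ k) (X k))"
    using curve_expansion[OF assms(1,2)] by blast
  then have "\<xi> (act (\<gamma> t) w) = poly (\<Sum>k\<le>D. monom (\<xi> (X k)) k) t" for t
    by (simp add: lin_sum[OF assms(3)] poly_sum poly_monom mult.commute)
  then show ?thesis by blast
qed

lemma divided_power_eq: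
  assumes X: "\<And>k. X k \<in> V" "\<And>k. k > D \<Longrightarrow> X k = 0"
    and exp: "\<And>t. act (root_elem n i j t) w = (\<Sum>k\<le>D. sc (t ^ k) (X k))"
  shows "divided_power n L i j m w = X m"
proof -
  have supp: "(\<Sum>l | Y l \<noteq> 0. sc (t ^ l) (Y l)) = (\<Sum>k\<le>M. sc (t ^ k) (Y k))"
    if "\<And>k. k > M \<Longrightarrow> Y k = 0" for Y M t
    using that by (intro sum.mono_neutral_left) (auto simp: not_less[symmetric])
  have "(THE Y. (\<forall>l. Y l \<in> V) \<and> finite {l. Y l \<noteq> 0} \<and>
      (\<forall>t. act (root_elem n i j t) w = (\<Sum>l | Y l \<noteq> 0. sc (t ^ l) (Y l)))) = X"
  proof (rule the_equality)
    have "finite {l. X l \<noteq> 0}"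
      by (rule finite_subset[of _ "{..D}"]) (use X(2) in \<open>auto simp: not_less[symmetric]\<close>)
    then show "(\<forall>l. X l \<in> V) \<and> finite {l. X l \<noteq> 0} \<and>
      (\<forall>t. act (root_elem n i j t) w = (\<Sum>l | X l \<noteq> 0. sc (t ^ l) (X l)))"
      using X exp supp[OF X(2)] by auto
  next
    fix Y assume Y: "(\<forall>l. Y l \<in> V) \<and> finite {l. Y l \<noteq> 0} \<and>
      (\<forall>t. act (root_elem n i j t) w = (\<Sum>l | Y l \<noteq> 0. sc (t ^ l) (Y l)))"
    then obtain M where M: "\<And>k. Y k \<noteq> 0 \<Longrightarrow> k \<le> M"
      using finite_nat_set_iff_bounded_le[of "{l. Y l \<noteq> 0}"] by auto
    show "Y = X"
    proof
      fix k
      have *: "(\<Sum>l\<le>D + M + k. sc (t ^ l) (Y l)) = (\<Sum>l\<le>D + M + k. sc (t ^ l) (X l))" for t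
      proof -
        have "(\<Sum>l\<le>D + M + k. sc (t ^ l) (Y l)) = act (root_elem n i j t) w"
          using Y supp[of "D + M + k" Y t] M by force
        also have "\<dots> = (\<Sum>l\<le>D + M + k. sc (t ^ l) (X l))"
          unfolding exp by (rule expansion_extend[OF X(2)]) auto
        finally show ?thesis .
      qed
      show "Y k = X k"
        by (rule expansion_unique[OF _ X(1) *, of k]) (use Y in auto)
    qed
  qed
  then show ?thesis
    unfolding divided_power_def by simp
qed

end

section \<open>The chain of levels and their matrix coefficients\<close>

lemma coeff_linear_power:
  "coeff ([:1, a:] ^ m) 0 = 1" "coeff ([:1, a:] ^ m) (Suc 0) = of_nat m * (a :: 'a::field)"
  by (induction m) (auto simp: algebra_simps)

lemma coeff_mult_1: "coeff (p * q) (Suc 0) = coeff p 0 * coeff q (Suc 0) + coeff p (Suc 0) * coeff q 0"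
  by (simp add: coeff_mult)

lemma vector_space_funs: "vector_space (\<lambda>c (\<phi> :: 'w \<Rightarrow> 'a::field) w. c * \<phi> w)"
  by unfold_locales (auto simp: fun_eq_iff algebra_simps)

text \<open>What both corners share. \<open>X k\<close> has weight \<open>\<kappa> k\<close> with
  coroot values \<open>\<beta> k\<close>, and each level adds the fundamental weight number
  \<open>c\<close> of the block. The curves \<open>x \<iota>\<close> will be root subgroups of
  positive roots that involve the removed simple root; \<open>straighten\<close> moves them past
  \<open>g\<close> and \<open>y s\<close>, and \<open>a\<close> will be the pairing of the highest
  weight with the removed coroot. By \<open>minors\<close> the functions
  \<open>\<phi> \<iota>\<close> give all flag minors with \<open>c\<close> rows up to
  scalars.\<close>

locale level_module = block n q d N + rat_module n L
  for n q d N :: nat and L :: "('a::{field,infinite}, 'v::ab_group_add) repn" +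
  fixes v :: 'v and y :: "'a \<Rightarrow> 'a mat" and X :: "nat \<Rightarrow> 'v" and D a c :: nat
    and \<kappa> :: "nat \<Rightarrow> 'a mat \<Rightarrow> 'a" and \<beta> :: "nat \<Rightarrow> nat \<Rightarrow> nat"
    and J :: "nat set" and x :: "nat \<Rightarrow> 'a \<Rightarrow> 'a mat" and \<phi> :: "nat \<Rightarrow> 'a mat \<Rightarrow> 'a"
  assumes v: "v \<in> V" "v \<noteq> 0" and X: "\<And>k. X k \<in> V" "\<And>k. k > D \<Longrightarrow> X k = 0" "X 0 = v"
    and y_SL: "\<And>s. y s \<in> carrier (SL n)"
    and y_expansion: "\<And>s. act (y s) v = (\<Sum>k\<le>D. sc (s ^ k) (X k))"
    and B_act: "\<And>b k. b \<in> B_sub n q \<Longrightarrow> act b (X k) = sc (\<kappa> k (diag_part n b)) (X k)"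
    and \<kappa>: "\<And>k. has_weight (\<kappa> k) (\<beta> k)"
    and \<beta>: "\<And>k s. Suc s < N \<Longrightarrow> \<beta> (Suc k) s = \<beta> k s + (if Suc s = c then 1 else 0)"
    and c: "0 < c" "c < N"
    and x: "\<And>\<iota>. \<iota> \<in> J \<Longrightarrow> poly_curve n (x \<iota>)" "\<And>\<iota>. \<iota> \<in> J \<Longrightarrow> x \<iota> 0 = 1\<^sub>m n"
    and straighten: "\<And>\<iota> g s t. \<iota> \<in> J \<Longrightarrow> g \<in> G_sub n q \<Longrightarrow> 1 + s * t * \<phi> \<iota> g \<noteq> 0 \<Longrightarrow>
      act (x \<iota> t) (act g (act (y s) v)) =
        sc ((1 + s * t * \<phi> \<iota> g) ^ a) (act g (act (y (s / (1 + s * t * \<phi> \<iota> g))) v))"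
    and minors: "\<And>I. sorted_wrt (<) I \<Longrightarrow> set I \<subseteq> {..<N} \<Longrightarrow> length I = c \<Longrightarrow>
      \<exists>\<iota>\<in>J. \<exists>z. \<forall>g\<in>G_sub n q. minor I 0 (blk d g) = z * \<phi> \<iota> g"
    and J_unit: "\<exists>\<iota>\<in>J. \<phi> \<iota> (1\<^sub>m n) = 1"
begin

lemma G_SL: "g \<in> G_sub n q \<Longrightarrow> g \<in> carrier (SL n)"
  using G_sub_SL by simp

text \<open>
  \<open>\<eta> = \<xi> \<circ> d/dt x \<iota> t\<close> at \<open>t = 0\<close>; the identity is the coefficient of \<open>t s\<^bsup>j+1\<^esup>\<close> in \<open>straighten\<close>.
\<close>
lemma lower_level:
  assumes \<iota>: "\<iota> \<in> J" and \<xi>: "lin \<xi>"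
  shows "\<exists>\<eta>. lin \<eta> \<and> (\<forall>g\<in>G_sub n q. \<forall>j. \<eta> (act g (X (Suc j))) = (of_nat a - of_nat j) * \<phi> \<iota> g * \<xi> (act g (X j)))"
proof -
  have xSL: "x \<iota> t \<in> carrier (SL n)" for t
    using x(1)[OF \<iota>] unfolding poly_curve_def by blast
  have "\<forall>w\<in>V. \<exists>p. \<forall>t. \<xi> (act (x \<iota> t) w) = poly p t"
    using curve_functional_poly[OF x(1)[OF \<iota>] _ \<xi>] by blast
  then obtain p where p: "\<And>w t. w \<in> V \<Longrightarrow> \<xi> (act (x \<iota> t) w) = poly (p w) t"
    by metis
  have p_add: "p (w + w') = p w + p w'" if "w \<in> V" "w' \<in> V" for w w'
    by (rule poly_eqI_infinite) (use that xSL in \<open>simp add: p[symmetric] act_simps lin_simps[OF \<xi>]\<close>)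
  have p_scale: "p (sc z w) = smult z (p w)" if "w \<in> V" for z w
    by (rule poly_eqI_infinite) (use that xSL in \<open>simp add: p[symmetric] act_simps lin_simps[OF \<xi>]\<close>)
  define \<eta> where "\<eta> w = coeff (p w) (Suc 0)" for w
  have "lin \<eta>"
    unfolding linear_on_def \<eta>_def by (simp add: p_add p_scale)
  moreover have "\<eta> (act g (X (Suc j))) = (of_nat a - of_nat j) * \<phi> \<iota> g * \<xi> (act g (X j))"
    if g: "g \<in> G_sub n q" for g j
  proof -
    \<comment> \<open>Beyond \<open>D\<close> the vectors \<open>X k\<close> vanish, so a longer sum
      does no harm and brings the index \<open>Suc j\<close> into range.\<close>
    define M where "M = D + Suc j"
    define \<xi>k where "\<xi>k k = \<xi> (act g (X k))" for k
    define f where "f = \<phi> \<iota> g"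
    have gX: "act g (X k) \<in> V" for k
      using act_simps(1)[OF G_SL[OF g] X(1)] .
    have p0: "coeff (p (act g (X k))) 0 = \<xi>k k" for k
      using p[OF gX, of 0 k] x(2)[OF \<iota>] act_simps(4)[OF gX] unfolding \<xi>k_def by (simp add: poly_0_coeff_0)
    have exp: "act (y s) v = (\<Sum>k\<le>M. sc (s ^ k) (X k))" for s
      unfolding y_expansion by (rule expansion_extend[OF X(2)]) (auto simp: M_def)
    have gexp: "act g (act (y s) v) = (\<Sum>k\<le>M. sc (s ^ k) (act g (X k)))" for s
      unfolding exp by (rule act_sum[OF G_SL[OF g] X(1)])
    \<comment> \<open>The factor \<open>z ^ Suc M\<close> clears the powers of \<open>s / z\<close>.
      Its one power more than \<open>M\<close> makes both sides vanish where \<open>z = 0\<close>, a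
      case that \<open>straighten\<close> does not cover.\<close>
    have poly_id: "[:1, s * f:] ^ Suc M * (\<Sum>k\<le>M. smult (s ^ k) (p (act g (X k))))
        = (\<Sum>k\<le>M. smult (s ^ k * \<xi>k k) ([:1, s * f:] ^ (a + Suc M - k)))" for s
    proof (rule poly_eqI_infinite)
      fix t
      define z where "z = 1 + s * t * f"
      have z: "poly [:1, s * f:] t = z"
        unfolding z_def by (simp add: algebra_simps)
      show "poly ([:1, s * f:] ^ Suc M * (\<Sum>k\<le>M. smult (s ^ k) (p (act g (X k))))) t
        = poly (\<Sum>k\<le>M. smult (s ^ k * \<xi>k k) ([:1, s * f:] ^ (a + Suc M - k))) t"
      proof (cases "z = 0")
        case True
        have "(\<Sum>k\<le>M. s ^ k * \<xi>k k * z ^ (a + Suc M - k)) = 0"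
          by (intro sum.neutral) (auto simp: True)
        then show ?thesis
          unfolding poly_mult poly_power z poly_sum poly_smult by (simp add: True)
      next
        case False
        have "(\<Sum>k\<le>M. s ^ k * poly (p (act g (X k))) t) = \<xi> (act (x \<iota> t) (act g (act (y s) v)))"
          unfolding gexp act_sum[OF xSL gX] p[OF gX, symmetric]
          using act_simps(1)[OF xSL gX] by (subst lin_sum[OF \<xi>]) auto
        also have "\<dots> = \<xi> (sc (z ^ a) (act g (act (y (s / z)) v)))"
          using straighten[OF \<iota> g, of s t] False unfolding z_def f_def by simp
        also have "\<dots> = z ^ a * \<xi> (act g (act (y (s / z)) v))"
          by (rule lin_simps(2)[OF \<xi>]) (use act_simps(1) y_SL v G_SL[OF g] in blast)
        also have "\<xi> (act g (act (y (s / z)) v)) = (\<Sum>k\<le>M. (s / z) ^ k * \<xi>k k)"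
          unfolding gexp lin_sum[OF \<xi> gX] \<xi>k_def ..
        finally have *: "(\<Sum>k\<le>M. s ^ k * poly (p (act g (X k))) t) = z ^ a * (\<Sum>k\<le>M. (s / z) ^ k * \<xi>k k)" .
        have **: "z ^ Suc M * (z ^ a * (\<Sum>k\<le>M. (s / z) ^ k * \<xi>k k)) = (\<Sum>k\<le>M. s ^ k * \<xi>k k * z ^ (a + Suc M - k))"
          unfolding sum_distrib_left
        proof (rule sum.cong[OF refl])
          fix k assume "k \<in> {..M}"
          then have "z ^ (a + Suc M) = z ^ (a + Suc M - k) * z ^ k"
            by (simp add: power_add[symmetric])
          then show "z ^ Suc M * (z ^ a * ((s / z) ^ k * \<xi>k k)) = s ^ k * \<xi>k k * z ^ (a + Suc M - k)"
            using False by (simp add: power_divide power_add field_simps)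
        qed
        show ?thesis
          unfolding poly_mult poly_power z poly_sum poly_smult * by (rule **)
      qed
    qed
    \<comment> \<open>The coefficients of \<open>t\<close> in \<open>poly_id\<close>: the powers of
      \<open>z\<close> contribute \<open>Suc M\<close> on the left and \<open>a + Suc M - k\<close>
      on the right, whose difference is \<open>a - k\<close>. Comparing powers of \<open>s\<close>
      then isolates one level.\<close>
    have "(\<Sum>k\<le>Suc M. s ^ k * (if k \<le> M then \<eta> (act g (X k)) else 0))
        = (\<Sum>k\<le>Suc M. s ^ k * (if k = 0 then 0 else (of_nat a - of_nat (k - 1)) * f * \<xi>k (k - 1)))" for s
    proof -
      define A where "A = (\<Sum>k\<le>M. s ^ k * \<eta> (act g (X k)))"
      have "A + of_nat (Suc M) * (s * f) * (\<Sum>k\<le>M. s ^ k * \<xi>k k)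
          = (\<Sum>k\<le>M. s ^ k * \<xi>k k * (of_nat (a + Suc M - k) * (s * f)))"
        using arg_cong[OF poly_id[of s], of "\<lambda>p. coeff p (Suc 0)"]
        unfolding A_def \<eta>_def coeff_mult_1 coeff_linear_power coeff_sum coeff_smult p0
        by simp
      moreover have "(\<Sum>k\<le>M. s ^ k * \<xi>k k * (of_nat (a + Suc M - k) * (s * f)))
          = (\<Sum>k\<le>M. s ^ Suc k * ((of_nat a - of_nat k) * f * \<xi>k k) + of_nat (Suc M) * (s * f) * (s ^ k * \<xi>k k))"
        by (intro sum.cong refl) (simp add: of_nat_diff algebra_simps)
      ultimately have "A = (\<Sum>k\<le>M. s ^ Suc k * ((of_nat a - of_nat k) * f * \<xi>k k))"
        unfolding sum.distrib sum_distrib_left by (simp del: of_nat_Suc)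
      moreover have "(\<Sum>k\<le>Suc M. s ^ k * (if k \<le> M then \<eta> (act g (X k)) else 0)) = A"
        unfolding A_def by simp
      moreover have "(\<Sum>k\<le>Suc M. s ^ k * (if k = 0 then 0 else (of_nat a - of_nat (k - 1)) * f * \<xi>k (k - 1)))
          = (\<Sum>k\<le>M. s ^ Suc k * ((of_nat a - of_nat k) * f * \<xi>k k))"
        unfolding sum.atMost_Suc_shift by simp
      ultimately show ?thesis by simp
    qed
    from coeff_eq_of_sums_eq[OF this, of "Suc j"] show ?thesis
      unfolding M_def f_def \<xi>k_def by simp
  qed
  ultimately show ?thesis by blast
qed

text \<open>At the identity, for an index with \<open>\<phi> \<iota> (1\<^sub>m n) = 1\<close>,
  \<open>lower_level\<close> turns a linear form that is nonzero on \<open>X k\<close> into one that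
  is nonzero on \<open>X (Suc k)\<close>.\<close>

lemma X_nonzero:
  assumes "\<And>l. l < k \<Longrightarrow> of_nat a - of_nat l \<noteq> (0 :: 'a)"
  shows "X k \<noteq> 0"
  using assms
proof (induction k)
  case (Suc k)
  then have "X k \<noteq> 0" by simp
  then obtain \<xi> where \<xi>: "lin \<xi>" "\<xi> (X k) \<noteq> 0"
    using lin_ext[OF X(1) V_closed(1), of k] lin_zero by metis
  obtain \<iota> where \<iota>: "\<iota> \<in> J" "\<phi> \<iota> (1\<^sub>m n) = 1"
    using J_unit by blast
  from lower_level[OF \<iota>(1) \<xi>(1)] G_sub_one
  obtain \<eta> where "lin \<eta>" "\<eta> (act (1\<^sub>m n) (X (Suc k))) = (of_nat a - of_nat k) * \<phi> \<iota> (1\<^sub>m n) * \<xi> (act (1\<^sub>m n) (X k))"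
    by blast
  then have \<eta>: "lin \<eta>" "\<eta> (X (Suc k)) = (of_nat a - of_nat k) * \<xi> (X k)"
    using \<iota>(2) act_simps(4)[OF X(1)] by auto
  then have "\<eta> (X (Suc k)) \<noteq> 0"
    using \<xi>(2) Suc.prems[of k] by simp
  then show ?case
    using lin_zero[OF \<eta>(1)] by metis
qed (use v X(3) in simp)

abbreviation "Ind k \<equiv> induced_module n (G_sub n q) (B_sub n q) (\<kappa> k)"

definition coef :: "nat \<Rightarrow> ('v \<Rightarrow> 'a) \<Rightarrow> 'a mat \<Rightarrow> 'a" where
  "coef k \<xi> = (\<lambda>g. if g \<in> G_sub n q then \<xi> (act g (X k)) else 0)"

lemma coef_in_Ind:
  assumes \<xi>: "lin \<xi>"
  shows "coef k \<xi> \<in> rspace (Ind k)"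
proof -
  obtain r :: nat and u f where u: "\<And>i. i < r \<Longrightarrow> u i \<in> V" "\<And>i. i < r \<Longrightarrow> regular_on n (carrier (SL n)) (f i)"
    and act: "\<And>g. g \<in> carrier (SL n) \<Longrightarrow> act g (X k) = (\<Sum>i<r. sc (f i g) (u i))"
    using act_rational[OF X(1)[of k]] by blast
  have "regular_on n (carrier (SL n)) (\<lambda>g. \<Sum>i<r. \<xi> (u i) * f i g)"
    using u(2) by (intro regular_on_sum) auto
  moreover have "coef k \<xi> g = (\<Sum>i<r. \<xi> (u i) * f i g)" if "g \<in> G_sub n q" for g
    unfolding coef_def using that act[OF G_SL[OF that]] lin_sum[OF \<xi>, of "{..<r}" u "\<lambda>i. f i g"] u(1)
    by (simp add: mult.commute)
  ultimately have "regular_on n (G_sub n q) (coef k \<xi>)"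
    unfolding regular_on_def using G_SL by metis
  moreover have "coef k \<xi> (g * b) = \<kappa> k (diag_part n b) * coef k \<xi> g"
    if g: "g \<in> G_sub n q" and b: "b \<in> B_sub n q" for g b
  proof -
    have b': "b \<in> G_sub n q" using B_sub_cases[OF b] by blast
    have "act (g * b) (X k) = sc (\<kappa> k (diag_part n b)) (act g (X k))"
      using act_simps(5)[OF G_SL[OF g] G_SL[OF b'] X(1)] B_act[OF b] act_simps(3)[OF G_SL[OF g] X(1)] by simp
    then show ?thesis
      unfolding coef_def using g b' G_sub_mult[OF g b'] act_simps(1)[OF G_SL[OF g] X(1)] by (simp add: lin_simps[OF \<xi>])
  qed
  ultimately show ?thesis
    unfolding induced_module_def by (simp add: coef_def)
qed

text \<open>The space \<open>F\<^sub>k\<close> of the overview.\<close>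

definition coefs :: "nat \<Rightarrow> ('a mat \<Rightarrow> 'a) set" where
  "coefs k = {coef k \<xi> | \<xi>. lin \<xi>}"

lemma coefs_subset: "coefs k \<subseteq> rspace (Ind k)"
  unfolding coefs_def using coef_in_Ind by auto

lemma coefs_add: "f \<in> coefs k \<Longrightarrow> h \<in> coefs k \<Longrightarrow> (\<lambda>g. f g + h g) \<in> coefs k"
  and coefs_scale: "f \<in> coefs k \<Longrightarrow> (\<lambda>g. z * f g) \<in> coefs k"
  and coefs_zero: "(\<lambda>_. 0) \<in> coefs k"
proof -
  show "(\<lambda>g. f g + h g) \<in> coefs k" if "f \<in> coefs k" "h \<in> coefs k"
  proof -
    obtain \<xi> \<eta> where "lin \<xi>" "lin \<eta>" "f = coef k \<xi>" "h = coef k \<eta>"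
      using \<open>f \<in> coefs k\<close> \<open>h \<in> coefs k\<close> unfolding coefs_def by blast
    then show ?thesis
      unfolding coefs_def by (intro CollectI exI[of _ "\<lambda>w. \<xi> w + \<eta> w"])
        (auto simp: coef_def linear_on_def algebra_simps)
  qed
  show "(\<lambda>g. z * f g) \<in> coefs k" if "f \<in> coefs k"
  proof -
    obtain \<xi> where "lin \<xi>" "f = coef k \<xi>"
      using \<open>f \<in> coefs k\<close> unfolding coefs_def by blast
    then show ?thesis
      unfolding coefs_def by (intro CollectI exI[of _ "\<lambda>w. z * \<xi> w"])
        (auto simp: coef_def linear_on_def algebra_simps)
  qed
  show "(\<lambda>_. 0) \<in> coefs k"
    unfolding coefs_def by (intro CollectI exI[of _ "\<lambda>_. 0"]) (auto simp: coef_def linear_on_def)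
qed

text \<open>Dividing by \<open>a - k\<close> turns \<open>lower_level\<close> around: a minor with
  \<open>c\<close> rows times a coefficient of level \<open>k\<close> is a coefficient of level
  \<open>Suc k\<close>, and such products generate.\<close>

lemma coefs_Suc:
  assumes "coefs k = rspace (Ind k)" "of_nat a - of_nat k \<noteq> (0 :: 'a)"
  shows "coefs (Suc k) = rspace (Ind (Suc k))"
proof (rule equalityI[OF coefs_subset], rule subsetI)
  fix f assume f: "f \<in> rspace (Ind (Suc k))"
  show "f \<in> coefs (Suc k)"
  proof (rule induced_generated_by_minors[OF \<kappa> \<kappa> c _ f])
    fix I h assume I: "sorted_wrt (<) I" "set I \<subseteq> {..<N}" "length I = c" and "h \<in> rspace (Ind k)"
    then obtain \<xi> where \<xi>: "lin \<xi>" "h = coef k \<xi>"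
      using assms(1) unfolding coefs_def by blast
    obtain \<iota> z where \<iota>: "\<iota> \<in> J" "\<And>g. g \<in> G_sub n q \<Longrightarrow> minor I 0 (blk d g) = z * \<phi> \<iota> g"
      using minors[OF I] by blast
    obtain \<eta> where \<eta>: "lin \<eta>" "\<And>g j. g \<in> G_sub n q \<Longrightarrow>
        \<eta> (act g (X (Suc j))) = (of_nat a - of_nat j) * \<phi> \<iota> g * \<xi> (act g (X j))"
      using lower_level[OF \<iota>(1) \<xi>(1)] by blast
    have "(\<lambda>g. minor I 0 (blk d g) * h g) = (\<lambda>g. z / (of_nat a - of_nat k) * coef (Suc k) \<eta> g)"
      unfolding \<xi>(2) coef_def using \<iota>(2) \<eta>(2) assms(2) by (auto simp: fun_eq_iff)
    moreover have "coef (Suc k) \<eta> \<in> coefs (Suc k)"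
      unfolding coefs_def using \<eta>(1) by blast
    ultimately show "(\<lambda>g. minor I 0 (blk d g) * h g) \<in> coefs (Suc k)"
      by (simp only: coefs_scale)
  qed (use \<beta> in \<open>auto intro: coefs_zero coefs_add\<close>)
qed

end

section \<open>Duality between generated submodules and matrix coefficients\<close>

lemma poly_fun_mult_left:
  assumes "P \<in> poly_fun n" "A \<in> carrier_mat n n"
  shows "\<exists>Q\<in>poly_fun n. \<forall>g\<in>carrier_mat n n. P (A * g) = Q g"
  using assms(1)
proof (induction rule: poly_fun.induct)
  case (const c)
  show ?case by (intro bexI[of _ "\<lambda>_. c"] poly_fun.const) simp
next
  case (entry i j)
  have "(\<lambda>g. \<Sum>u<n. A $$ (i, u) * g $$ (u, j)) \<in> poly_fun n"
    using entry by (intro poly_fun_sum poly_fun.mult poly_fun.const poly_fun.entry) auto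
  moreover have "\<forall>g\<in>carrier_mat n n. (A * g) $$ (i, j) = (\<Sum>u<n. A $$ (i, u) * g $$ (u, j))"
    using entry by (intro ballI index_mult_mat_sum[OF assms(2)]) auto
  ultimately show ?case by (intro bexI[of _ "\<lambda>g. \<Sum>u<n. A $$ (i, u) * g $$ (u, j)"])
next
  case (add f g)
  then obtain F G where "F \<in> poly_fun n" "\<forall>g\<in>carrier_mat n n. f (A * g) = F g"
    "G \<in> poly_fun n" "\<forall>h\<in>carrier_mat n n. g (A * h) = G h" by blast
  then show ?case by (intro bexI[of _ "\<lambda>h. F h + G h"] poly_fun.add) auto
next
  case (mult f g)
  then obtain F G where "F \<in> poly_fun n" "\<forall>g\<in>carrier_mat n n. f (A * g) = F g"
    "G \<in> poly_fun n" "\<forall>h\<in>carrier_mat n n. g (A * h) = G h" by blast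
  then show ?case by (intro bexI[of _ "\<lambda>h. F h * G h"] poly_fun.mult) auto
qed

context level_module
begin

lemma Ind_act:
  assumes f: "f \<in> rspace (Ind k)" and h: "h \<in> G_sub n q"
  shows "ract (Ind k) h f \<in> rspace (Ind k)"
proof -
  let ?i = "inv\<^bsub>SL n\<^esub> h"
  have i: "?i \<in> G_sub n q" by (rule G_sub_inv[OF h])
  then have ic: "?i \<in> carrier_mat n n" using G_sub_SL by blast
  obtain P where P: "P \<in> poly_fun n" "\<forall>g\<in>G_sub n q. f g = P g"
    using f unfolding induced_module_def regular_on_def by auto
  obtain Q where Q: "Q \<in> poly_fun n" "\<forall>g\<in>carrier_mat n n. P (?i * g) = Q g"
    using poly_fun_mult_left[OF P(1) ic] by blast
  have "regular_on n (G_sub n q) (ract (Ind k) h f)"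
    unfolding regular_on_def induced_module_def
    using P(2) Q i G_sub_mult[OF i] G_sub_SL by (intro bexI[OF _ Q(1)]) auto
  moreover have "ract (Ind k) h f (g * b) = \<kappa> k (diag_part n b) * ract (Ind k) h f g"
    if g: "g \<in> G_sub n q" and b: "b \<in> B_sub n q" for g b
  proof -
    have b': "b \<in> G_sub n q" using B_sub_cases[OF b] by blast
    have "?i * (g * b) = ?i * g * b"
      using ic G_sub_SL[OF g] G_sub_SL[OF b'] by (intro assoc_mult_mat[symmetric]) auto
    moreover have "f (?i * g * b) = \<kappa> k (diag_part n b) * f (?i * g)"
      using f G_sub_mult[OF i g] b unfolding induced_module_def by simp
    ultimately show ?thesis
      using g G_sub_mult[OF g b'] unfolding induced_module_def by simp
  qed
  ultimately show ?thesis
    unfolding induced_module_def by simp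
qed

lemma Ind_act_coef:
  assumes \<xi>: "lin \<xi>" and h: "h \<in> G_sub n q"
  shows "ract (Ind k) h (coef k \<xi>) = coef k (\<lambda>w. \<xi> (act (inv\<^bsub>SL n\<^esub> h) w))"
proof
  fix g
  let ?i = "inv\<^bsub>SL n\<^esub> h"
  have i: "?i \<in> G_sub n q" by (rule G_sub_inv[OF h])
  show "ract (Ind k) h (coef k \<xi>) g = coef k (\<lambda>w. \<xi> (act ?i w)) g"
  proof (cases "g \<in> G_sub n q")
    case True
    then show ?thesis
      using G_sub_mult[OF i True] act_simps(5)[OF G_SL[OF i] G_SL[OF True] X(1)]
      unfolding induced_module_def coef_def by simp
  qed (simp add: induced_module_def coef_def)
qed

lemma Ind_rscale: "rscale (Ind k) = (\<lambda>c f g. c * f g)"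
  unfolding induced_module_def by simp

lemma Ind_add: "f \<in> rspace (Ind k) \<Longrightarrow> h \<in> rspace (Ind k) \<Longrightarrow> f + h \<in> rspace (Ind k)"
  and Ind_scale: "f \<in> rspace (Ind k) \<Longrightarrow> (\<lambda>g. z * f g) \<in> rspace (Ind k)"
proof -
  show "f + h \<in> rspace (Ind k)" if "f \<in> rspace (Ind k)" "h \<in> rspace (Ind k)"
  proof -
    have "regular_on n (G_sub n q) f" "regular_on n (G_sub n q) h"
      using that unfolding induced_module_def by auto
    then obtain P Q where "P \<in> poly_fun n" "\<forall>g\<in>G_sub n q. f g = P g" "Q \<in> poly_fun n" "\<forall>g\<in>G_sub n q. h g = Q g"
      unfolding regular_on_def by blast
    then have "regular_on n (G_sub n q) (f + h)"
      unfolding regular_on_def by (intro bexI[of _ "\<lambda>g. P g + Q g"] poly_fun.add) auto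
    then show ?thesis
      using that unfolding induced_module_def by (simp add: algebra_simps)
  qed
  show "(\<lambda>g. z * f g) \<in> rspace (Ind k)" if "f \<in> rspace (Ind k)"
  proof -
    have "regular_on n (G_sub n q) f"
      using that unfolding induced_module_def by auto
    then obtain P where "P \<in> poly_fun n" "\<forall>g\<in>G_sub n q. f g = P g"
      unfolding regular_on_def by blast
    then have "regular_on n (G_sub n q) (\<lambda>g. z * f g)"
      unfolding regular_on_def by (intro bexI[of _ "\<lambda>g. z * P g"] poly_fun.mult poly_fun.const) auto
    then show ?thesis
      using that unfolding induced_module_def by simp
  qed
qed

abbreviation "Weyl k \<equiv> weyl_module n (G_sub n q) (B_sub n q) (\<kappa> k)"

lemma Weyl_rspace: "\<theta> \<in> rspace (Weyl k) \<longleftrightarrow> (\<forall>f. f \<notin> rspace (Ind k) \<longrightarrow> \<theta> f = 0) \<and>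
    (\<forall>f\<in>rspace (Ind k). \<forall>h\<in>rspace (Ind k). \<theta> (f + h) = \<theta> f + \<theta> h) \<and>
    (\<forall>z. \<forall>f\<in>rspace (Ind k). \<theta> (\<lambda>g. z * f g) = z * \<theta> f)"
  unfolding weyl_module_def dual_module_def by (simp add: Ind_rscale)

lemma Weyl_ract: "ract (Weyl k) h \<theta> f = (if f \<in> rspace (Ind k) then \<theta> (ract (Ind k) (inv\<^bsub>SL n\<^esub> h) f) else 0)"
  unfolding weyl_module_def dual_module_def by simp

lemma Weyl_rscale: "rscale (Weyl k) = (\<lambda>z \<theta> f. z * \<theta> f)"
  unfolding weyl_module_def dual_module_def by simp

lemma Weyl_act:
  assumes \<theta>: "\<theta> \<in> rspace (Weyl k)" and h: "h \<in> G_sub n q"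
  shows "ract (Weyl k) h \<theta> \<in> rspace (Weyl k)"
proof -
  let ?i = "inv\<^bsub>SL n\<^esub> h"
  have ind: "ract (Ind k) ?i f \<in> rspace (Ind k)" if "f \<in> rspace (Ind k)" for f
    by (rule Ind_act[OF that G_sub_inv[OF h]])
  have "ract (Ind k) ?i (f + f') = ract (Ind k) ?i f + ract (Ind k) ?i f'" for f f'
    unfolding induced_module_def by auto
  moreover have "ract (Ind k) ?i (\<lambda>g. z * f g) = (\<lambda>g. z * ract (Ind k) ?i f g)" for z f
    unfolding induced_module_def by auto
  ultimately show ?thesis
    using \<theta> ind Ind_add Ind_scale unfolding Weyl_rspace Weyl_ract by simp
qed

text \<open>The annihilator \<open>A\<close> of \<open>coefs k\<close> is a submodule of the Weyl
  module. It is not everything, since evaluation at the identity does not kill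
  \<open>coef k \<xi>\<close> when \<open>\<xi> (X k)\<close> is nonzero. If it is zero, nothing
  lies outside \<open>coefs k\<close>, because a linear form separating such a function would belong
  to \<open>A\<close>.\<close>

lemma coefs_eq_Ind_of_simple:
  assumes simple: "simple_module (G_sub n q) (Weyl k)" and "X k \<noteq> 0"
  shows "coefs k = rspace (Ind k)"
proof (rule ccontr)
  assume "coefs k \<noteq> rspace (Ind k)"
  then obtain f where f: "f \<in> rspace (Ind k)" "f \<notin> coefs k"
    using coefs_subset by blast
  interpret fs: vector_space "\<lambda>c (\<phi> :: 'a mat \<Rightarrow> 'a) w. c * \<phi> w"
    by (rule vector_space_funs)
  interpret ds: vector_space "\<lambda>c (\<phi> :: ('a mat \<Rightarrow> 'a) \<Rightarrow> 'a) w. c * \<phi> w"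
    by (rule vector_space_funs)
  define A where "A = {\<theta> \<in> rspace (Weyl k). \<forall>f\<in>coefs k. \<theta> f = 0}"
  have "ds.subspace A"
    unfolding ds.subspace_def A_def Weyl_rspace by (auto simp: algebra_simps)
  moreover have "ract (Weyl k) h \<theta> \<in> A" if \<theta>: "\<theta> \<in> A" and h: "h \<in> G_sub n q" for h \<theta>
  proof -
    have "\<theta> (ract (Ind k) (inv\<^bsub>SL n\<^esub> h) f) = 0" if f: "f \<in> coefs k" for f
    proof -
      obtain \<xi> where "lin \<xi>" "f = coef k \<xi>"
        using f unfolding coefs_def by blast
      then have "ract (Ind k) (inv\<^bsub>SL n\<^esub> h) f \<in> coefs k"
        using Ind_act_coef[OF _ G_sub_inv[OF h]] lin_act G_SL[OF G_sub_inv[OF G_sub_inv[OF h]]]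
        unfolding coefs_def by blast
      then show ?thesis using \<theta> unfolding A_def by blast
    qed
    then show ?thesis
      using \<theta> h Weyl_act unfolding A_def by (auto simp: Weyl_ract)
  qed
  ultimately have "submodule (G_sub n q) (Weyl k) A"
    unfolding submodule_def Weyl_rscale by (auto simp: A_def)
  then have "A = {0} \<or> A = rspace (Weyl k)"
    using simple unfolding simple_module_def by blast
  then show False
  proof
    assume A0: "A = {0}"
    have "fs.subspace (coefs k)"
      unfolding fs.subspace_def
      using coefs_zero coefs_add coefs_scale by (auto simp: zero_fun_def plus_fun_def)
    then obtain \<zeta> where \<zeta>: "\<forall>V. linear_on (\<lambda>c \<phi> w. c * \<phi> w) V \<zeta>" "\<zeta> f = 1" "\<forall>u\<in>coefs k. \<zeta> u = 0"
      using functional_separating_subspace[OF fs.vector_space_axioms _ f(2)] by blast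
    then have "(\<lambda>f. if f \<in> rspace (Ind k) then \<zeta> f else 0) \<in> rspace (Weyl k)"
      using Ind_add Ind_scale unfolding Weyl_rspace linear_on_def by simp
    then have "(\<lambda>f. if f \<in> rspace (Ind k) then \<zeta> f else 0) \<in> A"
      unfolding A_def using \<zeta>(3) by auto
    then have "(\<lambda>f. if f \<in> rspace (Ind k) then \<zeta> f else 0) = (\<lambda>_. 0)"
      unfolding A0 by (simp add: zero_fun_def)
    then have "\<zeta> f = 0"
      using f(1) by (metis (no_types, lifting))
    then show False using \<zeta>(2) by simp
  next
    assume A1: "A = rspace (Weyl k)"
    obtain \<xi> where \<xi>: "lin \<xi>" "\<xi> (X k) \<noteq> 0"
      using lin_ext[OF X(1) V_closed(1), of k] lin_zero assms(2) by metis
    define \<theta> where "\<theta> f = (if f \<in> rspace (Ind k) then f (1\<^sub>m n) else 0)" for f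
    have "\<theta> \<in> A"
      unfolding A1 Weyl_rspace \<theta>_def using Ind_add Ind_scale by simp
    moreover have "coef k \<xi> \<in> coefs k" "coef k \<xi> \<in> rspace (Ind k)"
      using \<xi>(1) coef_in_Ind unfolding coefs_def by blast+
    ultimately have "coef k \<xi> (1\<^sub>m n) = 0"
      unfolding A_def \<theta>_def by auto
    moreover have "(1\<^sub>m n :: 'a mat) \<in> G_sub n q" by (rule G_sub_one)
    ultimately show False
      using \<xi>(2) act_simps(4)[OF X(1)[of k]] unfolding coef_def by simp
  qed
qed

definition M :: "nat \<Rightarrow> 'v set" where
  "M k = submodule (G_sub n q) L hull {X k}"

lemma submodule_V: "submodule (G_sub n q) L V"
  unfolding submodule_def using subspace_V act_simps(1) G_SL by blast

lemma submodule_M: "submodule (G_sub n q) L (M k)"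
proof -
  let ?S = "{T. submodule (G_sub n q) L T \<and> {X k} \<subseteq> T}"
  have "V \<in> ?S" using submodule_V X(1) by simp
  then have "\<Inter>?S \<subseteq> V" by blast
  moreover have "vs.subspace (\<Inter>?S)"
    by (rule vs.subspace_Inter) (auto simp: submodule_def)
  moreover have "act g w \<in> \<Inter>?S" if "g \<in> G_sub n q" "w \<in> \<Inter>?S" for g w
    using that unfolding submodule_def by blast
  ultimately show ?thesis
    unfolding M_def hull_def by (subst submodule_def) blast
qed

lemma M_minimal: "submodule (G_sub n q) L W \<Longrightarrow> X k \<in> W \<Longrightarrow> M k \<subseteq> W"
  unfolding M_def by (intro hull_minimal) auto

lemma X_in_M: "X k \<in> M k"
  unfolding M_def using hull_subset[of "{X k}"] by auto

lemma M_V: "w \<in> M k \<Longrightarrow> w \<in> V"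
  using submodule_M[of k] unfolding submodule_def by blast

lemma M_closed:
  "w \<in> M k \<Longrightarrow> g \<in> G_sub n q \<Longrightarrow> act g w \<in> M k" "vs.subspace (M k)"
  using submodule_M[of k] unfolding submodule_def by blast+

text \<open>This is the largest submodule inside \<open>W\<close>. It shows that \<open>M k\<close>
  lies in every subspace that contains the orbit of \<open>X k\<close>.\<close>

lemma submodule_orbit_in:
  assumes "vs.subspace W"
  shows "submodule (G_sub n q) L {w \<in> V. \<forall>g\<in>G_sub n q. act g w \<in> W}"
  unfolding submodule_def
proof (intro conjI ballI)
  show "vs.subspace {w \<in> V. \<forall>g\<in>G_sub n q. act g w \<in> W}"
    unfolding vs.subspace_def
    using assms by (auto simp: act_simps(2,3)[OF G_SL] act_zero[OF G_SL] vs.subspace_0 vs.subspace_add vs.subspace_scale)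
  fix g :: "'a mat" and w assume g: "g \<in> G_sub n q" and w: "w \<in> {w \<in> V. \<forall>g\<in>G_sub n q. act g w \<in> W}"
  then show "act g w \<in> {w \<in> V. \<forall>g\<in>G_sub n q. act g w \<in> W}"
    using G_sub_mult[OF _ g] act_simps(1)[OF G_SL[OF g]]
    by (auto simp: act_simps(5)[OF G_SL G_SL[OF g], symmetric])
qed auto

lemma M_in_subspace:
  assumes "vs.subspace W" "\<And>g. g \<in> G_sub n q \<Longrightarrow> act g (X k) \<in> W" "w \<in> M k"
  shows "w \<in> W"
proof -
  have "M k \<subseteq> {w \<in> V. \<forall>g\<in>G_sub n q. act g w \<in> W}"
    using assms(2) X(1) by (intro M_minimal submodule_orbit_in[OF assms(1)]) auto
  then have "act (1\<^sub>m n) w \<in> W"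
    using assms(3) G_sub_one by blast
  then show ?thesis
    using act_simps(4)[OF M_V[OF assms(3)]] by simp
qed

text \<open>\<open>M k\<close> is spanned by the orbit of \<open>X k\<close>. Hence
  \<open>coefs k\<close> is the space of restrictions to \<open>M k\<close> of linear forms.\<close>

lemma coef_eq_iff:
  assumes "lin \<xi>" "lin \<xi>'"
  shows "coef k \<xi> = coef k \<xi>' \<longleftrightarrow> (\<forall>w\<in>M k. \<xi> w = \<xi>' w)"
proof
  assume eq: "coef k \<xi> = coef k \<xi>'"
  have "vs.subspace {w \<in> V. \<xi> w = \<xi>' w}"
    unfolding vs.subspace_def
    by (auto simp: lin_simps[OF assms(1)] lin_simps[OF assms(2)] lin_zero[OF assms(1)] lin_zero[OF assms(2)])
  moreover have "act g (X k) \<in> {w \<in> V. \<xi> w = \<xi>' w}" if "g \<in> G_sub n q" for g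
    using fun_cong[OF eq, of g] that act_simps(1)[OF G_SL[OF that] X(1)] unfolding coef_def by simp
  ultimately show "\<forall>w\<in>M k. \<xi> w = \<xi>' w"
    using M_in_subspace[of "{w \<in> V. \<xi> w = \<xi>' w}" k] by blast
next
  assume "\<forall>w\<in>M k. \<xi> w = \<xi>' w"
  then show "coef k \<xi> = coef k \<xi>'"
    unfolding coef_def using M_closed(1)[OF X_in_M] by auto
qed

text \<open>Rationality puts the whole orbit of \<open>X k\<close> into the span of finitely many
  vectors.\<close>

lemma M_finite_basis: "\<exists>B. finite B \<and> B \<subseteq> M k \<and> \<not> vs.dependent B \<and> M k \<subseteq> vs.span B"
proof -
  obtain r :: nat and u f where
    act: "\<And>g. g \<in> carrier (SL n) \<Longrightarrow> act g (X k) = (\<Sum>i<r. sc (f i g) (u i))"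
    using act_rational[OF X(1)[of k]] by blast
  have "w \<in> vs.span (u ` {..<r})" if "w \<in> M k" for w
  proof (rule M_in_subspace[OF vs.subspace_span _ that])
    fix g :: "'a mat" assume "g \<in> G_sub n q"
    then show "act g (X k) \<in> vs.span (u ` {..<r})"
      unfolding act[OF G_SL[OF \<open>g \<in> G_sub n q\<close>]]
      by (intro vs.span_sum vs.span_scale vs.span_base) auto
  qed
  moreover obtain B where "B \<subseteq> M k" "\<not> vs.dependent B" "M k \<subseteq> vs.span B"
    using vs.basis_exists[of "M k"] by metis
  ultimately show ?thesis
    using vs.independent_span_bound[of "u ` {..<r}" B] by blast
qed

lemma Weyl_sum:
  assumes \<theta>: "\<theta> \<in> rspace (Weyl k)" and "finite A" "\<And>b. b \<in> A \<Longrightarrow> F b \<in> rspace (Ind k)"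
  shows "(\<lambda>g. \<Sum>b\<in>A. z b * F b g) \<in> rspace (Ind k) \<and> \<theta> (\<lambda>g. \<Sum>b\<in>A. z b * F b g) = (\<Sum>b\<in>A. z b * \<theta> (F b))"
  using assms(2,3)
proof (induction rule: finite_induct)
  case empty
  have "(\<lambda>_. 0) \<in> rspace (Ind k)"
    using coefs_zero coefs_subset by blast
  moreover have "\<theta> (\<lambda>g. z * f g) = z * \<theta> f" if "f \<in> rspace (Ind k)" for z f
    using \<theta> that unfolding Weyl_rspace by blast
  from this[OF \<open>(\<lambda>_. 0) \<in> _\<close>, of 0] have "\<theta> (\<lambda>_. 0) = 0" by simp
  ultimately show ?case by simp
next
  case (insert b A)
  have b: "(\<lambda>g. z b * F b g) \<in> rspace (Ind k)" "\<theta> (\<lambda>g. z b * F b g) = z b * \<theta> (F b)"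
    using insert Ind_scale \<theta> unfolding Weyl_rspace by auto
  have eq: "(\<lambda>g. \<Sum>b\<in>insert b A. z b * F b g) = (\<lambda>g. z b * F b g) + (\<lambda>g. \<Sum>b\<in>A. z b * F b g)"
    using insert by (auto simp: fun_eq_iff)
  show ?case
    unfolding eq using insert b Ind_add \<theta> unfolding Weyl_rspace by simp
qed

text \<open>By \<open>coef_eq_iff\<close> the space \<open>coefs k\<close> is the dual of
  \<open>M k\<close>. If it is all of \<open>Ind k\<close>, then \<open>Weyl k\<close> is the bidual
  of \<open>M k\<close>, and \<open>\<Phi>\<close> is the evaluation map, bijective in finite
  dimension.\<close>

theorem generated_isomorphic_Weyl:
  assumes all: "coefs k = rspace (Ind k)"
  shows "module_isomorphic (G_sub n q) (generated_submodule (G_sub n q) L (X k)) (Weyl k)"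
proof -
  have "\<forall>f\<in>rspace (Ind k). \<exists>\<xi>. lin \<xi> \<and> coef k \<xi> = f"
    unfolding all[symmetric] coefs_def by blast
  \<comment> \<open>The choice of the linear form representing \<open>f\<close> does not matter on
    \<open>M k\<close>.\<close>
  then obtain fn where fn: "\<And>f. f \<in> rspace (Ind k) \<Longrightarrow> lin (fn f) \<and> coef k (fn f) = f"
    by metis
  define \<Phi> where "\<Phi> w f = (if f \<in> rspace (Ind k) then fn f w else 0)" for w f
  have \<Phi>: "\<Phi> w (coef k \<xi>) = \<xi> w" if "w \<in> M k" "lin \<xi>" for w \<xi>
    using coef_eq_iff[of "fn (coef k \<xi>)" \<xi> k] fn[OF coef_in_Ind[OF that(2)]] that coef_in_Ind[OF that(2)]
    unfolding \<Phi>_def by simp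
  have \<Phi>_Weyl: "\<Phi> w \<in> rspace (Weyl k)" if w: "w \<in> M k" for w
  proof -
    have "\<Phi> w (f + h) = \<Phi> w f + \<Phi> w h" if "f \<in> rspace (Ind k)" "h \<in> rspace (Ind k)" for f h
    proof -
      have "lin (\<lambda>u. fn f u + fn h u)"
        using fn that unfolding linear_on_def by (simp add: algebra_simps)
      moreover have "coef k (\<lambda>u. fn f u + fn h u) = f + h"
      proof
        fix g
        show "coef k (\<lambda>u. fn f u + fn h u) g = (f + h) g"
          using fun_cong[OF conjunct2[OF fn[OF that(1)]], of g] fun_cong[OF conjunct2[OF fn[OF that(2)]], of g]
          unfolding coef_def by (auto split: if_splits)
      qed
      ultimately have "\<Phi> w (f + h) = fn f w + fn h w"
        using \<Phi>[OF w] by metis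
      then show ?thesis using that unfolding \<Phi>_def by simp
    qed
    moreover have "\<Phi> w (\<lambda>g. z * f g) = z * \<Phi> w f" if "f \<in> rspace (Ind k)" for f z
    proof -
      have "lin (\<lambda>u. z * fn f u)"
        using fn that unfolding linear_on_def by (simp add: algebra_simps)
      moreover have "coef k (\<lambda>u. z * fn f u) = (\<lambda>g. z * f g)"
      proof
        fix g
        show "coef k (\<lambda>u. z * fn f u) g = z * f g"
          using fun_cong[OF conjunct2[OF fn[OF that]], of g]
          unfolding coef_def by (auto split: if_splits)
      qed
      ultimately have "\<Phi> w (\<lambda>g. z * f g) = z * fn f w"
        using \<Phi>[OF w] by metis
      then show ?thesis using that unfolding \<Phi>_def by simp
    qed
    ultimately show ?thesis
      unfolding Weyl_rspace by (auto simp: \<Phi>_def)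
  qed
  have "inj_on \<Phi> (M k)"
  proof (rule inj_onI)
    fix w w' assume w: "w \<in> M k" "w' \<in> M k" and eq: "\<Phi> w = \<Phi> w'"
    show "w = w'"
      using \<Phi>[OF w(1)] \<Phi>[OF w(2)] eq by (intro lin_ext M_V[OF w(1)] M_V[OF w(2)]) metis
  qed
  moreover have "\<exists>w\<in>M k. \<Phi> w = \<theta>" if \<theta>: "\<theta> \<in> rspace (Weyl k)" for \<theta>
  proof -
    obtain B where B: "finite B" "B \<subseteq> M k" "\<not> vs.dependent B" "M k \<subseteq> vs.span B"
      using M_finite_basis by blast
    have "\<exists>\<xi>. lin \<xi> \<and> (\<forall>x\<in>B. \<xi> x = (if x = b then 1 else 0))" for b
      using exists_functional[OF vs.vector_space_axioms B(3), of "\<lambda>x. if x = b then 1 else 0"] by blast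
    then obtain \<xi> where \<xi>: "\<And>b. lin (\<xi> b)" "\<And>b x. x \<in> B \<Longrightarrow> \<xi> b x = (if x = b then 1 else 0)"
      by metis
    \<comment> \<open>The coordinates of the preimage are the values of \<open>\<theta>\<close> on
      the functions of the dual basis.\<close>
    define w where "w = (\<Sum>b\<in>B. sc (\<theta> (coef k (\<xi> b))) b)"
    have "w \<in> M k"
      unfolding w_def using B(2) M_closed(2)
      by (intro vs.subspace_sum vs.subspace_scale) auto
    moreover have "\<Phi> w f = \<theta> f" for f
    proof (cases "f \<in> rspace (Ind k)")
      case True
      define \<zeta> where "\<zeta> = fn f"
      have \<zeta>: "lin \<zeta>" "coef k \<zeta> = f"
        using fn[OF True] unfolding \<zeta>_def by auto
      have lin': "lin (\<lambda>u. \<Sum>b\<in>B. \<zeta> b * \<xi> b u)"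
        unfolding linear_on_def
        by (auto simp: lin_simps[OF \<xi>(1)] distrib_left sum.distrib sum_distrib_left ac_simps)
      have "vs.subspace {u \<in> V. \<zeta> u = (\<Sum>b\<in>B. \<zeta> b * \<xi> b u)}"
        unfolding vs.subspace_def
        using lin_zero[OF \<zeta>(1)] lin_zero[OF lin'] lin_simps[OF \<zeta>(1)] lin_simps[OF lin'] by auto
      moreover have "B \<subseteq> {u \<in> V. \<zeta> u = (\<Sum>b\<in>B. \<zeta> b * \<xi> b u)}"
      proof
        fix u assume u: "u \<in> B"
        have "(\<Sum>b\<in>B. \<zeta> b * \<xi> b u) = (\<Sum>b\<in>B. if b = u then \<zeta> b else 0)"
          using u by (intro sum.cong) (auto simp: \<xi>(2))
        then show "u \<in> {u \<in> V. \<zeta> u = (\<Sum>b\<in>B. \<zeta> b * \<xi> b u)}"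
          using u B(1,2) M_V by auto
      qed
      ultimately have "vs.span B \<subseteq> {u \<in> V. \<zeta> u = (\<Sum>b\<in>B. \<zeta> b * \<xi> b u)}"
        by (rule vs.span_minimal[rotated])
      then have "coef k \<zeta> = coef k (\<lambda>u. \<Sum>b\<in>B. \<zeta> b * \<xi> b u)"
        using B(4) coef_eq_iff[OF \<zeta>(1) lin', of k] by blast
      also have "\<dots> = (\<lambda>g. \<Sum>b\<in>B. \<zeta> b * coef k (\<xi> b) g)"
        by (auto simp: coef_def fun_eq_iff)
      finally have "\<theta> f = (\<Sum>b\<in>B. \<zeta> b * \<theta> (coef k (\<xi> b)))"
        using Weyl_sum[OF \<theta> B(1), of "\<lambda>b. coef k (\<xi> b)" \<zeta>] coef_in_Ind \<xi>(1) \<zeta>(2) by simp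
      moreover have "\<Phi> w f = \<zeta> w"
        unfolding \<Phi>_def \<zeta>_def using True by simp
      moreover have "\<zeta> w = (\<Sum>b\<in>B. \<theta> (coef k (\<xi> b)) * \<zeta> b)"
        unfolding w_def using B(2) M_V by (intro lin_sum[OF \<zeta>(1)]) auto
      ultimately show ?thesis by (simp add: mult.commute)
    next
      case False
      then show ?thesis using \<theta> unfolding \<Phi>_def Weyl_rspace by simp
    qed
    ultimately show ?thesis by blast
  qed
  ultimately have "bij_betw \<Phi> (M k) (rspace (Weyl k))"
    unfolding bij_betw_def using \<Phi>_Weyl by blast
  moreover have "\<Phi> (w + w') = \<Phi> w + \<Phi> w'" if "w \<in> M k" "w' \<in> M k" for w w'
    using that fn M_V by (auto simp: \<Phi>_def fun_eq_iff lin_simps)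
  moreover have "\<Phi> (sc z w) = rscale (Weyl k) z (\<Phi> w)" if "w \<in> M k" for z w
    using that fn M_V by (auto simp: \<Phi>_def fun_eq_iff lin_simps Weyl_rscale)
  moreover have "\<Phi> (act g w) = ract (Weyl k) g (\<Phi> w)" if g: "g \<in> G_sub n q" and w: "w \<in> M k" for g w
  proof
    fix f
    show "\<Phi> (act g w) f = ract (Weyl k) g (\<Phi> w) f"
    proof (cases "f \<in> rspace (Ind k)")
      case True
      have inv: "inv\<^bsub>SL n\<^esub> (inv\<^bsub>SL n\<^esub> g) = g"
        using SL.inv_inv[OF G_SL[OF g]] .
      have "ract (Ind k) (inv\<^bsub>SL n\<^esub> g) f = coef k (\<lambda>u. fn f (act g u))"
        using Ind_act_coef[of "fn f" "inv\<^bsub>SL n\<^esub> g" k] fn[OF True] G_sub_inv[OF g] inv by simp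
      then have "\<Phi> w (ract (Ind k) (inv\<^bsub>SL n\<^esub> g) f) = fn f (act g w)"
        using \<Phi>[OF w] lin_act[OF conjunct1[OF fn[OF True]] G_SL[OF g]] by simp
      then show ?thesis
        using True unfolding Weyl_ract by (simp add: \<Phi>_def)
    qed (simp add: \<Phi>_def Weyl_ract)
  qed
  ultimately show ?thesis
    unfolding module_isomorphic_def generated_submodule_def M_def[symmetric]
    by (intro exI[of _ \<Phi>]) simp
qed

theorem generated_isomorphic_Weyl_of_simple:
  assumes nz: "\<And>l. l < k \<Longrightarrow> of_nat a - of_nat l \<noteq> (0 :: 'a)"
    and m: "m \<le> k" "simple_module (G_sub n q) (Weyl m)"
  shows "module_isomorphic (G_sub n q) (generated_submodule (G_sub n q) L (X k)) (Weyl k)"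
proof (rule generated_isomorphic_Weyl)
  have "coefs m = rspace (Ind m)"
    using nz m by (intro coefs_eq_Ind_of_simple X_nonzero) auto
  then have "coefs (m + j) = rspace (Ind (m + j))" if "m + j \<le> k" for j
    using that
  proof (induction j)
    case (Suc j)
    then show ?case using coefs_Suc[of "m + j"] nz[of "m + j"] by simp
  qed simp
  from this[of "k - m"] m(1) show "coefs k = rspace (Ind k)" by simp
qed

end


section \<open>Vectors of highest weight\<close>

lemma monom_eq_one_infinite:
  fixes e :: nat
  assumes "\<And>z :: 'a::{field,infinite}. z \<noteq> 0 \<Longrightarrow> z ^ e = 1"
  shows "e = 0"
proof -
  have "monom (1 :: 'a) e = 1"
    by (rule poly_eqI_infinite_nz) (use assms in \<open>simp add: poly_monom\<close>)
  then have "coeff (monom (1 :: 'a) e) e = coeff 1 e" by simp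
  then show ?thesis by (simp split: if_splits)
qed

lemma powi_exponent_unique:
  assumes "\<And>z :: 'a::{field,infinite}. z \<noteq> 0 \<Longrightarrow> z powi i = z powi j"
  shows "i = j"
proof -
  have *: "i = j" if "i \<le> j" "\<And>z :: 'a. z \<noteq> 0 \<Longrightarrow> z powi i = z powi j" for i j
  proof -
    have "z ^ nat (j - i) = 1" if "z \<noteq> 0" for z :: 'a
    proof -
      have "z powi (j - i) = 1"
        using \<open>z \<noteq> 0\<close> \<open>\<And>z. z \<noteq> 0 \<Longrightarrow> z powi i = z powi j\<close>[of z] by (simp add: power_int_diff)
      then show ?thesis using \<open>i \<le> j\<close> by (simp add: power_int_def)
    qed
    then show ?thesis using monom_eq_one_infinite[where 'a = 'a, of "nat (j - i)"] that(1) by simp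
  qed
  show ?thesis
    using *[of i j] *[of j i] assms by (cases "i \<le> j") auto
qed

lemma poly_fun_power: "P \<in> poly_fun n \<Longrightarrow> (\<lambda>g. P g ^ k) \<in> poly_fun n"
  by (induction k) (auto intro: poly_fun.intros)

lemma poly_fun_prod: "(\<And>i. i \<in> A \<Longrightarrow> f i \<in> poly_fun n) \<Longrightarrow> (\<lambda>g. \<Prod>i\<in>A. f i g) \<in> poly_fun n"
  by (induction A rule: infinite_finite_induct) (auto intro: poly_fun.intros)

lemma torus_simps:
  assumes "s \<in> torus n"
  shows "s \<in> carrier_mat n n" "s \<in> carrier (SL n)" "r < n \<Longrightarrow> c < n \<Longrightarrow> r \<noteq> c \<Longrightarrow> s $$ (r, c) = 0"
    "(\<Prod>r<n. s $$ (r, r)) = (1 :: 'a::field)" "r < n \<Longrightarrow> s $$ (r, r) \<noteq> 0"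
proof -
  show s: "s \<in> carrier_mat n n" "s \<in> carrier (SL n)"
    using assms unfolding torus_def by auto
  show off: "s $$ (r, c) = 0" if "r < n" "c < n" "r \<noteq> c" for r c
    using assms that unfolding torus_def diagonal_mat_def by auto
  have "det s = (\<Prod>r<n. s $$ (r, r))"
    by (rule det_upper_triangular_prod[OF s(1)]) (use s off in \<open>auto simp: upper_triangular_def\<close>)
  then show prod: "(\<Prod>r<n. s $$ (r, r)) = 1"
    using s(2) by simp
  show "s $$ (r, r) \<noteq> 0" if "r < n"
  proof
    assume "s $$ (r, r) = 0"
    then have "(\<Prod>r<n. s $$ (r, r)) = 0"
      using that by (intro prod_zero) auto
    then show False using prod by simp
  qed
qed

lemma torus_mult_index:
  assumes "s \<in> torus n" "t \<in> torus n" "r < n"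
  shows "(s * t) $$ (r, r) = s $$ (r, r) * (t $$ (r, r) :: 'a::field)"
  using assms torus_simps[OF assms(1)] torus_simps[OF assms(2)] by (intro mult_diagonal) auto

lemma torus_diagI:
  assumes "A \<in> carrier_mat n n" "\<And>r c. r < n \<Longrightarrow> c < n \<Longrightarrow> r \<noteq> c \<Longrightarrow> A $$ (r, c) = 0"
    "(\<Prod>r<n. A $$ (r, r)) = (1 :: 'a::field)"
  shows "A \<in> torus n"
proof -
  have "det A = 1"
    using assms by (subst det_upper_triangular_prod[OF assms(1)]) (auto simp: upper_triangular_def)
  then show ?thesis
    using assms unfolding torus_def diagonal_mat_def by auto
qed

lemma torus_el:
  assumes "s \<in> torus n" "i < n" "j < n" "i \<noteq> j"
  shows "s * el n i j t = el n i j (s $$ (i, i) / s $$ (j, j) * t) * (s :: 'a::field mat)"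
proof (rule eq_matI)
  note s = torus_simps[OF assms(1)]
  fix r c assume "r < dim_row (el n i j (s $$ (i, i) / s $$ (j, j) * t) * s)"
    "c < dim_col (el n i j (s $$ (i, i) / s $$ (j, j) * t) * s)"
  then have rc: "r < n" "c < n" using s(1) by auto
  show "(s * el n i j t) $$ (r, c) = (el n i j (s $$ (i, i) / s $$ (j, j) * t) * s) $$ (r, c)"
    unfolding mult_el[OF s(1) assms(2-4) rc] el_mult[OF s(1) assms(2-4) rc]
    using s(3)[of r i] s(3)[of j c] s(5)[of j] rc assms by auto
qed (use torus_simps(1)[OF assms(1)] in auto)

text \<open>The values at \<open>t\<close> of \<open>2\<rho>\<^sup>\<vee>\<close>.\<close>
definition rho_torus :: "nat \<Rightarrow> 'a::field \<Rightarrow> 'a mat" where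
  "rho_torus n z = mat n n (\<lambda>(r, c). if r = c then z powi (int n - 1 - 2 * int r) else 0)"

lemma rho_torus:
  assumes "z \<noteq> (0 :: 'a::field)"
  shows "rho_torus n z \<in> torus n"
proof (rule torus_diagI)
  have "(\<Prod>r<m. z powi (int n - 1 - 2 * int r)) = z powi (int m * (int n - int m))" for m
  proof (induction m)
    case (Suc m)
    have "int (Suc m) * (int n - int (Suc m)) = int m * (int n - int m) + (int n - 1 - 2 * int m)"
      by (simp add: algebra_simps)
    then show ?case
      using Suc assms by (simp add: power_int_add[symmetric] del: of_nat_Suc)
  qed simp
  from this[of n] show "(\<Prod>r<n. rho_torus n z $$ (r, r)) = 1"
    by (simp add: rho_torus_def)
qed (auto simp: rho_torus_def)

lemma rho_torus_quotient:
  assumes "z \<noteq> (0 :: 'a::field)" "i < j" "j < n"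
  shows "rho_torus n z $$ (i, i) / rho_torus n z $$ (j, j) = z ^ (2 * (j - i))"
proof -
  have "rho_torus n z $$ (i, i) / rho_torus n z $$ (j, j) = z powi (2 * int (j - i))"
    using assms by (simp add: rho_torus_def power_int_diff[symmetric] of_nat_diff)
  also have "\<dots> = z ^ (2 * (j - i))"
    by (metis of_nat_mult of_nat_numeral power_int_of_nat)
  finally show ?thesis .
qed

context
  fixes n :: nat and K :: "'a::field mat set"
  assumes K_mult: "\<And>A B. A \<in> K \<Longrightarrow> B \<in> K \<Longrightarrow> A * B \<in> K"
    and K_one: "1\<^sub>m n \<in> K"
    and K_el: "\<And>i j t. i < j \<Longrightarrow> j < n \<Longrightarrow> el n i j t \<in> K"
begin

private definition row_unip :: "nat \<Rightarrow> (nat \<Rightarrow> 'a) \<Rightarrow> nat \<Rightarrow> 'a mat" where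
  "row_unip m b k = mat n n (\<lambda>(r, c). if r = c then 1 else if r = m \<and> m < c \<and> c < k then b c else 0)"

private lemma row_unip_in:
  assumes "m < n" "k \<le> n"
  shows "row_unip m b k \<in> K"
  using assms(2)
proof (induction k)
  case 0
  have "row_unip m b 0 = 1\<^sub>m n"
    unfolding row_unip_def by (rule eq_matI) auto
  then show ?case using K_one by simp
next
  case (Suc k)
  show ?case
  proof (cases "m < k")
    case True
    have "row_unip m b (Suc k) = row_unip m b k * el n m k (b k)"
    proof (rule eq_matI)
      fix r c assume "r < dim_row (row_unip m b k * el n m k (b k))" "c < dim_col (row_unip m b k * el n m k (b k))"
      then have rc: "r < n" "c < n" by (auto simp: row_unip_def)
      have "(row_unip m b k * el n m k (b k)) $$ (r, c)
        = row_unip m b k $$ (r, c) + (if c = k then b k * row_unip m b k $$ (r, m) else 0)"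
        using rc True Suc assms(1) by (intro mult_el) (auto simp: row_unip_def)
      then show "row_unip m b (Suc k) $$ (r, c) = (row_unip m b k * el n m k (b k)) $$ (r, c)"
        using rc True assms(1) by (auto simp: row_unip_def)
    qed (auto simp: row_unip_def)
    then show ?thesis
      using Suc True K_mult K_el by simp
  next
    case False
    then have "row_unip m b (Suc k) = row_unip m b k"
      unfolding row_unip_def by (intro eq_matI) auto
    then show ?thesis using Suc by simp
  qed
qed

text \<open>\<open>m\<close> counts the leading rows that may differ from the identity; the last of
  them is split off as a left factor.\<close>

lemma unitriangular_in_generated:
  assumes "A \<in> carrier_mat n n" "\<And>r c. c < r \<Longrightarrow> r < n \<Longrightarrow> A $$ (r, c) = 0" "\<And>r. r < n \<Longrightarrow> A $$ (r, r) = 1"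
  shows "A \<in> K"
proof -
  have "A \<in> K" if "m \<le> n" "A \<in> carrier_mat n n" "\<And>r c. c < r \<Longrightarrow> r < n \<Longrightarrow> A $$ (r, c) = 0"
    "\<And>r. r < n \<Longrightarrow> A $$ (r, r) = 1" "\<And>r c. m \<le> r \<Longrightarrow> r < n \<Longrightarrow> c < n \<Longrightarrow> r \<noteq> c \<Longrightarrow> A $$ (r, c) = 0" for m A
    using that
  proof (induction m arbitrary: A)
    case 0
    then have "A = 1\<^sub>m n" by (intro eq_matI) auto
    then show ?case using K_one by simp
  next
    case (Suc m)
    define A' where "A' = mat n n (\<lambda>(r, c). if r = m then if c = m then 1 else 0 else A $$ (r, c))"
    define R where "R = row_unip m (\<lambda>c. A $$ (m, c)) n"
    have A': "A' \<in> K"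
      unfolding A'_def using Suc.prems by (intro Suc.IH) auto
    have "A = R * A'"
    proof (rule eq_matI)
      fix r c assume "r < dim_row (R * A')" "c < dim_col (R * A')"
      then have rc: "r < n" "c < n" by (auto simp: R_def A'_def row_unip_def)
      have sum: "(R * A') $$ (r, c) = (\<Sum>u<n. R $$ (r, u) * A' $$ (u, c))"
        using rc by (intro index_mult_mat_sum) (auto simp: R_def A'_def row_unip_def)
      show "A $$ (r, c) = (R * A') $$ (r, c)"
      proof (cases "r = m")
        case False
        then have "(\<Sum>u<n. R $$ (r, u) * A' $$ (u, c)) = (\<Sum>u<n. if u = r then A' $$ (u, c) else 0)"
          using rc by (intro sum.cong) (auto simp: R_def row_unip_def)
        then show ?thesis
          unfolding sum using rc False by (simp add: A'_def)
      next
        case True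
        have "(\<Sum>u<n. R $$ (r, u) * A' $$ (u, c)) = (\<Sum>u<n. if u = c then A $$ (m, c) else 0)"
        proof (rule sum.cong[OF refl])
          fix u assume u: "u \<in> {..<n}"
          have "A $$ (u, c) = 0" if "m < u" "u \<noteq> c"
            using Suc.prems(5)[of u c] that u rc by simp
          then show "R $$ (r, u) * A' $$ (u, c) = (if u = c then A $$ (m, c) else 0)"
            using u rc True Suc.prems(4)[of m] Suc.prems(4)[of u] Suc.prems(3)[of c m]
            unfolding R_def row_unip_def A'_def
            by (cases "u = m"; cases "u = c"; cases "m < u") (auto simp: not_less le_less)
        qed
        then show ?thesis
          unfolding sum using rc True by simp
      qed
    qed (use Suc.prems in \<open>auto simp: R_def A'_def row_unip_def\<close>)
    moreover have "R \<in> K"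
      unfolding R_def using Suc.prems(1) by (intro row_unip_in) auto
    ultimately show ?case using K_mult A' by simp
  qed
  from this[of n A] assms show ?thesis by auto
qed

end

lemma coroot_torus:
  assumes "1 \<le> i" "i < n" "z \<noteq> (0 :: 'a::field)"
  shows "coroot_elem n i z \<in> torus n"
proof (rule torus_diagI)
  have "(\<Prod>r<n. coroot_elem n i z $$ (r, r)) = (\<Prod>r\<in>{i - 1, i}. coroot_elem n i z $$ (r, r))"
    using assms by (intro prod.mono_neutral_right) (auto simp: coroot_elem_def)
  also have "\<dots> = 1"
    using assms by (auto simp: coroot_elem_def)
  finally show "(\<Prod>r<n. coroot_elem n i z $$ (r, r)) = 1" .
qed (auto simp: coroot_elem_def)

lemma coroot_mult:
  assumes "1 \<le> i" "i < n"
  shows "coroot_elem n i y * coroot_elem n i z = coroot_elem n i (y * z :: 'a::field)"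
proof (rule eq_matI)
  fix r c assume "r < dim_row (coroot_elem n i (y * z))" "c < dim_col (coroot_elem n i (y * z))"
  then have rc: "r < n" "c < n" by (auto simp: coroot_elem_def)
  have "(coroot_elem n i y * coroot_elem n i z) $$ (r, c) = coroot_elem n i y $$ (r, c) * coroot_elem n i z $$ (c, c)"
    using rc by (intro mult_diagonal) (auto simp: coroot_elem_def)
  then show "(coroot_elem n i y * coroot_elem n i z) $$ (r, c) = coroot_elem n i (y * z) $$ (r, c)"
    using rc by (auto simp: coroot_elem_def)
qed (auto simp: coroot_elem_def)

text \<open>
  A regular character \<open>\<chi>\<close> of the multiplicative group is \<open>poly p t / t ^ m\<close>. Multiplicativity gives
  \<open>p (s t) = p s p t\<close> up to powers, and comparing one nonzero coefficient in \<open>t\<close> shows \<open>p s = s ^ k\<close>.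
\<close>
lemma pairing_spec:
  fixes \<omega> :: "'a::{field,infinite} mat \<Rightarrow> 'a"
  assumes \<omega>: "\<omega> \<in> weights n (torus n)" and i: "1 \<le> i" "i < n" and z: "z \<noteq> 0"
  shows "\<omega> (coroot_elem n i z) = z powi pairing n \<omega> i"
proof -
  obtain P where P: "P \<in> poly_fun n" "\<And>s. s \<in> torus n \<Longrightarrow> \<omega> s = P s"
    using \<omega> unfolding weights_def regular_on_def by blast
  have "\<exists>m p. \<forall>t. t \<noteq> 0 \<longrightarrow> t ^ m * P (coroot_elem n i t) = poly p t"
    using P(1)
  proof (induction rule: poly_fun.induct)
    case (const c)
    show ?case by (intro exI[of _ 0] exI[of _ "[:c:]"]) simp
  next
    case (entry r c)
    show ?case
      by (intro exI[of _ 1] exI[of _ "if r \<noteq> c then 0 else if r + 1 = i then [:0, 0, 1:] else if r = i then 1 else [:0, 1:]"])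
        (use entry i in \<open>auto simp: coroot_elem_def\<close>)
  next
    case (add f g)
    then obtain m p m' p' where "\<And>t. t \<noteq> 0 \<Longrightarrow> t ^ m * f (coroot_elem n i t) = poly p t"
      "\<And>t. t \<noteq> 0 \<Longrightarrow> t ^ m' * g (coroot_elem n i t) = poly p' t" by blast
    then have "\<forall>t. t \<noteq> 0 \<longrightarrow> t ^ (m + m') * (f (coroot_elem n i t) + g (coroot_elem n i t))
        = poly (monom 1 m' * p + monom 1 m * p') t"
      by (simp add: power_add algebra_simps poly_monom)
    then show ?case by blast
  next
    case (mult f g)
    then obtain m p m' p' where pp': "\<And>t. t \<noteq> 0 \<Longrightarrow> t ^ m * f (coroot_elem n i t) = poly p t"
      "\<And>t. t \<noteq> 0 \<Longrightarrow> t ^ m' * g (coroot_elem n i t) = poly p' t" by blast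
    have "t ^ (m + m') * (f (coroot_elem n i t) * g (coroot_elem n i t))
        = (t ^ m * f (coroot_elem n i t)) * (t ^ m' * g (coroot_elem n i t))" for t
      by (simp add: power_add ac_simps)
    then have "\<forall>t. t \<noteq> 0 \<longrightarrow> t ^ (m + m') * (f (coroot_elem n i t) * g (coroot_elem n i t)) = poly (p * p') t"
      unfolding poly_mult by (metis pp')
    then show ?case by blast
  qed
  then obtain m p where p: "\<And>t. t \<noteq> 0 \<Longrightarrow> t ^ m * \<omega> (coroot_elem n i t) = poly p t"
    using P(2) coroot_torus[OF i] by metis
  have nz: "\<omega> (coroot_elem n i t) \<noteq> 0" if "t \<noteq> 0" for t
    using \<omega> coroot_torus[OF i that] unfolding weights_def by blast
  have mult: "poly p (s * t) = poly p s * poly p t" if "s \<noteq> 0" "t \<noteq> 0" for s t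
  proof -
    have "\<omega> (coroot_elem n i (s * t)) = \<omega> (coroot_elem n i s) * \<omega> (coroot_elem n i t)"
      using \<omega> coroot_torus[OF i that(1)] coroot_torus[OF i that(2)] coroot_mult[OF i, of s t]
      unfolding weights_def by force
    then show ?thesis
      using p[of "s * t"] p[OF that(1)] p[OF that(2)] that by (simp add: power_mult_distrib algebra_simps)
  qed
  have "p \<noteq> 0" using p[of 1] nz[of 1] by auto
  then obtain k where k: "coeff p k \<noteq> 0"
    by (metis leading_coeff_0_iff)
  have pk: "poly p s = s ^ k" if "s \<noteq> 0" for s
  proof -
    have "pcompose p [:0, s:] = smult (poly p s) p"
      by (rule poly_eqI_infinite_nz) (use mult[OF that] in \<open>simp add: poly_pcompose mult.commute\<close>)
    then have "coeff (pcompose p [:0, s:]) k = poly p s * coeff p k" by simp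
    moreover have "coeff (pcompose p [:0, s:]) k = s ^ k * coeff p k"
      by (rule coeff_pcompose_linear)
    ultimately show ?thesis using k by simp
  qed
  have "\<omega> (coroot_elem n i t) = t powi (int k - int m)" if "t \<noteq> 0" for t
    using p[OF that] pk[OF that] that by (simp add: power_int_diff field_simps)
  then have "pairing n \<omega> i = int k - int m"
    unfolding pairing_def by (intro the_equality) (auto intro: powi_exponent_unique[where 'a = 'a])
  then show ?thesis
    using \<open>\<And>t. t \<noteq> 0 \<Longrightarrow> \<omega> (coroot_elem n i t) = _\<close> z by simp
qed

section \<open>The action of upper triangular matrices on a vector of highest weight\<close>

locale hw_module = rat_module n L for n :: nat and L :: "('a::{field,infinite}, 'v::ab_group_add) repn" +
  fixes \<omega> :: "'a mat \<Rightarrow> 'a" and v :: 'v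
  assumes \<omega>: "\<omega> \<in> weights n (torus n)"
    and highest: "\<And>\<mu>. \<mu> \<in> weights n (torus n) \<Longrightarrow> weight_space (torus n) L \<mu> \<noteq> {0} \<Longrightarrow> weight_le n \<mu> \<omega>"
    and v_weight: "v \<in> weight_space (torus n) L \<omega>"
begin

lemma v_V: "v \<in> V" and torus_v: "t \<in> torus n \<Longrightarrow> act t v = sc (\<omega> t) v"
  using v_weight unfolding weight_space_def by auto

lemma \<omega>_mult: "s \<in> torus n \<Longrightarrow> t \<in> torus n \<Longrightarrow> \<omega> (s * t) = \<omega> s * \<omega> t"
  and \<omega>_nonzero: "t \<in> torus n \<Longrightarrow> \<omega> t \<noteq> 0"
  using \<omega> unfolding weights_def by auto

text \<open>If moving \<open>g\<close> past \<open>y s\<close> rescales \<open>s\<close> by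
  \<open>w\<close> and the vector by \<open>z\<close>, comparison of the powers of \<open>s\<close>
  makes every coefficient an eigenvector.\<close>

lemma act_coefficient:
  assumes X: "\<And>k. X k \<in> V" "\<And>k. k > D \<Longrightarrow> X k = 0" and exp: "\<And>s. act (y s) v = (\<Sum>k\<le>D. sc (s ^ k) (X k))"
    and g: "g \<in> carrier (SL n)" and act: "\<And>s. act g (act (y s) v) = sc z (act (y (w * s)) v)"
  shows "act g (X k) = sc (z * w ^ k) (X k)"
proof (cases "k \<le> D")
  case True
  have "(\<Sum>k\<le>D. sc (s ^ k) (act g (X k))) = (\<Sum>k\<le>D. sc (s ^ k) (sc (z * w ^ k) (X k)))" for s
  proof -
    have "(\<Sum>k\<le>D. sc (s ^ k) (act g (X k))) = act g (act (y s) v)"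
      unfolding exp by (rule act_sum[OF g X(1), symmetric])
    also have "\<dots> = sc z (\<Sum>k\<le>D. sc ((w * s) ^ k) (X k))"
      unfolding act unfolding exp ..
    finally show ?thesis
      by (simp add: vs.scale_sum_right power_mult_distrib ac_simps)
  qed
  then show ?thesis
    using act_simps(1)[OF g X(1)] X(1) True by (intro expansion_unique[of "\<lambda>k. act g (X k)" "\<lambda>k. sc (z * w ^ k) (X k)"]) auto
next
  case False
  then show ?thesis using X(2) act_zero[OF g] by simp
qed

text \<open>A nonzero coefficient of index \<open>k > 0\<close> would have the weight \<omega> plus
  \<open>k\<close> times a positive root, and yet lie below \<omega>. Evaluated on
  \<open>rho_torus n z\<close>, this makes a power of \<open>z\<close> with positive exponent equal
  to 1 for all nonzero \<open>z\<close>.\<close>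

lemma upper_root_fixes:
  assumes ij: "i < j" "j < n"
  shows "act (el n i j t) v = v"
proof -
  obtain X D where X: "\<And>k. X k \<in> V" "\<And>k. k > D \<Longrightarrow> X k = 0"
    and exp: "\<And>t. act (el n i j t) v = (\<Sum>k\<le>D. sc (t ^ k) (X k))"
    using curve_expansion[OF poly_curve_el[of i j n] v_V] ij by auto
  have zero: "X k = 0" if "k > 0" for k
  proof (rule ccontr)
    assume "X k \<noteq> 0"
    define \<mu> where "\<mu> s = \<omega> s * (s $$ (i, i) / s $$ (j, j)) ^ k" for s
    have act: "act s (X k) = sc (\<mu> s) (X k)" if s: "s \<in> torus n" for s
      unfolding \<mu>_def
    proof (rule act_coefficient[OF X exp])
      show "s \<in> carrier (SL n)" by (rule torus_simps(2)[OF s])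
      fix t
      have "act s (act (el n i j t) v) = act (s * el n i j t) v"
        using torus_simps(2)[OF s] el_in_SL[of i j n] ij v_V by (intro act_simps(5)[symmetric]) auto
      also have "\<dots> = act (el n i j (s $$ (i, i) / s $$ (j, j) * t)) (act s v)"
        using torus_el[OF s, of i j t] torus_simps(2)[OF s] el_in_SL[of i j n] ij v_V by (simp add: act_simps(5) det_el)
      also have "\<dots> = sc (\<omega> s) (act (el n i j (s $$ (i, i) / s $$ (j, j) * t)) v)"
        unfolding torus_v[OF s] using el_in_SL[of i j n] ij v_V by (intro act_simps(3)) auto
      finally show "act s (act (el n i j t) v) = sc (\<omega> s) (act (el n i j (s $$ (i, i) / s $$ (j, j) * t)) v)" .
    qed
    have "\<mu> \<in> weights n (torus n)"
      unfolding weights_def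
    proof (intro CollectI conjI ballI)
      obtain P where P: "P \<in> poly_fun n" "\<forall>s\<in>torus n. \<omega> s = P s"
        using \<omega> unfolding weights_def regular_on_def by blast
      \<comment> \<open>The diagonal entries multiply to 1, so the inverse of the entry at
        \<open>j\<close> is the product of the others; this makes \<open>\<mu>\<close>
        regular.\<close>
      define F where "F = (\<lambda>s. P s * (s $$ (i, i) * (\<Prod>r\<in>{..<n} - {j}. s $$ (r, r))) ^ k)"
      have F: "F \<in> poly_fun n"
        unfolding F_def using ij by (intro poly_fun.mult P poly_fun_power poly_fun_prod poly_fun.entry) auto
      have \<mu>F: "\<mu> s = F s" if s: "s \<in> torus n" for s
      proof -
        have "s $$ (j, j) * (\<Prod>r\<in>{..<n} - {j}. s $$ (r, r)) = 1"
          using torus_simps(4)[OF s] ij by (simp add: prod.remove[of "{..<n}" j])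
        then have pe: "(\<Prod>r\<in>{..<n} - {j}. s $$ (r, r)) = 1 / s $$ (j, j)"
          using torus_simps(5)[OF s ij(2)] by (simp add: eq_divide_eq mult.commute)
        show ?thesis
          unfolding \<mu>_def F_def pe using P(2) s by simp
      qed
      show "regular_on n (torus n) \<mu>"
        unfolding regular_on_def using \<mu>F by (intro bexI[OF _ F]) simp
      fix s :: "'a mat" assume s: "s \<in> torus n"
      show "\<mu> s \<noteq> 0"
        unfolding \<mu>_def using \<omega>_nonzero[OF s] torus_simps(5)[OF s] ij by simp
      fix t :: "'a mat" assume t: "t \<in> torus n"
      show "\<mu> (s * t) = \<mu> s * \<mu> t"
        unfolding \<mu>_def using \<omega>_mult[OF s t] torus_mult_index[OF s t] ij
        by (simp add: power_mult_distrib power_divide)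
    qed
    moreover have "X k \<in> weight_space (torus n) L \<mu>"
      unfolding weight_space_def using X(1) act by simp
    ultimately have "weight_le n \<mu> \<omega>"
      using highest \<open>X k \<noteq> 0\<close> by blast
    then obtain c where c: "\<And>s. s \<in> torus n \<Longrightarrow> \<omega> s = \<mu> s * (\<Prod>i=1..n-1. simple_root i s ^ c i)"
      unfolding weight_le_def by blast
    have "z ^ (2 * (j - i) * k + 2 * (\<Sum>i=1..n-1. c i)) = 1" if z: "z \<noteq> 0" for z :: 'a
    proof -
      have h: "rho_torus n z \<in> torus n" by (rule rho_torus[OF z])
      have "simple_root l (rho_torus n z) = z ^ 2" if "l \<in> {1..n-1}" for l
      proof -
        have "l - 1 < l" "l < n" using that by auto
        then show ?thesis
          using rho_torus_quotient[OF z, of "l - 1" l n] that unfolding simple_root_def by simp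
      qed
      then have "(\<Prod>l=1..n-1. simple_root l (rho_torus n z) ^ c l) = z ^ (2 * (\<Sum>l=1..n-1. c l))"
        by (simp add: power_mult[symmetric] power_sum[symmetric] sum_distrib_left)
      moreover have "\<mu> (rho_torus n z) = \<omega> (rho_torus n z) * z ^ (2 * (j - i) * k)"
        unfolding \<mu>_def rho_torus_quotient[OF z ij] by (simp add: power_mult)
      ultimately show ?thesis
        using c[OF h] \<omega>_nonzero[OF h] by (simp add: power_add mult.commute)
    qed
    then have "2 * (j - i) * k + 2 * (\<Sum>i=1..n-1. c i) = 0"
      by (rule monom_eq_one_infinite)
    then show False using ij \<open>k > 0\<close> by simp
  qed
  have "act (el n i j t) v = X 0" for t
  proof -
    have "(\<Sum>k\<le>D. sc (t ^ k) (X k)) = (\<Sum>k\<in>{0}. sc (t ^ k) (X k))"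
      using zero by (intro sum.mono_neutral_right) auto
    then show ?thesis unfolding exp by simp
  qed
  from this[of t] this[of 0] show ?thesis
    using act_simps(4)[OF v_V] by simp
qed

text \<open>\<open>Z\<close> is its diagonal part times a unitriangular matrix, and the latter is a
  product of root elements that fix \<open>v\<close>.\<close>

lemma upper_triangular_act:
  assumes Z: "Z \<in> carrier (SL n)" "upper_triangular Z"
  shows "act Z v = sc (\<omega> (diag_part n Z)) v"
proof -
  have Zc: "Z \<in> carrier_mat n n" using Z by simp
  have up: "Z $$ (r, c) = 0" if "c < r" "r < n" for r c
    using Z that unfolding upper_triangular_def by auto
  have prod: "(\<Prod>r<n. Z $$ (r, r)) = 1"
    using det_upper_triangular_prod[OF Zc Z(2)] Z(1) by simp
  define T where "T = diag_part n Z"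
  have T: "T \<in> torus n"
    unfolding T_def diag_part_def using prod by (intro torus_diagI) auto
  have nz: "Z $$ (r, r) \<noteq> 0" if "r < n" for r
    using torus_simps(5)[OF T that] that unfolding T_def diag_part_def by simp
  define U where "U = mat n n (\<lambda>(r, c). Z $$ (r, c) / Z $$ (r, r))"
  have "U \<in> {A \<in> carrier (SL n). act A v = v}"
  proof (rule unitriangular_in_generated)
    show "1\<^sub>m n \<in> {A \<in> carrier (SL n). act A v = v}"
      using act_simps(4)[OF v_V] by simp
    show "el n i j t \<in> {A \<in> carrier (SL n). act A v = v}" if "i < j" "j < n" for i j t
      using upper_root_fixes[OF that] el_in_SL[of i j n t] that by simp
    show "A * B \<in> {A \<in> carrier (SL n). act A v = v}"
      if "A \<in> {A \<in> carrier (SL n). act A v = v}" "B \<in> {A \<in> carrier (SL n). act A v = v}" for A B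
      using that act_simps(5)[of A B v] v_V by (auto simp: det_mult[of A n B])
    show "U $$ (r, c) = 0" if "c < r" "r < n" for r c
      using up[OF that] that unfolding U_def by simp
    show "U $$ (r, r) = 1" if "r < n" for r
      using nz[OF that] that unfolding U_def by simp
  qed (simp add: U_def)
  then have U: "U \<in> carrier (SL n)" "act U v = v" by auto
  have "Z = T * U"
  proof (rule eq_matI)
    fix r c assume "r < dim_row (T * U)" "c < dim_col (T * U)"
    then have rc: "r < n" "c < n" by (auto simp: T_def U_def diag_part_def)
    have "(T * U) $$ (r, c) = (\<Sum>u<n. T $$ (r, u) * U $$ (u, c))"
      using rc by (intro index_mult_mat_sum) (auto simp: T_def U_def diag_part_def)
    also have "\<dots> = (\<Sum>u<n. if u = r then Z $$ (r, c) else 0)"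
      using rc nz[OF rc(1)] by (intro sum.cong refl) (auto simp: T_def U_def diag_part_def)
    also have "\<dots> = Z $$ (r, c)" using rc by simp
    finally show "Z $$ (r, c) = (T * U) $$ (r, c)" ..
  qed (use Zc in \<open>auto simp: T_def U_def diag_part_def\<close>)
  then have "act Z v = act T (act U v)"
    using act_simps(5)[OF torus_simps(2)[OF T] U(1) v_V] by simp
  then show ?thesis
    unfolding U(2) torus_v[OF T] unfolding T_def .
qed

end

section \<open>The common argument for both corners\<close>

lemma fun_power_apply: "(f ^ k) x = (f x ^ k :: 'a::field)"
  by (induction k) (auto simp: times_fun_def)

lemma el_commute:
  assumes "i < n" "j < n" "k < n" "l < n" "i \<noteq> j" "k \<noteq> l" "j \<noteq> k" "l \<noteq> i"
  shows "el n i j s * el n k l t = el n k l t * el n i j (s :: 'a::field)"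
proof (rule eq_matI)
  fix r c assume "r < dim_row (el n k l t * el n i j s)" "c < dim_col (el n k l t * el n i j s)"
  then have rc: "r < n" "c < n" by auto
  show "(el n i j s * el n k l t) $$ (r, c) = (el n k l t * el n i j s) $$ (r, c)"
    unfolding el_mult[OF el_carrier assms(1,2,5) rc] mult_el[OF el_carrier assms(1,2,5) rc]
    using rc assms by (auto simp: el_index)
qed auto

locale block_hw = block n q d N + hw_module n L \<omega> v
  for n q d N :: nat and L :: "('a::{field,infinite}, 'v::ab_group_add) repn" and \<omega> :: "'a mat \<Rightarrow> 'a" and v :: 'v +
  assumes dominant: "\<omega> \<in> dominant_weights n" and v_nonzero: "v \<noteq> 0"
begin

lemma T_sub_torus: "t \<in> T_sub n q \<Longrightarrow> t \<in> torus n"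
proof -
  assume t: "t \<in> T_sub n q"
  then have "t \<in> carrier_mat n n" "det t = 1"
    using G_sub_SL T_sub_in_G_sub by blast+
  then show ?thesis
    unfolding torus_def diagonal_mat_def by (auto simp: T_sub_diagonal[OF t])
qed

text \<open>The weight \<open>\<omega> + k \<omega>\<^sub>e\<close> on the torus of the block,
  written multiplicatively and in the syntactic form used by the theorem.\<close>

definition level_weight :: "nat \<Rightarrow> nat \<Rightarrow> 'a mat \<Rightarrow> 'a" where
  "level_weight e k = restrict \<omega> (T_sub n q) * restrict (fund_weight e) (T_sub n q) ^ k"

lemma level_weight_apply:
  "t \<in> T_sub n q \<Longrightarrow> level_weight e k t = \<omega> t * fund_weight e t ^ k"
  unfolding level_weight_def by (simp add: times_fun_def fun_power_apply)

lemma has_weight_level_weight: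
  assumes e: "e \<le> n" and fw: "\<And>s z. Suc s < N \<Longrightarrow> z \<noteq> 0 \<Longrightarrow> fund_weight e (cr s z) = (if Suc s = c then z else 1 :: 'a)"
  shows "has_weight (level_weight e k) (\<lambda>s. nat (pairing n \<omega> (Suc (d + s))) + (if Suc s = c then k else 0))"
  unfolding has_weight_def
proof (intro conjI ballI allI impI)
  fix s t :: "'a mat" assume st: "s \<in> T_sub n q" "t \<in> T_sub n q"
  have "fund_weight e (s * t) = fund_weight e s * (fund_weight e t :: 'a)"
    unfolding fund_weight_def prod.distrib[symmetric]
    using e torus_mult_index[OF T_sub_torus[OF st(1)] T_sub_torus[OF st(2)]] by (intro prod.cong refl) auto
  then show "level_weight e k (s * t) = level_weight e k s * level_weight e k t"
    using st T_sub_mult[OF st] \<omega>_mult[OF T_sub_torus[OF st(1)] T_sub_torus[OF st(2)]]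
    by (simp add: level_weight_apply power_mult_distrib)
next
  fix s and z :: 'a assume s: "Suc s < N" and z: "z \<noteq> 0"
  have "Suc (d + s) \<in> {1..n-1}" "Suc (d + s) < n"
    using s d_N by auto
  then have "pairing n \<omega> (Suc (d + s)) \<ge> 0" "\<omega> (cr s z) = z powi pairing n \<omega> (Suc (d + s))"
    using dominant pairing_spec[OF \<omega> _ _ z, of "Suc (d + s)"] unfolding dominant_weights_def by auto
  then have "\<omega> (cr s z) = z ^ nat (pairing n \<omega> (Suc (d + s)))"
    by (simp add: power_int_def)
  then show "level_weight e k (cr s z) = z ^ (nat (pairing n \<omega> (Suc (d + s))) + (if Suc s = c then k else 0))"
    using cr_in_T_sub[OF s z] fw[OF s z] by (simp add: level_weight_apply power_add)
qed

text \<open>\<open>i0, j0\<close> is the place of the removed negative simple root and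
  \<open>l\<close> its number; \<open>e\<close> numbers the added fundamental weight in the large
  group, \<open>c\<close> the same weight in the block. By \<open>T\<close> the torus of the block
  rescales \<open>y\<close> through that weight, and by \<open>comm\<close> the positive root
  elements of the block commute with \<open>y\<close>; so the Borel subgroup acts on
  \<open>X k\<close> by a scalar. The factor \<open>z ^ a\<close> of \<open>straighten\<close>
  arises from the diagonal part of \<open>Z\<close>.\<close>

theorem Weyl_in_restriction:
  fixes x :: "nat \<Rightarrow> 'a \<Rightarrow> 'a mat" and \<phi> :: "nat \<Rightarrow> 'a mat \<Rightarrow> 'a"
  assumes ij: "i0 < n" "j0 < n" "i0 \<noteq> j0" and e: "e \<le> n" and c: "0 < c" "c < N"
    and T: "\<And>t :: 'a mat. t \<in> T_sub n q \<Longrightarrow> t $$ (i0, i0) = fund_weight e t * t $$ (j0, j0)"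
    and comm: "\<And>i j. i < j \<Longrightarrow> i \<in> {d..<d+N} \<Longrightarrow> j \<in> {d..<d+N} \<Longrightarrow> j \<noteq> i0 \<and> j0 \<noteq> i"
    and fw: "\<And>s z. Suc s < N \<Longrightarrow> z \<noteq> 0 \<Longrightarrow> fund_weight e (cr s z) = (if Suc s = c then z else 1 :: 'a)"
    and x: "\<And>\<iota>. \<iota> \<in> J \<Longrightarrow> poly_curve n (x \<iota>)" "\<And>\<iota>. \<iota> \<in> J \<Longrightarrow> x \<iota> 0 = 1\<^sub>m n"
    and straighten: "\<And>\<iota> g s t z. \<iota> \<in> J \<Longrightarrow> g \<in> G_sub n q \<Longrightarrow> z = 1 + s * t * \<phi> \<iota> g \<Longrightarrow> z \<noteq> 0 \<Longrightarrow>
      \<exists>Z. Z \<in> carrier (SL n) \<and> upper_triangular Z \<and> diag_part n Z = coroot_elem n l z \<and>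
        x \<iota> t * g * el n i0 j0 s = g * (el n i0 j0 (s / z) * Z)"
    and minors: "\<And>I. sorted_wrt (<) I \<Longrightarrow> set I \<subseteq> {..<N} \<Longrightarrow> length I = c \<Longrightarrow>
      \<exists>\<iota>\<in>J. \<exists>z. \<forall>g\<in>G_sub n q. minor I 0 (blk d g) = z * \<phi> \<iota> g"
    and J_unit: "\<exists>\<iota>\<in>J. \<phi> \<iota> (1\<^sub>m n) = 1"
    and l: "1 \<le> l" "l < n"
    and nz: "\<And>r :: nat. r < k \<Longrightarrow> of_int (pairing n \<omega> l - int r) \<noteq> (0 :: 'a)"
    and m: "m \<le> k" "simple_module (G_sub n q) (weyl_module n (G_sub n q) (B_sub n q) (level_weight e m))"
  shows "module_isomorphic (G_sub n q)
    (generated_submodule (G_sub n q) L (divided_power n L (Suc i0) (Suc j0) k v))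
    (weyl_module n (G_sub n q) (B_sub n q) (level_weight e k))"
proof -
  define y where "y = (el n i0 j0 :: 'a \<Rightarrow> _)"
  have y: "poly_curve n y" unfolding y_def by (rule poly_curve_el[OF ij(3)])
  then have ySL: "y s \<in> carrier (SL n)" for s unfolding poly_curve_def by blast
  obtain X D where X: "\<And>k. X k \<in> V" "\<And>k. k > D \<Longrightarrow> X k = 0"
    and exp: "\<And>s. act (y s) v = (\<Sum>k\<le>D. sc (s ^ k) (X k))"
    using curve_expansion[OF y v_V] by blast
  have dp: "divided_power n L (Suc i0) (Suc j0) k v = X k" for k
    by (rule divided_power_eq[OF X]) (use exp in \<open>simp_all add: y_def\<close>)
  have X0: "X 0 = v"
  proof -
    have "(\<Sum>k\<le>D. sc (0 ^ k) (X k)) = (\<Sum>k\<in>{0}. sc (0 ^ k) (X k))"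
      by (intro sum.mono_neutral_right) auto
    then have "act (y 0) v = X 0" unfolding exp by simp
    then show ?thesis
      using act_simps(4)[OF v_V] unfolding y_def by simp
  qed
  note weight = has_weight_level_weight[OF e fw]
  have pos: "pairing n \<omega> l \<ge> 0"
    using dominant l unfolding dominant_weights_def by auto
  have B_act: "act b (X k) = sc (level_weight e k (diag_part n b)) (X k)" if "b \<in> B_sub n q" for b k
    using that
  proof (induction rule: B_sub_induct)
    case (torus t)
    have t: "t \<in> torus n" by (rule T_sub_torus[OF torus])
    have "act t (X k) = sc (\<omega> t * fund_weight e t ^ k) (X k)"
    proof (rule act_coefficient[OF X exp torus_simps(2)[OF t]])
      fix s
      have quot: "t $$ (i0, i0) / t $$ (j0, j0) = fund_weight e t"
        using T[OF torus] torus_simps(5)[OF t ij(2)] by simp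
      have "act t (act (y s) v) = act (t * y s) v"
        by (rule act_simps(5)[OF torus_simps(2)[OF t] ySL v_V, symmetric])
      also have "t * y s = y (fund_weight e t * s) * t"
        unfolding y_def torus_el[OF t ij] quot ..
      also have "act (y (fund_weight e t * s) * t) v = act (y (fund_weight e t * s)) (act t v)"
        by (rule act_simps(5)[OF ySL torus_simps(2)[OF t] v_V])
      also have "\<dots> = sc (\<omega> t) (act (y (fund_weight e t * s)) v)"
        unfolding torus_v[OF t] by (rule act_simps(3)[OF ySL v_V])
      finally show "act t (act (y s) v) = sc (\<omega> t) (act (y (fund_weight e t * s)) v)" .
    qed
    then show ?case
      by (simp add: diag_part_T_sub[OF torus] level_weight_apply[OF torus])
  next
    case (root i j z)
    have ijn: "i < n" "j < n" "i \<noteq> j" using root d_N by auto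
    have elSL: "el n i j z \<in> carrier (SL n)" by (rule el_in_SL[OF ijn(3)])
    have "act (el n i j z) (X k) = sc (1 * 1 ^ k) (X k)"
    proof (rule act_coefficient[OF X exp elSL])
      fix s
      have "act (el n i j z) (act (y s) v) = act (el n i j z * y s) v"
        by (rule act_simps(5)[OF elSL ySL v_V, symmetric])
      also have "el n i j z * y s = y s * el n i j z"
        unfolding y_def using comm[OF root] ijn ij by (intro el_commute) auto
      also have "act (y s * el n i j z) v = act (y s) (act (el n i j z) v)"
        by (rule act_simps(5)[OF ySL elSL v_V])
      also have "\<dots> = act (y s) v"
        using upper_root_fixes[OF root(1) ijn(2)] by simp
      finally show "act (el n i j z) (act (y s) v) = sc 1 (act (y (1 * s)) v)" by simp
    qed
    then show ?case
      by (simp add: diag_part_el[OF ijn(3)] has_weight_one[OF weight])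
  next
    case (mult g h)
    have gh: "g \<in> carrier (SL n)" "h \<in> carrier (SL n)" "g \<in> carrier_mat n n" "h \<in> carrier_mat n n"
      using B_sub_cases[OF mult(1)] B_sub_cases[OF mult(2)] G_sub_SL by auto
    have ghT: "diag_part n g \<in> T_sub n q" "diag_part n h \<in> T_sub n q" "upper_triangular g" "upper_triangular h"
      using B_sub_cases[OF mult(1)] B_sub_cases[OF mult(2)] by auto
    have "level_weight e k (diag_part n (g * h)) = level_weight e k (diag_part n g) * level_weight e k (diag_part n h)"
      unfolding upper_triangular_mult(2)[OF gh(3,4) ghT(3,4)]
      using weight ghT(1,2) unfolding has_weight_def by blast
    then show ?case
      using act_simps(5)[OF gh(1,2) X(1)] mult act_simps(3)[OF gh(1) X(1)] by (simp add: mult.commute)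
  qed
  have move: "act (x \<iota> t) (act g (act (y s) v)) =
      sc ((1 + s * t * \<phi> \<iota> g) ^ nat (pairing n \<omega> l)) (act g (act (y (s / (1 + s * t * \<phi> \<iota> g))) v))"
    if \<iota>: "\<iota> \<in> J" and g: "g \<in> G_sub n q" and nonzero: "1 + s * t * \<phi> \<iota> g \<noteq> 0" for \<iota> g s t
  proof -
    define z where "z = 1 + s * t * \<phi> \<iota> g"
    obtain Z where Z: "Z \<in> carrier (SL n)" "upper_triangular Z" "diag_part n Z = coroot_elem n l z"
      "x \<iota> t * g * y s = g * (y (s / z) * Z)"
      using straighten[OF \<iota> g z_def] nonzero unfolding y_def z_def by blast
    have xSL: "x \<iota> t \<in> carrier (SL n)"
      using x(1)[OF \<iota>] unfolding poly_curve_def by blast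
    have gSL: "g \<in> carrier (SL n)" using G_sub_SL[OF g] by simp
    have "x \<iota> t * g \<in> carrier (SL n)" "y (s / z) * Z \<in> carrier (SL n)"
      using SL.m_closed[OF xSL gSL] SL.m_closed[OF ySL Z(1)] by simp_all
    then have "act (x \<iota> t) (act g (act (y s) v)) = act g (act (y (s / z)) (act Z v))"
      using Z(4) act_simps(5)[OF _ ySL v_V, of "x \<iota> t * g" s] act_simps(5)[OF xSL gSL act_simps(1)[OF ySL v_V]]
        act_simps(5)[OF gSL _ v_V, of "y (s / z) * Z"] act_simps(5)[OF ySL Z(1) v_V] by metis
    also have "act Z v = sc (z ^ nat (pairing n \<omega> l)) v"
      using upper_triangular_act[OF Z(1,2)] pairing_spec[OF \<omega> l, of z] nonzero pos
      unfolding Z(3) by (simp add: power_int_def z_def)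
    finally show ?thesis
      using act_simps(3)[OF ySL v_V] act_simps(3)[OF gSL act_simps(1)[OF ySL v_V]] unfolding z_def by simp
  qed
  interpret level_module n q d N L v y X D "nat (pairing n \<omega> l)" c "level_weight e"
    "\<lambda>k s. nat (pairing n \<omega> (Suc (d + s))) + (if Suc s = c then k else 0)" J x \<phi>
  proof unfold_locales
    show "has_weight (level_weight e k) (\<lambda>s. nat (pairing n \<omega> (Suc (d + s))) + (if Suc s = c then k else 0))" for k
      by (rule weight)
  qed (use v_V v_nonzero X X0 ySL exp B_act c x move minors J_unit in auto)
  have "of_nat (nat (pairing n \<omega> l)) - of_nat r \<noteq> (0 :: 'a)" if "r < k" for r
    using nz[OF that] pos by (simp add: of_nat_nat)
  from generated_isomorphic_Weyl_of_simple[OF this m] show ?thesis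
    unfolding dp .
qed

end


section \<open>The two corners\<close>

lemma block_first: "n \<ge> 3 \<Longrightarrow> block n 1 1 (n - 1)"
  by unfold_locales auto

lemma block_last: "n \<ge> 3 \<Longrightarrow> block n (n - 1) 0 (n - 1)"
  by unfold_locales auto

text \<open>In essence the SL_2 identity that rewrites upper times lower unipotent as lower
  unipotent times upper triangular, valid when the corner entry \<open>z\<close> is nonzero. The row
  operation with \<open>s / z\<close> clears the only entry below the diagonal.\<close>

lemma straighten_first:
  fixes g :: "'a::field mat"
  assumes n: "n \<ge> 3" and g: "g \<in> G_sub n 1" and \<iota>: "\<iota> \<in> {1..<n}"
    and z: "z = 1 + s * t * g $$ (\<iota>, 1)" "z \<noteq> 0"
  shows "\<exists>Z. Z \<in> carrier (SL n) \<and> upper_triangular Z \<and> diag_part n Z = coroot_elem n 1 z \<and>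
    el n 0 \<iota> t * g * el n 1 0 s = g * (el n 1 0 (s / z) * Z)"
proof -
  interpret block n 1 1 "n - 1" by (rule block_first[OF n])
  have ag: "agrees_off n 1 n g"
    using g n unfolding G_sub_eq by simp
  then have gc: "g \<in> carrier_mat n n" "det g = 1" unfolding agrees_off_def by auto
  have gcol: "g $$ (r, 0) = (if r = 0 then 1 else 0)" if "r < n" for r
    using ag that n unfolding agrees_off_def by auto
  \<comment> \<open>The conjugate of \<open>el n 0 \<iota> t\<close> by \<open>g\<close>. As
    \<open>g\<close> fixes the first basis vector, only row 0 differs from the identity, by
    \<open>t\<close> times row \<open>\<iota>\<close> of \<open>g\<close>.\<close>
  define M where "M = mat n n (\<lambda>(r, c). (if r = c then 1 else 0) + (if r = 0 then t * g $$ (\<iota>, c) else 0))"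
  have Mc: "M \<in> carrier_mat n n" unfolding M_def by simp
  have eg: "el n 0 \<iota> t * g = g * M"
  proof (rule eq_matI)
    fix r c assume "r < dim_row (g * M)" "c < dim_col (g * M)"
    then have rc: "r < n" "c < n" using gc Mc by auto
    have "(g * M) $$ (r, c) = (\<Sum>u<n. g $$ (r, u) * M $$ (u, c))"
      by (rule index_mult_mat_sum[OF gc(1) Mc rc])
    also have "\<dots> = (\<Sum>u<n. (if u = c then g $$ (r, u) else 0) + (if u = 0 then g $$ (r, u) * (t * g $$ (\<iota>, c)) else 0))"
      using rc by (intro sum.cong refl) (auto simp: M_def algebra_simps)
    also have "\<dots> = g $$ (r, c) + g $$ (r, 0) * (t * g $$ (\<iota>, c))"
      unfolding sum.distrib using rc n by simp
    also have "\<dots> = (el n 0 \<iota> t * g) $$ (r, c)"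
      using \<iota> n rc gcol by (subst el_mult[OF gc(1)]) auto
    finally show "(el n 0 \<iota> t * g) $$ (r, c) = (g * M) $$ (r, c)" ..
  qed (use gc Mc in auto)
  have "det (el n 0 \<iota> t * g) = 1"
    using gc \<iota> by (simp add: det_mult[of _ n] det_el)
  then have detM: "det M = 1"
    unfolding eg using gc Mc by (simp add: det_mult[of g n])
  define W where "W = M * el n 1 0 s"
  define Z where "Z = el n 1 0 (- (s / z)) * W"
  have Wc: "W \<in> carrier_mat n n" "Z \<in> carrier_mat n n"
    unfolding W_def Z_def using Mc by auto
  have detZ: "det Z = 1"
    unfolding Z_def W_def using Mc detM by (simp add: det_mult[of _ n] det_el)
  have W: "W $$ (r, c) = M $$ (r, c) + (if c = 0 then s * M $$ (r, 1) else 0)" if "r < n" "c < n" for r c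
    unfolding W_def using that n Mc by (intro mult_el) auto
  have Z: "Z $$ (r, c) = W $$ (r, c) + (if r = 1 then - (s / z) * W $$ (0, c) else 0)" if "r < n" "c < n" for r c
    unfolding Z_def using that n Wc by (intro el_mult) auto
  have z0: "M $$ (0, 0) + s * M $$ (0, 1) = z"
    using n gcol[of \<iota>] \<iota> unfolding M_def z(1) by (simp add: algebra_simps)
  have "upper_triangular Z"
    unfolding upper_triangular_def
  proof (intro allI impI)
    fix r c assume "r < dim_row Z" "c < r"
    then have rc: "c < r" "r < n" using Wc by auto
    show "Z $$ (r, c) = 0"
    proof (cases "r = 1")
      case True
      then have "c = 0" using rc by simp
      have "Z $$ (1, 0) = M $$ (1, 0) + s * M $$ (1, 1) - (s / z) * (M $$ (0, 0) + s * M $$ (0, 1))"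
        using n by (simp add: Z W)
      also have "\<dots> = 0"
        unfolding z0 using z(2) n by (simp add: M_def)
      finally show ?thesis unfolding True \<open>c = 0\<close> .
    next
      case False
      then show ?thesis
        using rc n by (auto simp: Z W M_def)
    qed
  qed
  moreover have "diag_part n Z = coroot_elem n 1 z"
  proof (rule eq_matI)
    fix r c assume "r < dim_row (coroot_elem n 1 z)" "c < dim_col (coroot_elem n 1 z)"
    then have rc: "r < n" "c < n" by (auto simp: coroot_elem_def)
    have "Z $$ (0, 0) = z"
      using n z0 by (simp add: Z W)
    moreover have "Z $$ (1, 1) = inverse z"
    proof -
      have "Z $$ (1, 1) = 1 - (s / z) * (t * g $$ (\<iota>, 1))"
        using n by (simp add: Z W M_def)
      then show ?thesis
        using z by (simp add: field_simps)
    qed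
    moreover have "Z $$ (r, r) = 1" if "r \<noteq> 0" "r \<noteq> 1"
      using that rc by (simp add: Z W M_def)
    ultimately show "diag_part n Z $$ (r, c) = coroot_elem n 1 z $$ (r, c)"
      using rc by (auto simp: diag_part_def coroot_elem_def)
  qed (auto simp: diag_part_def coroot_elem_def)
  moreover have "el n 0 \<iota> t * g * el n 1 0 s = g * (el n 1 0 (s / z) * Z)"
  proof -
    have "el n 1 0 (s / z) * Z = W"
      unfolding Z_def using el_mult_cancel[of W n 1 0 "- (s / z)"] Wc n by simp
    then show ?thesis
      unfolding eg W_def using assoc_mult_mat[OF gc(1) Mc el_carrier] by simp
  qed
  ultimately show ?thesis
    using Wc detZ by (intro exI[of _ Z]) simp
qed

lemma straighten_last:
  fixes g :: "'a::field mat"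
  assumes n: "n \<ge> 3" and g: "g \<in> G_sub n (n - 1)" and \<iota>: "\<iota> \<in> {..<n - 1}"
    and z: "z = 1 + s * t * (inv\<^bsub>SL n\<^esub> g) $$ (n - 2, \<iota>)" "z \<noteq> 0"
  shows "\<exists>Z. Z \<in> carrier (SL n) \<and> upper_triangular Z \<and> diag_part n Z = coroot_elem n (n - 1) z \<and>
    el n \<iota> (n - 1) t * g * el n (n - 1) (n - 2) s = g * (el n (n - 1) (n - 2) (s / z) * Z)"
proof -
  interpret block n "n - 1" 0 "n - 1" by (rule block_last[OF n])
  define m where "m = n - 2"
  have nm: "n = Suc (Suc m)" "0 < m" unfolding m_def using n by auto
  define h where "h = inv\<^bsub>SL n\<^esub> g"
  have "agrees_off n 0 (Suc m) g" "agrees_off n 0 (Suc m) h"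
    using g G_sub_inv[OF g] unfolding G_sub_eq h_def by (auto simp: nm)
  then have gc: "g \<in> carrier_mat n n" "det g = 1" and hc: "h \<in> carrier_mat n n"
    and grow: "\<And>c. c < n \<Longrightarrow> g $$ (Suc m, c) = (if c = Suc m then 1 else 0)"
    and hrow: "\<And>c. c < n \<Longrightarrow> h $$ (Suc m, c) = (if c = Suc m then 1 else 0)"
    unfolding agrees_off_def by (auto simp: nm)
  have gh: "g * h = 1\<^sub>m n"
    using SL.r_inv[of g n] gc unfolding h_def by simp
  \<comment> \<open>Again the conjugate by \<open>g\<close>. The last row of \<open>g\<close> is a
    unit vector, so only the last column differs from the identity, by \<open>t\<close> times column
    \<open>\<iota>\<close> of the inverse \<open>h\<close>.\<close>
  define M where "M = mat n n (\<lambda>(r, c). (if r = c then 1 else 0) + (if c = Suc m then t * h $$ (r, \<iota>) else 0))"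
  have Mc: "M \<in> carrier_mat n n" unfolding M_def by simp
  have \<iota>m: "\<iota> < n" "\<iota> \<noteq> Suc m" using \<iota> nm by auto
  have eg: "el n \<iota> (Suc m) t * g = g * M"
  proof (rule eq_matI)
    fix r c assume "r < dim_row (g * M)" "c < dim_col (g * M)"
    then have rc: "r < n" "c < n" using gc Mc by auto
    have ghri: "(\<Sum>u<n. g $$ (r, u) * h $$ (u, \<iota>)) = (if r = \<iota> then 1 else 0)"
      using index_mult_mat_sum[OF gc(1) hc rc(1) \<iota>m(1)] rc \<iota>m unfolding gh by simp
    have "(g * M) $$ (r, c) = (\<Sum>u<n. g $$ (r, u) * M $$ (u, c))"
      by (rule index_mult_mat_sum[OF gc(1) Mc rc])
    also have "\<dots> = (\<Sum>u<n. (if u = c then g $$ (r, u) else 0) + (if c = Suc m then t else 0) * (g $$ (r, u) * h $$ (u, \<iota>)))"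
      using rc by (intro sum.cong refl) (auto simp: M_def algebra_simps)
    also have "\<dots> = g $$ (r, c) + (if c = Suc m then t else 0) * (if r = \<iota> then 1 else 0)"
      unfolding sum.distrib sum_distrib_left[symmetric] ghri using rc by simp
    also have "\<dots> = (el n \<iota> (Suc m) t * g) $$ (r, c)"
      using \<iota>m nm rc grow by (subst el_mult[OF gc(1)]) auto
    finally show "(el n \<iota> (Suc m) t * g) $$ (r, c) = (g * M) $$ (r, c)" ..
  qed (use gc Mc in auto)
  have "det (el n \<iota> (Suc m) t * g) = 1"
    using gc \<iota>m by (simp add: det_mult[of _ n] det_el)
  then have detM: "det M = 1"
    unfolding eg using gc Mc by (simp add: det_mult[of g n])
  define W where "W = M * el n (Suc m) m s"
  define Z where "Z = el n (Suc m) m (- (s / z)) * W"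
  have Wc: "W \<in> carrier_mat n n" "Z \<in> carrier_mat n n"
    unfolding W_def Z_def using Mc by auto
  have detZ: "det Z = 1"
    unfolding Z_def W_def using Mc detM by (simp add: det_mult[of _ n] det_el)
  have W: "W $$ (r, c) = M $$ (r, c) + (if c = m then s * M $$ (r, Suc m) else 0)" if "r < n" "c < n" for r c
    unfolding W_def using that nm Mc by (intro mult_el) auto
  have Z: "Z $$ (r, c) = W $$ (r, c) + (if r = Suc m then - (s / z) * W $$ (m, c) else 0)" if "r < n" "c < n" for r c
    unfolding Z_def using that nm Wc by (intro el_mult) auto
  have mn: "m < n" "Suc m < n" using nm by auto
  have z': "z = 1 + s * t * h $$ (m, \<iota>)"
    unfolding z(1) h_def m_def ..
  have W_m: "W $$ (m, c) = (if c = m then z else if c = Suc m then t * h $$ (m, \<iota>) else 0)" if "c < n" for c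
    using that mn by (auto simp: W M_def z' algebra_simps)
  have W_last: "W $$ (Suc m, c) = (if c = m then s else if c = Suc m then 1 else 0)" if "c < n" for c
    using that mn hrow[OF \<iota>m(1)] \<iota>m by (auto simp: W M_def)
  have "upper_triangular Z"
    unfolding upper_triangular_def
  proof (intro allI impI)
    fix r c assume "r < dim_row Z" "c < r"
    then have rc: "c < r" "r < n" "c < n" using Wc by auto
    show "Z $$ (r, c) = 0"
    proof (cases "r = Suc m")
      case True
      then show ?thesis
        using rc z(2) by (simp add: Z W_m W_last)
    next
      case False
      then have "c \<noteq> m" "c \<noteq> Suc m" using rc nm by auto
      then show ?thesis
        using rc False by (simp add: Z W M_def)
    qed
  qed
  moreover have "diag_part n Z = coroot_elem n (Suc m) z"
  proof (rule eq_matI)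
    fix r c assume "r < dim_row (coroot_elem n (Suc m) z)" "c < dim_col (coroot_elem n (Suc m) z)"
    then have rc: "r < n" "c < n" by (auto simp: coroot_elem_def)
    have "Z $$ (m, m) = z"
      using mn by (simp add: Z W_m)
    moreover have "Z $$ (Suc m, Suc m) = inverse z"
    proof -
      have "Z $$ (Suc m, Suc m) = 1 - (s / z) * (t * h $$ (m, \<iota>))"
        using mn by (simp add: Z W_m W_last)
      also have "\<dots> = (z - s * t * h $$ (m, \<iota>)) / z"
        using z(2) by (simp add: diff_divide_distrib)
      also have "\<dots> = inverse z"
        unfolding z' by (simp add: inverse_eq_divide)
      finally show ?thesis .
    qed
    moreover have "Z $$ (r, r) = 1" if "r \<noteq> m" "r \<noteq> Suc m"
      using that rc by (simp add: Z W M_def)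
    ultimately show "diag_part n Z $$ (r, c) = coroot_elem n (Suc m) z $$ (r, c)"
      using rc by (auto simp: diag_part_def coroot_elem_def)
  qed (auto simp: diag_part_def coroot_elem_def)
  moreover have "el n \<iota> (Suc m) t * g * el n (Suc m) m s = g * (el n (Suc m) m (s / z) * Z)"
  proof -
    have "el n (Suc m) m (s / z) * Z = W"
      unfolding Z_def using el_mult_cancel[of W n "Suc m" m "- (s / z)"] Wc mn by simp
    then show ?thesis
      unfolding eg W_def using assoc_mult_mat[OF gc(1) Mc el_carrier] by simp
  qed
  moreover have "n - 1 = Suc m" "n - 2 = m" using nm by auto
  ultimately show ?thesis
    using Wc detZ by (intro exI[of _ Z]) simp
qed

lemma sorted_list_omitting_one:
  assumes "sorted_wrt (<) I" "set I \<subseteq> {..<Suc m}" "length I = m"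
  shows "\<exists>\<iota><Suc m. I = [0..<\<iota>] @ [Suc \<iota>..<Suc m]"
proof -
  have "card (set I) = m"
    using assms by (simp add: distinct_card strict_sorted_iff)
  then have "card ({..<Suc m} - set I) = 1"
    using assms(2) by (simp add: card_Diff_subset)
  then obtain \<iota> where \<iota>: "{..<Suc m} - set I = {\<iota>}"
    by (auto simp: card_1_singleton_iff)
  then have "\<iota> < Suc m" "set I = {..<Suc m} - {\<iota>}"
    using assms(2) by auto
  moreover have "set ([0..<\<iota>] @ [Suc \<iota>..<Suc m]) = {..<Suc m} - {\<iota>}"
    using \<open>\<iota> < Suc m\<close> by auto
  moreover have "sorted_wrt (<) ([0..<\<iota>] @ [Suc \<iota>..<Suc m])"
    using \<open>\<iota> < Suc m\<close> by (auto simp: sorted_wrt_append)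
  ultimately show ?thesis
    using assms(1) strict_sorted_equal by metis
qed

text \<open>Entries of the inverse are cofactors of \<open>g\<close>. In the matrix left after the
  deletion the last row is a unit vector, so the cofactor reduces to a minor of the block in its
  first \<open>n - 2\<close> columns.\<close>

lemma minor_last:
  assumes n: "n \<ge> 3" and I: "sorted_wrt (<) I" "set I \<subseteq> {..<n - 1}" "length I = n - 2"
  shows "\<exists>\<iota>\<in>{..<n-1}. \<exists>z. \<forall>g\<in>G_sub n (n - 1). minor I 0 (blk 0 g) = z * (inv\<^bsub>SL n\<^esub> (g :: 'a::field mat)) $$ (n - 2, \<iota>)"
proof -
  interpret block n "n - 1" 0 "n - 1" by (rule block_last[OF n])
  define m where "m = n - 2"
  have nm: "n = Suc (Suc m)" "0 < m" unfolding m_def using n by auto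
  obtain \<iota> where \<iota>: "\<iota> < Suc m" "I = [0..<\<iota>] @ [Suc \<iota>..<Suc m]"
    using sorted_list_omitting_one[of I m] I nm by auto
  have nth: "I ! a = (if a < \<iota> then a else Suc a)" if "a < m" for a
    using that \<iota> by (auto simp: nth_append)
  have len: "length I = m" using I(3) nm by simp
  have "minor I 0 (blk 0 g) = (-1) ^ (\<iota> + m) * (inv\<^bsub>SL n\<^esub> g) $$ (m, \<iota>)" if g: "g \<in> G_sub n (n - 1)" for g :: "'a mat"
  proof -
    have "agrees_off n 0 (Suc m) g"
      using g unfolding G_sub_eq by (simp add: nm)
    then have gc: "g \<in> carrier_mat n n" "det g = 1"
      and grow: "\<And>c. c < n \<Longrightarrow> g $$ (Suc m, c) = (if c = Suc m then 1 else 0)"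
      unfolding agrees_off_def by (auto simp: nm)
    define A where "A = mat_delete g \<iota> m"
    have A: "A \<in> carrier_mat (Suc m) (Suc m)"
      unfolding A_def using gc nm by (auto simp: mat_delete_def)
    have Aix: "A $$ (r, c) = g $$ (if r < \<iota> then r else Suc r, if c < m then c else Suc c)" if "r < Suc m" "c < Suc m" for r c
      unfolding A_def mat_delete_def using that gc nm by auto
    have "det A = (\<Sum>c<Suc m. A $$ (m, c) * cofactor A m c)"
      by (rule laplace_expansion_row[OF A]) simp
    also have "\<dots> = (\<Sum>c\<in>{m}. A $$ (m, c) * cofactor A m c)"
      using \<iota>(1) nm by (intro sum.mono_neutral_right) (auto simp: Aix grow)
    also have "\<dots> = cofactor A m m"
      using \<iota>(1) nm by (simp add: Aix grow)
    also have "\<dots> = det (mat_delete A m m)"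
      by (simp add: cofactor_def)
    also have "mat_delete A m m = mat m m (\<lambda>(a, b). blk 0 g (I ! a, 0 + b))"
      by (rule eq_matI) (use A in \<open>auto simp: mat_delete_def Aix nth blk_def\<close>)
    finally have detA: "det A = minor I 0 (blk 0 g)"
      unfolding minor_def len .
    have "(inv\<^bsub>SL n\<^esub> g) $$ (m, \<iota>) = cofactor g \<iota> m"
      unfolding SL_inv_eq_adj[OF gc] adj_mat_def using gc nm \<iota>(1) by auto
    also have "\<dots> = (-1) ^ (\<iota> + m) * minor I 0 (blk 0 g)"
      unfolding cofactor_def A_def[symmetric] detA ..
    finally show ?thesis
      by (simp add: mult.assoc[symmetric] power_add[symmetric] mult_2[symmetric])
  qed
  then have "\<forall>g\<in>G_sub n (n - 1). minor I 0 (blk 0 g) = (-1) ^ (\<iota> + m) * (inv\<^bsub>SL n\<^esub> (g :: 'a mat)) $$ (n - 2, \<iota>)"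
    unfolding m_def by blast
  moreover have "\<iota> \<in> {..<n - 1}"
    using \<iota>(1) nm by simp
  ultimately show ?thesis by blast
qed

theorem theoremA:
  fixes n p k :: nat
    and \<omega> :: "'a::alg_closed_field mat \<Rightarrow> 'a"
    and L :: "('a, 'v::ab_group_add) repn"
    and v :: 'v
  assumes "CHAR('a) = p" and "p > 0"
    and "n \<ge> 3"
    and "\<omega> \<in> dominant_weights n"
    and "k \<in> {0..p - 1}"
    and "is_simple_hw_module n \<omega> L"
    and "v \<in> weight_space (torus n) L \<omega>" and "v \<noteq> 0"
  shows
    "((\<forall>l::nat. l < k \<longrightarrow> [pairing n \<omega> 1 - int l \<noteq> 0] (mod int p)) \<and>
      (\<exists>m\<in>{0..k}. simple_module (G_sub n 1)
         (weyl_module n (G_sub n 1) (B_sub n 1)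
            (restrict \<omega> (T_sub n 1) * restrict (fund_weight 2) (T_sub n 1) ^ m)))
      \<longrightarrow> module_isomorphic (G_sub n 1)
            (generated_submodule (G_sub n 1) L (divided_power n L 2 1 k v))
            (weyl_module n (G_sub n 1) (B_sub n 1)
               (restrict \<omega> (T_sub n 1) * restrict (fund_weight 2) (T_sub n 1) ^ k)))
     \<and>
     ((\<forall>l::nat. l < k \<longrightarrow> [pairing n \<omega> (n - 1) - int l \<noteq> 0] (mod int p)) \<and>
      (\<exists>m\<in>{0..k}. simple_module (G_sub n (n - 1))
         (weyl_module n (G_sub n (n - 1)) (B_sub n (n - 1))
            (restrict \<omega> (T_sub n (n - 1)) * restrict (fund_weight (n - 2)) (T_sub n (n - 1)) ^ m)))
      \<longrightarrow> module_isomorphic (G_sub n (n - 1))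
            (generated_submodule (G_sub n (n - 1)) L (divided_power n L n (n - 1) k v))
            (weyl_module n (G_sub n (n - 1)) (B_sub n (n - 1))
               (restrict \<omega> (T_sub n (n - 1)) * restrict (fund_weight (n - 2)) (T_sub n (n - 1)) ^ k)))"
proof -
  interpret hw_module n L \<omega> v
    using assms(4,6,7) unfolding is_simple_hw_module_def dominant_weights_def
    by unfold_locales auto
  \<comment> \<open>The congruences modulo p become invertibility in the field, whose characteristic
    is p.\<close>
  have nonzero: "of_int (a - int r) \<noteq> (0 :: 'a)"
    if "\<forall>l::nat. l < k \<longrightarrow> [a - int l \<noteq> 0] (mod int p)" "r < k" for a r
  proof -
    have "\<not> int CHAR('a) dvd a - int r"
      using that assms(1) by (auto simp: cong_0_iff)
    then show ?thesis
      unfolding of_int_eq_0_iff_char_dvd .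
  qed
  have n: "n \<ge> 3" by (rule assms(3))
  show ?thesis
  proof (intro conjI impI)
    assume asm: "(\<forall>l::nat. l < k \<longrightarrow> [pairing n \<omega> 1 - int l \<noteq> 0] (mod int p)) \<and>
      (\<exists>m\<in>{0..k}. simple_module (G_sub n 1)
         (weyl_module n (G_sub n 1) (B_sub n 1)
            (restrict \<omega> (T_sub n 1) * restrict (fund_weight 2) (T_sub n 1) ^ m)))"
    interpret block n 1 1 "n - 1" by (rule block_first[OF n])
    interpret block_hw n 1 1 "n - 1" L \<omega> v
      by unfold_locales (use assms in auto)
    from asm obtain m where m: "m \<le> k"
      "simple_module (G_sub n 1) (weyl_module n (G_sub n 1) (B_sub n 1) (level_weight 2 m))"
      unfolding level_weight_def by auto
    have "module_isomorphic (G_sub n 1)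
        (generated_submodule (G_sub n 1) L (divided_power n L (Suc 1) (Suc 0) k v))
        (weyl_module n (G_sub n 1) (B_sub n 1) (level_weight 2 k))"
    \<comment> \<open>On this corner \<open>\<omega>\<^sub>2\<close> is the first fundamental weight
      of the block, so the relevant minors have one row: they are the entries of the first column of
      the block.\<close>
    proof (rule Weyl_in_restriction[where c = 1 and l = 1 and J = "{1..<n}"
          and x = "el n 0" and \<phi> = "\<lambda>\<iota> g. g $$ (\<iota>, 1)"])
      fix t :: "'a mat" assume t: "t \<in> T_sub n 1"
      have "t $$ (0, 0) = 1"
        using T_sub_in_G_sub[OF t] n unfolding G_sub_eq agrees_off_def by auto
      then show "t $$ (1, 1) = fund_weight 2 t * t $$ (0, 0)"
        by (simp add: fund_weight_def numeral_2_eq_2)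
    next
      fix s and z :: 'a assume "Suc s < n - 1" "z \<noteq> 0"
      then show "fund_weight 2 (coroot_elem n (Suc (1 + s)) z) = (if Suc s = 1 then z else 1)"
        using n by (simp add: fund_weight_def numeral_2_eq_2 coroot_elem_def)
    next
      fix I :: "nat list" assume "set I \<subseteq> {..<n - 1}" "length I = 1"
      then obtain i where "I = [i]" "i < n - 1"
        by (auto simp: length_Suc_conv)
      then show "\<exists>\<iota>\<in>{1..<n}. \<exists>z. \<forall>g\<in>G_sub n 1. minor I 0 (blk 1 g) = z * (g :: 'a mat) $$ (\<iota>, 1)"
        by (intro bexI[of _ "Suc i"] exI[of _ 1]) (auto simp: minor_def det_single blk_def)
    next
      show "\<exists>\<iota>\<in>{1..<n}. 1\<^sub>m n $$ (\<iota>, 1) = (1 :: 'a)"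
        using n by (intro bexI[of _ 1]) auto
    next
      fix \<iota> s t z and g :: "'a mat"
      assume "\<iota> \<in> {1..<n}" "g \<in> G_sub n 1" "z = 1 + s * t * g $$ (\<iota>, 1)" "z \<noteq> 0"
      then show "\<exists>Z. Z \<in> carrier (SL n) \<and> upper_triangular Z \<and> diag_part n Z = coroot_elem n 1 z \<and>
          el n 0 \<iota> t * g * el n 1 0 s = g * (el n 1 0 (s / z) * Z)"
        using straighten_first[OF n] by blast
    next
      fix r :: nat assume "r < k"
      then show "of_int (pairing n \<omega> 1 - int r) \<noteq> (0 :: 'a)"
        by (rule nonzero[OF conjunct1[OF asm]])
    qed (use n m in \<open>auto intro: poly_curve_el\<close>)
    then show "module_isomorphic (G_sub n 1)
        (generated_submodule (G_sub n 1) L (divided_power n L 2 1 k v))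
        (weyl_module n (G_sub n 1) (B_sub n 1)
          (restrict \<omega> (T_sub n 1) * restrict (fund_weight 2) (T_sub n 1) ^ k))"
      unfolding level_weight_def by (simp add: numeral_2_eq_2)
  next
    assume asm: "(\<forall>l::nat. l < k \<longrightarrow> [pairing n \<omega> (n - 1) - int l \<noteq> 0] (mod int p)) \<and>
      (\<exists>m\<in>{0..k}. simple_module (G_sub n (n - 1))
         (weyl_module n (G_sub n (n - 1)) (B_sub n (n - 1))
            (restrict \<omega> (T_sub n (n - 1)) * restrict (fund_weight (n - 2)) (T_sub n (n - 1)) ^ m)))"
    interpret block n "n - 1" 0 "n - 1" by (rule block_last[OF n])
    interpret block_hw n "n - 1" 0 "n - 1" L \<omega> v
      by unfold_locales (use assms in auto)
    from asm obtain m where m: "m \<le> k" "simple_module (G_sub n (n - 1))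
        (weyl_module n (G_sub n (n - 1)) (B_sub n (n - 1)) (level_weight (n - 2) m))"
      unfolding level_weight_def by auto
    have Suc_n: "Suc (n - 1) = n" "Suc (n - 2) = n - 1"
      using n by auto
    have "module_isomorphic (G_sub n (n - 1))
        (generated_submodule (G_sub n (n - 1)) L (divided_power n L (Suc (n - 1)) (Suc (n - 2)) k v))
        (weyl_module n (G_sub n (n - 1)) (B_sub n (n - 1)) (level_weight (n - 2) k))"
    \<comment> \<open>Here the added weight is the last fundamental weight of the block of size
      \<open>n - 1\<close>. Its minors omit one row and the last column, and up to sign they are
      entries of the inverse.\<close>
    proof (rule Weyl_in_restriction[where c = "n - 2" and l = "n - 1" and J = "{..<n - 1}"
          and x = "\<lambda>\<iota>. el n \<iota> (n - 1)" and \<phi> = "\<lambda>\<iota> g. (inv\<^bsub>SL n\<^esub> g) $$ (n - 2, \<iota>)"])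
      fix t :: "'a mat" assume t: "t \<in> T_sub n (n - 1)"
      have "t $$ (n - 1, n - 1) = 1"
        using T_sub_in_G_sub[OF t] n unfolding G_sub_eq agrees_off_def by auto
      moreover have "(\<Prod>r<n. t $$ (r, r)) = t $$ (n - 1, n - 1) * (t $$ (n - 2, n - 2) * fund_weight (n - 2) t)"
      proof -
        obtain l where "n = Suc (Suc l)"
          using n by (metis Suc_n)
        then show ?thesis by (simp add: fund_weight_def mult.commute mult.left_commute)
      qed
      ultimately show "t $$ (n - 1, n - 1) = fund_weight (n - 2) t * t $$ (n - 2, n - 2)"
        using torus_simps(4)[OF T_sub_torus[OF t]] by (simp add: mult.commute)
    next
      fix s and z :: 'a assume s: "Suc s < n - 1" and "z \<noteq> 0"
      show "fund_weight (n - 2) (coroot_elem n (Suc (0 + s)) z) = (if Suc s = n - 2 then z else 1)"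
      proof (cases "Suc s = n - 2")
        case True
        have "fund_weight (n - 2) (coroot_elem n (Suc (0 + s)) z) = (\<Prod>r<n - 2. if r = s then z else 1)"
          unfolding fund_weight_def using s True by (intro prod.cong refl) (auto simp: coroot_elem_def)
        then show ?thesis using True by simp
      next
        case False
        have "fund_weight (n - 2) (coroot_elem n (Suc (0 + s)) z)
            = (\<Prod>r\<in>{s, Suc s}. coroot_elem n (Suc (0 + s)) z $$ (r, r))"
          unfolding fund_weight_def using s False
          by (intro prod.mono_neutral_right) (auto simp: coroot_elem_def split: if_splits)
        also have "\<dots> = 1"
          using s \<open>z \<noteq> 0\<close> by (simp add: coroot_elem_def)
        finally show ?thesis using False by simp
      qed
    next
      fix I :: "nat list" assume "sorted_wrt (<) I" "set I \<subseteq> {..<n - 1}" "length I = n - 2"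
      then show "\<exists>\<iota>\<in>{..<n - 1}. \<exists>z. \<forall>g\<in>G_sub n (n - 1). minor I 0 (blk 0 g) = z * (inv\<^bsub>SL n\<^esub> (g :: 'a mat)) $$ (n - 2, \<iota>)"
        by (rule minor_last[OF n])
    next
      have "inv\<^bsub>SL n\<^esub> (1\<^sub>m n) = (1\<^sub>m n :: 'a mat)"
        using SL.inv_one[of n] by simp
      then show "\<exists>\<iota>\<in>{..<n - 1}. (inv\<^bsub>SL n\<^esub> (1\<^sub>m n)) $$ (n - 2, \<iota>) = (1 :: 'a)"
        using n by (intro bexI[of _ "n - 2"]) auto
    next
      fix \<iota> s t z and g :: "'a mat"
      assume "\<iota> \<in> {..<n - 1}" "g \<in> G_sub n (n - 1)" "z = 1 + s * t * (inv\<^bsub>SL n\<^esub> g) $$ (n - 2, \<iota>)" "z \<noteq> 0"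
      then show "\<exists>Z. Z \<in> carrier (SL n) \<and> upper_triangular Z \<and> diag_part n Z = coroot_elem n (n - 1) z \<and>
          el n \<iota> (n - 1) t * g * el n (n - 1) (n - 2) s = g * (el n (n - 1) (n - 2) (s / z) * Z)"
        using straighten_last[OF n] by blast
    next
      fix r :: nat assume "r < k"
      then show "of_int (pairing n \<omega> (n - 1) - int r) \<noteq> (0 :: 'a)"
        by (rule nonzero[OF conjunct1[OF asm]])
    next
      fix \<iota> assume "\<iota> \<in> {..<n - 1}"
      then show "poly_curve n (el n \<iota> (n - 1) :: 'a \<Rightarrow> _)"
        by (intro poly_curve_el) simp
    qed (use n m in auto)
    then show "module_isomorphic (G_sub n (n - 1))
        (generated_submodule (G_sub n (n - 1)) L (divided_power n L n (n - 1) k v))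
        (weyl_module n (G_sub n (n - 1)) (B_sub n (n - 1))
          (restrict \<omega> (T_sub n (n - 1)) * restrict (fund_weight (n - 2)) (T_sub n (n - 1)) ^ k))"
      unfolding level_weight_def Suc_n .
  qed
qed

end
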